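(* Let $k$ be a commutative artinian ring with unit and let $\mathcal{C}$ be a skeletally small Hom-finite $k$-linear abelian category having Serre duality, with Auslander-Reiten translation $\tau$. Then a morphism $\alpha\colon X\to Y$ in $\mathcal{C}$ is right determined by some object if and only if it is an epimorphism, in which case $\alpha$ is right determined by $\tau^{-1}(\mathrm{Ker}\,\alpha)$. Dually, a morphism $\beta\colon Y\to Z$ in $\mathcal{C}$ is left determined by some object if and only if it is a monomorphism, in which case $\beta$ is left determined by $\tau(\mathrm{Cok}\,\beta)$.
   Context: Let $k\text{-mod}$ be the category of finitely generated $k$-modules, $E$ the minimal injective cogenerator of $k$, and $D=\mathrm{Hom}_k(-,E)$ the resulting duality on $k\text{-mod}$. A $k$-linear category is Hom-finite if every $\mathrm{Hom}_\mathcal{C}(X,Y)$ is a finitely generated $k$-module; it is skeletally small if the isomorphism classes of objects form a set. A Hom-finite $k$-linear abelian category $\mathcal{C}$ has Serre duality if there is a $k$-linear auto-equivalence $\tau\colon\mathcal{C}\to\mathcal{C}$ together with a functorial isomorphism $D\,\mathrm{Ext}^1_\mathcal{C}(X,Y)\simeq \mathrm{Hom}_\mathcal{C}(Y,\tau(X))$ for all objects $X,Y$; $\tau$ is called the Auslander-Reiten translation, and $\tau^{-1}$ denotes a quasi-inverse of $\tau$. For a morphism $\alpha\colon X\to Y$ and an object $C$, $\mathrm{Im}\,\mathrm{Hom}_\mathcal{C}(C,\alpha)\subseteq\mathrm{Hom}_\mathcal{C}(C,Y)$ denotes the image of the induced map $\mathrm{Hom}_\mathcal{C}(C,X)\to\mathrm{Hom}_\mathcal{C}(C,Y)$.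 The morphism $\alpha$ is right determined by $C$ if every $t\colon T\to Y$ with $\mathrm{Im}\,\mathrm{Hom}_\mathcal{C}(C,t)\subseteq\mathrm{Im}\,\mathrm{Hom}_\mathcal{C}(C,\alpha)$ factors as $t=\alpha\circ t'$ for some $t'\colon T\to X$. A morphism $\beta$ is left determined by $C$ if, viewed as a morphism in $\mathcal{C}^{\rm op}$, it is right determined by $C$. $\mathrm{Ker}$ and $\mathrm{Cok}$ denote kernel and cokernel. *)

theory Defs
  imports "HOL-Algebra.Module" "HOL-Algebra.Ideal" "HOL-Library.FuncSet"
begin

section \<open>Modules over a commutative artinian ring\<close>

locale artinian_cring = cring R for R (structure) +
  assumes dcc: "\<lbrakk>\<And>n::nat. ideal (I n) R; \<And>n. I (Suc n) \<subseteq> I n\<rbrakk> \<Longrightarrow> \<exists>N. \<forall>n\<ge>N. I n = I N"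

definition finitely_generated_module ::
  "('k, 'x) ring_scheme \<Rightarrow> ('k, 'a, 'y) module_scheme \<Rightarrow> bool" where
  "finitely_generated_module R M \<longleftrightarrow> module R M \<and>
     (\<exists>S. finite S \<and> S \<subseteq> carrier M \<and>
        (\<forall>N. submodule N R M \<and> S \<subseteq> N \<longrightarrow> N = carrier M))"

text \<open>Linear maps are taken to be extensional, so that equality of linear maps is equality
  of functions; this makes \<open>Hom_module\<close> below an honest module.\<close>

definition linear_maps ::
  "('k, 'x) ring_scheme \<Rightarrow> ('k, 'a, 'y) module_scheme \<Rightarrow> ('k, 'b, 'z) module_scheme \<Rightarrow> ('a \<Rightarrow> 'b) set" where
  "linear_maps R M N = {f \<in> carrier M \<rightarrow>\<^sub>E carrier N.
     (\<forall>x\<in>carrier M. \<forall>y\<in>carrier M. f (x \<oplus>\<^bsub>M\<^esub> y) = f x \<oplus>\<^bsub>N\<^esub> f y) \<and>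
     (\<forall>r\<in>carrier R. \<forall>x\<in>carrier M. f (r \<odot>\<^bsub>M\<^esub> x) = r \<odot>\<^bsub>N\<^esub> f x)}"

text \<open>The fields \<open>mult\<close> and \<open>one\<close> of a module record play no role for modules.\<close>

definition Hom_module ::
  "('k, 'x) ring_scheme \<Rightarrow> ('k, 'a, 'y) module_scheme \<Rightarrow> ('k, 'b, 'z) module_scheme \<Rightarrow> ('k, 'a \<Rightarrow> 'b) module" where
  "Hom_module R M N = \<lparr>
     carrier = linear_maps R M N,
     mult = undefined, one = undefined,
     zero = (\<lambda>x\<in>carrier M. \<zero>\<^bsub>N\<^esub>),
     add = (\<lambda>f g. \<lambda>x\<in>carrier M. f x \<oplus>\<^bsub>N\<^esub> g x),
     smult = (\<lambda>r f. \<lambda>x\<in>carrier M. r \<odot>\<^bsub>N\<^esub> f x)\<rparr>"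

text \<open>A HOL predicate cannot quantify over modules of all carrier types, so injectivity and the
  cogenerator property are relative to test modules whose carrier lies in a given type \<open>'n\<close>.
  The type \<open>'k list set\<close>, used for \<open>minimal_injective_cogenerator\<close>, is large enough: it
  contains a copy of every finitely generated module (a quotient of a module of lists of fixed
  length), in particular of the ideals of \<open>R\<close> and of the cyclic modules. By Baer's criterion,
  injectivity relative to it is injectivity; and a module that separates the points of cyclic
  modules and is injective separates the points of every module.\<close>

definition injective_module ::
  "'n itself \<Rightarrow> ('k, 'x) ring_scheme \<Rightarrow> ('k, 'e, 'y) module_scheme \<Rightarrow> bool" where
  "injective_module TYPE('n) R E \<longleftrightarrow> module R E \<and>
     (\<forall>(M :: ('k, 'n) module) (N :: ('k, 'n) module). \<forall>j \<in> linear_maps R M N. \<forall>f \<in> linear_maps R M E.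
        module R M \<and> module R N \<and> inj_on j (carrier M) \<longrightarrow>
        (\<exists>g \<in> linear_maps R N E. \<forall>x\<in>carrier M. g (j x) = f x))"

definition cogenerator_module ::
  "'n itself \<Rightarrow> ('k, 'x) ring_scheme \<Rightarrow> ('k, 'e, 'y) module_scheme \<Rightarrow> bool" where
  "cogenerator_module TYPE('n) R E \<longleftrightarrow> module R E \<and>
     (\<forall>M :: ('k, 'n) module. module R M \<longrightarrow>
        (\<forall>x\<in>carrier M. x \<noteq> \<zero>\<^bsub>M\<^esub> \<longrightarrow> (\<exists>f \<in> linear_maps R M E. f x \<noteq> \<zero>\<^bsub>E\<^esub>)))"

definition injective_cogenerator ::
  "('k, 'x) ring_scheme \<Rightarrow> ('k, 'e, 'y) module_scheme \<Rightarrow> bool" where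
  "injective_cogenerator R E \<longleftrightarrow>
     injective_module TYPE('k list set) R E \<and> cogenerator_module TYPE('k list set) R E"

definition minimal_injective_cogenerator ::
  "('k, 'x) ring_scheme \<Rightarrow> ('k, 'e, 'y) module_scheme \<Rightarrow> bool" where
  "minimal_injective_cogenerator R E \<longleftrightarrow> injective_cogenerator R E \<and>
     (\<forall>N. submodule N R E \<and> injective_cogenerator R (E\<lparr>carrier := N\<rparr>) \<longrightarrow> N = carrier E)"


section \<open>Linear categories\<close>

text \<open>Objects form a HOL set, so isomorphism classes of objects do as well: every category in the
  sense below is skeletally small. Hom-sets are recovered as morphisms with given domain and
  codomain; on each of them \<open>Zero\<close>, \<open>Plus\<close> and \<open>Scal\<close> give the module structure (see \<open>HomMod\<close>).\<close>

record ('k, 'o, 'm) lincat =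
  Obj :: "'o set"
  Arr :: "'m set"
  Dom :: "'m \<Rightarrow> 'o"
  Cod :: "'m \<Rightarrow> 'o"
  Ide :: "'o \<Rightarrow> 'm"
  Comp :: "'m \<Rightarrow> 'm \<Rightarrow> 'm"  (infixr \<open>\<bullet>\<index>\<close> 75)
  Zero :: "'o \<Rightarrow> 'o \<Rightarrow> 'm"
  Plus :: "'m \<Rightarrow> 'm \<Rightarrow> 'm"  (infixl \<open>\<boxplus>\<index>\<close> 65)
  Scal :: "'k \<Rightarrow> 'm \<Rightarrow> 'm"

definition Hom :: "('k, 'o, 'm, 'z) lincat_scheme \<Rightarrow> 'o \<Rightarrow> 'o \<Rightarrow> 'm set" where
  "Hom C X Y = {f \<in> Arr C. Dom C f = X \<and> Cod C f = Y}"

definition HomMod :: "('k, 'o, 'm, 'z) lincat_scheme \<Rightarrow> 'o \<Rightarrow> 'o \<Rightarrow> ('k, 'm) module" where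
  "HomMod C X Y = \<lparr>carrier = Hom C X Y, mult = undefined, one = undefined,
     zero = Zero C X Y, add = Plus C, smult = Scal C\<rparr>"

definition opposite :: "('k, 'o, 'm) lincat \<Rightarrow> ('k, 'o, 'm) lincat" where
  "opposite C = \<lparr>Obj = Obj C, Arr = Arr C, Dom = Cod C, Cod = Dom C, Ide = Ide C,
     Comp = (\<lambda>g f. f \<bullet>\<^bsub>C\<^esub> g), Zero = (\<lambda>X Y. Zero C Y X), Plus = Plus C, Scal = Scal C\<rparr>"

locale category =
  fixes C :: "('k, 'o, 'm) lincat" (structure)
  assumes Dom_Obj: "f \<in> Arr C \<Longrightarrow> Dom C f \<in> Obj C"
    and Cod_Obj: "f \<in> Arr C \<Longrightarrow> Cod C f \<in> Obj C"
    and Ide_Hom: "X \<in> Obj C \<Longrightarrow> Ide C X \<in> Hom C X X"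
    and Comp_Hom: "\<lbrakk>f \<in> Hom C X Y; g \<in> Hom C Y Z\<rbrakk> \<Longrightarrow> g \<bullet> f \<in> Hom C X Z"
    and Comp_Ide: "f \<in> Hom C X Y \<Longrightarrow> f \<bullet> Ide C X = f"
    and Ide_Comp: "f \<in> Hom C X Y \<Longrightarrow> Ide C Y \<bullet> f = f"
    and Comp_assoc: "\<lbrakk>f \<in> Hom C W X; g \<in> Hom C X Y; h \<in> Hom C Y Z\<rbrakk> \<Longrightarrow> h \<bullet> (g \<bullet> f) = (h \<bullet> g) \<bullet> f"

locale linear_category = category C + K: cring k
  for k :: "('k, 'x) ring_scheme" and C :: "('k, 'o, 'm) lincat" (structure) +
  assumes HomMod_module: "\<lbrakk>X \<in> Obj C; Y \<in> Obj C\<rbrakk> \<Longrightarrow> module k (HomMod C X Y)"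
    and Comp_Plus_right:
      "\<lbrakk>f \<in> Hom C X Y; f' \<in> Hom C X Y; g \<in> Hom C Y Z\<rbrakk> \<Longrightarrow> g \<bullet> (f \<boxplus> f') = g \<bullet> f \<boxplus> g \<bullet> f'"
    and Comp_Plus_left:
      "\<lbrakk>f \<in> Hom C X Y; g \<in> Hom C Y Z; g' \<in> Hom C Y Z\<rbrakk> \<Longrightarrow> (g \<boxplus> g') \<bullet> f = g \<bullet> f \<boxplus> g' \<bullet> f"
    and Comp_Scal_right:
      "\<lbrakk>r \<in> carrier k; f \<in> Hom C X Y; g \<in> Hom C Y Z\<rbrakk> \<Longrightarrow> g \<bullet> Scal C r f = Scal C r (g \<bullet> f)"
    and Comp_Scal_left:
      "\<lbrakk>r \<in> carrier k; f \<in> Hom C X Y; g \<in> Hom C Y Z\<rbrakk> \<Longrightarrow> Scal C r g \<bullet> f = Scal C r (g \<bullet> f)"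

definition hom_finite :: "('k, 'x) ring_scheme \<Rightarrow> ('k, 'o, 'm) lincat \<Rightarrow> bool" where
  "hom_finite k C \<longleftrightarrow> (\<forall>X\<in>Obj C. \<forall>Y\<in>Obj C. finitely_generated_module k (HomMod C X Y))"


section \<open>Abelian categories\<close>

definition monomorphism :: "('k, 'o, 'm) lincat \<Rightarrow> 'm \<Rightarrow> bool" where
  "monomorphism C m \<longleftrightarrow> m \<in> Arr C \<and>
     (\<forall>T. \<forall>f\<in>Hom C T (Dom C m). \<forall>g\<in>Hom C T (Dom C m). m \<bullet>\<^bsub>C\<^esub> f = m \<bullet>\<^bsub>C\<^esub> g \<longrightarrow> f = g)"

definition epimorphism :: "('k, 'o, 'm) lincat \<Rightarrow> 'm \<Rightarrow> bool" where
  "epimorphism C e \<longleftrightarrow> e \<in> Arr C \<and>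
     (\<forall>T. \<forall>f\<in>Hom C (Cod C e) T. \<forall>g\<in>Hom C (Cod C e) T. f \<bullet>\<^bsub>C\<^esub> e = g \<bullet>\<^bsub>C\<^esub> e \<longrightarrow> f = g)"

definition isomorphism :: "('k, 'o, 'm) lincat \<Rightarrow> 'm \<Rightarrow> bool" where
  "isomorphism C f \<longleftrightarrow> f \<in> Arr C \<and> (\<exists>g\<in>Hom C (Cod C f) (Dom C f).
     g \<bullet>\<^bsub>C\<^esub> f = Ide C (Dom C f) \<and> f \<bullet>\<^bsub>C\<^esub> g = Ide C (Cod C f))"

definition zero_object :: "('k, 'o, 'm) lincat \<Rightarrow> 'o \<Rightarrow> bool" where
  "zero_object C Z \<longleftrightarrow> Z \<in> Obj C \<and>
     (\<forall>X\<in>Obj C. (\<exists>!f. f \<in> Hom C X Z) \<and> (\<exists>!f. f \<in> Hom C Z X))"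

definition is_kernel :: "('k, 'o, 'm) lincat \<Rightarrow> 'm \<Rightarrow> 'm \<Rightarrow> bool" where
  "is_kernel C f i \<longleftrightarrow> f \<in> Arr C \<and> i \<in> Arr C \<and> Cod C i = Dom C f \<and>
     f \<bullet>\<^bsub>C\<^esub> i = Zero C (Dom C i) (Cod C f) \<and>
     (\<forall>T\<in>Obj C. \<forall>t\<in>Hom C T (Dom C f). f \<bullet>\<^bsub>C\<^esub> t = Zero C T (Cod C f) \<longrightarrow>
        (\<exists>!u. u \<in> Hom C T (Dom C i) \<and> i \<bullet>\<^bsub>C\<^esub> u = t))"

definition is_cokernel :: "('k, 'o, 'm) lincat \<Rightarrow> 'm \<Rightarrow> 'm \<Rightarrow> bool" where
  "is_cokernel C f p \<longleftrightarrow> f \<in> Arr C \<and> p \<in> Arr C \<and> Dom C p = Cod C f \<and>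
     p \<bullet>\<^bsub>C\<^esub> f = Zero C (Dom C f) (Cod C p) \<and>
     (\<forall>T\<in>Obj C. \<forall>t\<in>Hom C (Cod C f) T. t \<bullet>\<^bsub>C\<^esub> f = Zero C (Dom C f) T \<longrightarrow>
        (\<exists>!u. u \<in> Hom C (Cod C p) T \<and> u \<bullet>\<^bsub>C\<^esub> p = t))"

definition is_biproduct ::
  "('k, 'o, 'm) lincat \<Rightarrow> 'o \<Rightarrow> 'o \<Rightarrow> 'o \<Rightarrow> 'm \<Rightarrow> 'm \<Rightarrow> 'm \<Rightarrow> 'm \<Rightarrow> bool" where
  "is_biproduct C X Y B jX jY qX qY \<longleftrightarrow>
     X \<in> Obj C \<and> Y \<in> Obj C \<and> B \<in> Obj C \<and>
     jX \<in> Hom C X B \<and> jY \<in> Hom C Y B \<and> qX \<in> Hom C B X \<and> qY \<in> Hom C B Y \<and>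
     qX \<bullet>\<^bsub>C\<^esub> jX = Ide C X \<and> qY \<bullet>\<^bsub>C\<^esub> jY = Ide C Y \<and>
     qX \<bullet>\<^bsub>C\<^esub> jY = Zero C Y X \<and> qY \<bullet>\<^bsub>C\<^esub> jX = Zero C X Y \<and>
     jX \<bullet>\<^bsub>C\<^esub> qX \<boxplus>\<^bsub>C\<^esub> jY \<bullet>\<^bsub>C\<^esub> qY = Ide C B"

definition is_pullback :: "('k, 'o, 'm) lincat \<Rightarrow> 'm \<Rightarrow> 'm \<Rightarrow> 'm \<Rightarrow> 'm \<Rightarrow> bool" where
  "is_pullback C f p f' p' \<longleftrightarrow> f \<in> Arr C \<and> p \<in> Arr C \<and> f' \<in> Arr C \<and> p' \<in> Arr C \<and>
     Cod C f = Cod C p \<and> Dom C f' = Dom C p' \<and> Cod C p' = Dom C f \<and> Cod C f' = Dom C p \<and>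
     f \<bullet>\<^bsub>C\<^esub> p' = p \<bullet>\<^bsub>C\<^esub> f' \<and>
     (\<forall>T\<in>Obj C. \<forall>a\<in>Hom C T (Dom C f). \<forall>b\<in>Hom C T (Dom C p). f \<bullet>\<^bsub>C\<^esub> a = p \<bullet>\<^bsub>C\<^esub> b \<longrightarrow>
        (\<exists>!u. u \<in> Hom C T (Dom C p') \<and> p' \<bullet>\<^bsub>C\<^esub> u = a \<and> f' \<bullet>\<^bsub>C\<^esub> u = b))"

definition is_pushout :: "('k, 'o, 'm) lincat \<Rightarrow> 'm \<Rightarrow> 'm \<Rightarrow> 'm \<Rightarrow> 'm \<Rightarrow> bool" where
  "is_pushout C h i h' i' \<longleftrightarrow> h \<in> Arr C \<and> i \<in> Arr C \<and> h' \<in> Arr C \<and> i' \<in> Arr C \<and>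
     Dom C h = Dom C i \<and> Cod C h' = Cod C i' \<and> Dom C i' = Cod C h \<and> Dom C h' = Cod C i \<and>
     i' \<bullet>\<^bsub>C\<^esub> h = h' \<bullet>\<^bsub>C\<^esub> i \<and>
     (\<forall>T\<in>Obj C. \<forall>a\<in>Hom C (Cod C h) T. \<forall>b\<in>Hom C (Cod C i) T. a \<bullet>\<^bsub>C\<^esub> h = b \<bullet>\<^bsub>C\<^esub> i \<longrightarrow>
        (\<exists>!u. u \<in> Hom C (Cod C i') T \<and> u \<bullet>\<^bsub>C\<^esub> i' = a \<and> u \<bullet>\<^bsub>C\<^esub> h' = b))"

locale abelian_category = linear_category +
  assumes ex_zero_object: "\<exists>Z. zero_object C Z"
    and ex_biproduct: "\<lbrakk>X \<in> Obj C; Y \<in> Obj C\<rbrakk> \<Longrightarrow> \<exists>B jX jY qX qY. is_biproduct C X Y B jX jY qX qY"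
    and ex_kernel: "f \<in> Arr C \<Longrightarrow> \<exists>i. is_kernel C f i"
    and ex_cokernel: "f \<in> Arr C \<Longrightarrow> \<exists>p. is_cokernel C f p"
    and mono_is_kernel: "monomorphism C m \<Longrightarrow> \<exists>f. is_kernel C f m"
    and epi_is_cokernel: "epimorphism C e \<Longrightarrow> \<exists>f. is_cokernel C f e"


section \<open>Yoneda \<open>Ext\<^sup>1\<close>\<close>

text \<open>An extension of \<open>X\<close> by \<open>Y\<close>, that is, a short exact sequence
  \<open>0 \<rightarrow> Y \<rightarrow> M \<rightarrow> X \<rightarrow> 0\<close>, is the pair \<open>(i, p)\<close> of its morphisms.\<close>

definition extensions :: "('k, 'o, 'm) lincat \<Rightarrow> 'o \<Rightarrow> 'o \<Rightarrow> ('m \<times> 'm) set" where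
  "extensions C X Y = {(i, p). Dom C i = Y \<and> Cod C p = X \<and> is_kernel C p i \<and> is_cokernel C i p}"

definition ext_equiv :: "('k, 'o, 'm) lincat \<Rightarrow> 'o \<Rightarrow> 'o \<Rightarrow> (('m \<times> 'm) \<times> ('m \<times> 'm)) set" where
  "ext_equiv C X Y = {((i, p), (i', p')). (i, p) \<in> extensions C X Y \<and> (i', p') \<in> extensions C X Y \<and>
     (\<exists>h\<in>Hom C (Cod C i) (Cod C i'). isomorphism C h \<and> h \<bullet>\<^bsub>C\<^esub> i = i' \<and> p' \<bullet>\<^bsub>C\<^esub> h = p)}"

text \<open>\<open>ext_pull C f\<close> is the map \<open>Ext\<^sup>1(f, Y)\<close> and \<open>ext_push C h\<close> is the map \<open>Ext\<^sup>1(X, h)\<close>. Pullbacks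
  and pushouts are not chosen: the result is the set of all pullbacks (pushouts) of
  representatives, which is again a full equivalence class.\<close>

definition ext_pull :: "('k, 'o, 'm) lincat \<Rightarrow> 'm \<Rightarrow> ('m \<times> 'm) set \<Rightarrow> ('m \<times> 'm) set" where
  "ext_pull C f \<xi> = {(i', p'). \<exists>(i, p)\<in>\<xi>. \<exists>g.
     (i', p') \<in> extensions C (Dom C f) (Dom C i) \<and> is_pullback C f p g p' \<and> g \<bullet>\<^bsub>C\<^esub> i' = i}"

definition ext_push :: "('k, 'o, 'm) lincat \<Rightarrow> 'm \<Rightarrow> ('m \<times> 'm) set \<Rightarrow> ('m \<times> 'm) set" where
  "ext_push C h \<xi> = {(i', p'). \<exists>(i, p)\<in>\<xi>. \<exists>g.
     (i', p') \<in> extensions C (Cod C p) (Cod C h) \<and> is_pushout C h i g i' \<and> p' \<bullet>\<^bsub>C\<^esub> g = p}"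

text \<open>The Baer sum \<open>\<nabla>\<^sub>* \<Delta>\<^sup>* (\<xi> \<oplus> \<zeta>)\<close>, where \<open>\<Delta> = jX1 + jX2\<close> is the diagonal of \<open>X\<close> and
  \<open>\<nabla> = qY1 + qY2\<close> is the codiagonal of \<open>Y\<close>.\<close>

definition baer_sum ::
  "('k, 'o, 'm) lincat \<Rightarrow> 'o \<Rightarrow> 'o \<Rightarrow> ('m \<times> 'm) set \<Rightarrow> ('m \<times> 'm) set \<Rightarrow> ('m \<times> 'm) set" where
  "baer_sum C X Y \<xi> \<zeta> = {e. \<exists>(i1, p1)\<in>\<xi>. \<exists>(i2, p2)\<in>\<zeta>.
     \<exists>XX jX1 jX2 qX1 qX2 YY jY1 jY2 qY1 qY2 MM jM1 jM2 qM1 qM2.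
       is_biproduct C X X XX jX1 jX2 qX1 qX2 \<and>
       is_biproduct C Y Y YY jY1 jY2 qY1 qY2 \<and>
       is_biproduct C (Cod C i1) (Cod C i2) MM jM1 jM2 qM1 qM2 \<and>
       e \<in> ext_push C (qY1 \<boxplus>\<^bsub>C\<^esub> qY2) (ext_pull C (jX1 \<boxplus>\<^bsub>C\<^esub> jX2)
             {(jM1 \<bullet>\<^bsub>C\<^esub> i1 \<bullet>\<^bsub>C\<^esub> qY1 \<boxplus>\<^bsub>C\<^esub> jM2 \<bullet>\<^bsub>C\<^esub> i2 \<bullet>\<^bsub>C\<^esub> qY2,
               jX1 \<bullet>\<^bsub>C\<^esub> p1 \<bullet>\<^bsub>C\<^esub> qM1 \<boxplus>\<^bsub>C\<^esub> jX2 \<bullet>\<^bsub>C\<^esub> p2 \<bullet>\<^bsub>C\<^esub> qM2)})}"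

definition split_extensions :: "('k, 'o, 'm) lincat \<Rightarrow> 'o \<Rightarrow> 'o \<Rightarrow> ('m \<times> 'm) set" where
  "split_extensions C X Y =
     {(i, p) \<in> extensions C X Y. \<exists>s\<in>Hom C X (Dom C p). p \<bullet>\<^bsub>C\<^esub> s = Ide C X}"

definition Ext1 :: "('k, 'o, 'm) lincat \<Rightarrow> 'o \<Rightarrow> 'o \<Rightarrow> ('k, ('m \<times> 'm) set) module" where
  "Ext1 C X Y = \<lparr>
     carrier = extensions C X Y // ext_equiv C X Y,
     mult = undefined, one = undefined,
     zero = split_extensions C X Y,
     add = baer_sum C X Y,
     smult = (\<lambda>r. ext_push C (Scal C r (Ide C Y)))\<rparr>"


section \<open>Functors\<close>

record ('o, 'm, 'p, 'n) functor_data =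
  on_Obj :: "'o \<Rightarrow> 'p"
  on_Arr :: "'m \<Rightarrow> 'n"

definition is_functor ::
  "('k, 'o, 'm) lincat \<Rightarrow> ('k, 'p, 'n) lincat \<Rightarrow> ('o, 'm, 'p, 'n) functor_data \<Rightarrow> bool" where
  "is_functor C D F \<longleftrightarrow>
     (\<forall>X\<in>Obj C. on_Obj F X \<in> Obj D \<and> on_Arr F (Ide C X) = Ide D (on_Obj F X)) \<and>
     (\<forall>X Y. \<forall>f\<in>Hom C X Y. on_Arr F f \<in> Hom D (on_Obj F X) (on_Obj F Y)) \<and>
     (\<forall>X Y Z. \<forall>f\<in>Hom C X Y. \<forall>g\<in>Hom C Y Z.
        on_Arr F (g \<bullet>\<^bsub>C\<^esub> f) = on_Arr F g \<bullet>\<^bsub>D\<^esub> on_Arr F f)"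

definition is_linear_functor ::
  "('k, 'x) ring_scheme \<Rightarrow> ('k, 'o, 'm) lincat \<Rightarrow> ('k, 'p, 'n) lincat \<Rightarrow> ('o, 'm, 'p, 'n) functor_data \<Rightarrow> bool" where
  "is_linear_functor k C D F \<longleftrightarrow> is_functor C D F \<and>
     (\<forall>X Y. \<forall>f\<in>Hom C X Y. \<forall>g\<in>Hom C X Y.
        on_Arr F (f \<boxplus>\<^bsub>C\<^esub> g) = on_Arr F f \<boxplus>\<^bsub>D\<^esub> on_Arr F g) \<and>
     (\<forall>r\<in>carrier k. \<forall>f\<in>Arr C. on_Arr F (Scal C r f) = Scal D r (on_Arr F f))"

definition id_functor :: "('o, 'm, 'o, 'm) functor_data" where
  "id_functor = \<lparr>on_Obj = id, on_Arr = id\<rparr>"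

definition comp_functor ::
  "('p, 'n, 'q, 'l) functor_data \<Rightarrow> ('o, 'm, 'p, 'n) functor_data \<Rightarrow> ('o, 'm, 'q, 'l) functor_data" where
  "comp_functor G F = \<lparr>on_Obj = on_Obj G \<circ> on_Obj F, on_Arr = on_Arr G \<circ> on_Arr F\<rparr>"

definition naturally_isomorphic ::
  "('k, 'o, 'm) lincat \<Rightarrow> ('k, 'p, 'n) lincat \<Rightarrow>
   ('o, 'm, 'p, 'n) functor_data \<Rightarrow> ('o, 'm, 'p, 'n) functor_data \<Rightarrow> bool" where
  "naturally_isomorphic C D F G \<longleftrightarrow> (\<exists>\<eta>.
     (\<forall>X\<in>Obj C. \<eta> X \<in> Hom D (on_Obj F X) (on_Obj G X) \<and> isomorphism D (\<eta> X)) \<and>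
     (\<forall>X Y. \<forall>f\<in>Hom C X Y. \<eta> Y \<bullet>\<^bsub>D\<^esub> on_Arr F f = on_Arr G f \<bullet>\<^bsub>D\<^esub> \<eta> X))"

definition quasi_inverse ::
  "('k, 'o, 'm) lincat \<Rightarrow> ('k, 'p, 'n) lincat \<Rightarrow>
   ('o, 'm, 'p, 'n) functor_data \<Rightarrow> ('p, 'n, 'o, 'm) functor_data \<Rightarrow> bool" where
  "quasi_inverse C D F G \<longleftrightarrow> is_functor C D F \<and> is_functor D C G \<and>
     naturally_isomorphic C C (comp_functor G F) id_functor \<and>
     naturally_isomorphic D D (comp_functor F G) id_functor"


section \<open>Serre duality\<close>

text \<open>\<open>serre_duality k E C \<tau>\<close>: the category has Serre duality with Auslander-Reiten translation
  \<open>\<tau>\<close>. Here \<open>D = Hom\<^sub>k(-, E)\<close>, and the last two conjuncts are naturality of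
  \<open>\<Phi> X Y : D Ext\<^sup>1(X, Y) \<rightarrow> Hom(Y, \<tau> X)\<close> in \<open>X\<close> and in \<open>Y\<close>.\<close>

definition serre_duality ::
  "('k, 'x) ring_scheme \<Rightarrow> ('k, 'e, 'y) module_scheme \<Rightarrow> ('k, 'o, 'm) lincat \<Rightarrow>
   ('o, 'm, 'o, 'm) functor_data \<Rightarrow> bool" where
  "serre_duality k E C \<tau> \<longleftrightarrow>
     is_linear_functor k C C \<tau> \<and> (\<exists>\<sigma>. quasi_inverse C C \<tau> \<sigma>) \<and>
     (\<exists>\<Phi>.
       (\<forall>X\<in>Obj C. \<forall>Y\<in>Obj C.
          \<Phi> X Y \<in> linear_maps k (Hom_module k (Ext1 C X Y) E) (HomMod C Y (on_Obj \<tau> X)) \<and>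
          bij_betw (\<Phi> X Y) (carrier (Hom_module k (Ext1 C X Y) E)) (Hom C Y (on_Obj \<tau> X))) \<and>
       (\<forall>X\<in>Obj C. \<forall>X'\<in>Obj C. \<forall>Y\<in>Obj C. \<forall>f\<in>Hom C X X'.
          \<forall>\<phi>\<in>carrier (Hom_module k (Ext1 C X Y) E).
            \<Phi> X' Y (compose (carrier (Ext1 C X' Y)) \<phi> (ext_pull C f)) = on_Arr \<tau> f \<bullet>\<^bsub>C\<^esub> \<Phi> X Y \<phi>) \<and>
       (\<forall>X\<in>Obj C. \<forall>Y\<in>Obj C. \<forall>Y'\<in>Obj C. \<forall>h\<in>Hom C Y' Y.
          \<forall>\<phi>\<in>carrier (Hom_module k (Ext1 C X Y) E).
            \<Phi> X Y' (compose (carrier (Ext1 C X Y')) \<phi> (ext_push C h)) = \<Phi> X Y \<phi> \<bullet>\<^bsub>C\<^esub> h))"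


section \<open>Morphisms determined by objects\<close>

definition Im_Hom :: "('k, 'o, 'm) lincat \<Rightarrow> 'o \<Rightarrow> 'm \<Rightarrow> 'm set" where
  "Im_Hom C c \<alpha> = (\<lambda>f. \<alpha> \<bullet>\<^bsub>C\<^esub> f) ` Hom C c (Dom C \<alpha>)"

definition right_determined :: "('k, 'o, 'm) lincat \<Rightarrow> 'm \<Rightarrow> 'o \<Rightarrow> bool" where
  "right_determined C \<alpha> c \<longleftrightarrow> \<alpha> \<in> Arr C \<and> c \<in> Obj C \<and>
     (\<forall>T\<in>Obj C. \<forall>t\<in>Hom C T (Cod C \<alpha>). Im_Hom C c t \<subseteq> Im_Hom C c \<alpha> \<longrightarrow>
        (\<exists>t'\<in>Hom C T (Dom C \<alpha>). t = \<alpha> \<bullet>\<^bsub>C\<^esub> t'))"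

definition left_determined :: "('k, 'o, 'm) lincat \<Rightarrow> 'm \<Rightarrow> 'o \<Rightarrow> bool" where
  "left_determined C \<beta> c \<longleftrightarrow> right_determined (opposite C) \<beta> c"

end

theory Submission
  imports Defs
begin

text \<open>Let \<open>\<alpha> : X \<rightarrow> Y\<close> be an epimorphism with kernel \<open>K\<close> and \<open>\<xi> \<in> Ext\<^sup>1(Y, K)\<close> its class, and let
  \<open>c = \<tau>\<^sup>-\<^sup>1 K\<close>. A morphism \<open>t : T \<rightarrow> Y\<close> factors through \<open>\<alpha>\<close> iff \<open>t\<^sup>* \<xi> = 0\<close>. If \<open>t\<^sup>* \<xi> \<noteq> 0\<close>, the
  cogenerator \<open>E\<close> yields \<open>\<phi> \<in> D Ext\<^sup>1(T, K)\<close> with \<open>\<phi> (t\<^sup>* \<xi>) \<noteq> 0\<close>. As \<open>\<tau>\<close> is full, naturality of Serre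
  duality gives \<open>\<phi> = \<psi> \<circ> f\<^sup>*\<close> for some \<open>f : c \<rightarrow> T\<close>, where \<open>\<psi> \<in> D Ext\<^sup>1(c, K)\<close> corresponds to
  \<open>K \<cong> \<tau> c\<close>; so \<open>f\<^sup>* t\<^sup>* \<xi> \<noteq> 0\<close> and \<open>t f\<close> does not factor through \<open>\<alpha>\<close>. Conversely, for every
  nonzero \<open>f : c \<rightarrow> Y\<close> Serre duality yields \<open>\<xi> \<in> Ext\<^sup>1(Y, \<tau> c)\<close> with \<open>f\<^sup>* \<xi> \<noteq> 0\<close>, that is, an epimorphism
  onto \<open>Y\<close> through which \<open>f\<close> does not factor. By the descending chain condition in \<open>Hom(c, Y)\<close> some
  epimorphism \<open>t\<close> onto \<open>Y\<close> has \<open>Hom(c, t) = 0\<close>; it factors through every \<open>\<alpha> : X \<rightarrow> Y\<close> that is right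
  determined by \<open>c\<close>, which is therefore an epimorphism. Statements about \<open>Ext\<^sup>1(X, Y)\<close> as a module are
  reduced to \<open>Hom\<close>: finitely many of its elements are pullbacks \<open>a\<^sub>j\<^sup>* \<omega>\<close> of a single
  \<open>\<omega> \<in> Ext\<^sup>1(W, Y)\<close>, and \<open>a \<mapsto> a\<^sup>* \<omega>\<close> takes sums to Baer sums.\<close>

section \<open>Modules\<close>

text \<open>Two obstacles shape the proof. \<open>serre_duality\<close> speaks of functionals on
  \<open>Ext1 C X Y\<close>, but nothing in the hypotheses says that this record is a module:
  \<open>baer_sum\<close> is an existential over representatives and biproducts, and
  \<open>ext_pull\<close> and \<open>ext_push\<close> return sets of all possible choices.
  Statements about them are therefore translated into the existence of morphisms of short exact
  sequences (\<open>ext_mor\<close>). Moreover, \<open>E\<close> is tested only against modules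
  carried by \<open>'k list set\<close>, whereas elements of \<open>Ext1 C X Y\<close> are sets of
  pairs of morphisms; Baer's criterion and Zorn's lemma bridge this gap.

  Duals of facts on kernels, pullbacks and splittings come from \<open>opposite C\<close>. The two
  determinacy results are nevertheless proved separately, since Serre duality is not literally
  self-dual: the two variables enter through different naturality conditions, and \<tau> acts on one
  of them only. Hence the monomorphism case can read the required morphism directly off the
  bijection, where the epimorphism case has to lift it along \<tau>.\<close>

lemma linear_maps_add:
  "f \<in> linear_maps R M N \<Longrightarrow> x \<in> carrier M \<Longrightarrow> y \<in> carrier M \<Longrightarrow> f (x \<oplus>\<^bsub>M\<^esub> y) = f x \<oplus>\<^bsub>N\<^esub> f y"
  unfolding linear_maps_def by blast

lemma linear_maps_smult:
  "f \<in> linear_maps R M N \<Longrightarrow> r \<in> carrier R \<Longrightarrow> x \<in> carrier M \<Longrightarrow> f (r \<odot>\<^bsub>M\<^esub> x) = r \<odot>\<^bsub>N\<^esub> f x"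
  unfolding linear_maps_def by blast

lemma linear_maps_closed: "f \<in> linear_maps R M N \<Longrightarrow> x \<in> carrier M \<Longrightarrow> f x \<in> carrier N"
  unfolding linear_maps_def by blast

lemma linear_maps_zero:
  assumes "module R M" "module R N" "f \<in> linear_maps R M N"
  shows "f \<zero>\<^bsub>M\<^esub> = \<zero>\<^bsub>N\<^esub>"
proof -
  interpret M: module R M by fact
  interpret N: module R N by fact
  have "f \<zero>\<^bsub>M\<^esub> = f (\<zero>\<^bsub>R\<^esub> \<odot>\<^bsub>M\<^esub> \<zero>\<^bsub>M\<^esub>)" by simp
  also have "\<dots> = \<zero>\<^bsub>R\<^esub> \<odot>\<^bsub>N\<^esub> f \<zero>\<^bsub>M\<^esub>" by (rule linear_maps_smult[OF assms(3) M.R.zero_closed M.zero_closed])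
  also have "\<dots> = \<zero>\<^bsub>N\<^esub>" using assms(3) by (simp add: linear_maps_closed)
  finally show ?thesis .
qed

subsection \<open>Extension of linear maps\<close>

text \<open>Graphs of linear maps defined on submodules of \<open>M\<close>. A relation is used
  rather than a partial function so that the union of a chain is again such a graph without gluing;
  by additivity the last clause amounts to single-valuedness.\<close>

definition partial_linear ::
  "('k, 'x) ring_scheme \<Rightarrow> ('k, 'a, 'y) module_scheme \<Rightarrow> ('k, 'b, 'z) module_scheme \<Rightarrow> ('a \<times> 'b) set \<Rightarrow> bool" where
  "partial_linear R M N G \<longleftrightarrow> G \<subseteq> carrier M \<times> carrier N \<and> (\<zero>\<^bsub>M\<^esub>, \<zero>\<^bsub>N\<^esub>) \<in> G \<and>
     (\<forall>x y x' y'. (x, y) \<in> G \<and> (x', y') \<in> G \<longrightarrow> (x \<oplus>\<^bsub>M\<^esub> x', y \<oplus>\<^bsub>N\<^esub> y') \<in> G) \<and>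
     (\<forall>r\<in>carrier R. \<forall>x y. (x, y) \<in> G \<longrightarrow> (r \<odot>\<^bsub>M\<^esub> x, r \<odot>\<^bsub>N\<^esub> y) \<in> G) \<and>
     (\<forall>y. (\<zero>\<^bsub>M\<^esub>, y) \<in> G \<longrightarrow> y = \<zero>\<^bsub>N\<^esub>)"

locale two_modules = M: module R M + N: module R N
  for R :: "('k, 'x) ring_scheme" and M :: "('k, 'a, 'y) module_scheme"
    and N :: "('k, 'b, 'z) module_scheme"
begin

lemma partial_linear_neg:
  assumes "partial_linear R M N G" "(x, y) \<in> G"
  shows "(\<ominus>\<^bsub>M\<^esub> x, \<ominus>\<^bsub>N\<^esub> y) \<in> G"
proof -
  have c: "x \<in> carrier M" "y \<in> carrier N" using assms unfolding partial_linear_def by auto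
  have "((\<ominus>\<^bsub>R\<^esub> \<one>\<^bsub>R\<^esub>) \<odot>\<^bsub>M\<^esub> x, (\<ominus>\<^bsub>R\<^esub> \<one>\<^bsub>R\<^esub>) \<odot>\<^bsub>N\<^esub> y) \<in> G"
    using assms unfolding partial_linear_def by simp
  then show ?thesis using c by (simp add: M.smult_l_minus N.smult_l_minus)
qed

lemma partial_linear_unique:
  assumes G: "partial_linear R M N G" and "(x, y) \<in> G" "(x, y') \<in> G"
  shows "y = y'"
proof -
  have c: "x \<in> carrier M" "y \<in> carrier N" "y' \<in> carrier N" using assms unfolding partial_linear_def by auto
  have "(x \<oplus>\<^bsub>M\<^esub> \<ominus>\<^bsub>M\<^esub> x, y \<oplus>\<^bsub>N\<^esub> \<ominus>\<^bsub>N\<^esub> y') \<in> G"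
    using G partial_linear_neg[OF G assms(3)] assms(2) unfolding partial_linear_def by blast
  then have "y \<oplus>\<^bsub>N\<^esub> \<ominus>\<^bsub>N\<^esub> y' = \<zero>\<^bsub>N\<^esub>" using G c unfolding partial_linear_def by (simp add: M.r_neg)
  then show ?thesis using c N.add.inv_solve_right N.l_zero by (metis N.zero_closed)
qed

text \<open>The condition in Baer's criterion: every linear map from an ideal to \<open>N\<close> is
  multiplication by an element of \<open>N\<close>. It mentions no test module, so it carries
  injectivity from the type of the test modules over to modules of any type.\<close>

definition baer_property :: bool where
  "baer_property \<longleftrightarrow> (\<forall>I g. ideal I R \<and> g \<in> I \<rightarrow> carrier N \<and> (\<forall>r\<in>I. \<forall>s\<in>I. g (r \<oplus>\<^bsub>R\<^esub> s) = g r \<oplus>\<^bsub>N\<^esub> g s) \<and>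
     (\<forall>r\<in>carrier R. \<forall>s\<in>I. g (r \<otimes>\<^bsub>R\<^esub> s) = r \<odot>\<^bsub>N\<^esub> g s) \<longrightarrow>
     (\<exists>e\<in>carrier N. \<forall>r\<in>I. g r = r \<odot>\<^bsub>N\<^esub> e))"

text \<open>The one-step extension behind Baer's criterion. The scalars that move \<open>x\<close>
  into the domain of \<open>G\<close> form an ideal \<open>I\<close>, and r \<mapsto> G(r x) is
  linear on it; an element \<open>e\<close> representing this map is a consistent value at
  \<open>x\<close>.\<close>

lemma partial_linear_extend:
  assumes baer: baer_property and G: "partial_linear R M N G" and x: "x \<in> carrier M"
  shows "\<exists>G'. partial_linear R M N G' \<and> G \<subseteq> G' \<and> x \<in> Domain G'"
proof -
  define I where "I = {r \<in> carrier R. \<exists>e. (r \<odot>\<^bsub>M\<^esub> x, e) \<in> G}"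
  define g where "g r = (THE e. (r \<odot>\<^bsub>M\<^esub> x, e) \<in> G)" for r
  have gI: "g r = e" if "(r \<odot>\<^bsub>M\<^esub> x, e) \<in> G" for r e
    unfolding g_def using that partial_linear_unique[OF G] by blast
  have Gsub: "\<And>u v. (u, v) \<in> G \<Longrightarrow> u \<in> carrier M \<and> v \<in> carrier N"
    and Gz: "(\<zero>\<^bsub>M\<^esub>, \<zero>\<^bsub>N\<^esub>) \<in> G"
    and Gadd: "\<And>u v u' v'. (u, v) \<in> G \<Longrightarrow> (u', v') \<in> G \<Longrightarrow> (u \<oplus>\<^bsub>M\<^esub> u', v \<oplus>\<^bsub>N\<^esub> v') \<in> G"
    and Gsm: "\<And>r u v. r \<in> carrier R \<Longrightarrow> (u, v) \<in> G \<Longrightarrow> (r \<odot>\<^bsub>M\<^esub> u, r \<odot>\<^bsub>N\<^esub> v) \<in> G"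
    using G unfolding partial_linear_def by blast+
  have gG: "(r \<odot>\<^bsub>M\<^esub> x, g r) \<in> G" if "r \<in> I" for r
    using that gI unfolding I_def by auto
  have Ic: "r \<in> carrier R" if "r \<in> I" for r using that unfolding I_def by auto
  have addI: "((r \<oplus>\<^bsub>R\<^esub> s) \<odot>\<^bsub>M\<^esub> x, g r \<oplus>\<^bsub>N\<^esub> g s) \<in> G" if "r \<in> I" "s \<in> I" for r s
    using Gadd[OF gG[OF that(1)] gG[OF that(2)]] that Ic x by (simp add: M.smult_l_distr)
  have smI: "((r \<otimes>\<^bsub>R\<^esub> s) \<odot>\<^bsub>M\<^esub> x, r \<odot>\<^bsub>N\<^esub> g s) \<in> G" if "r \<in> carrier R" "s \<in> I" for r s
    using Gsm[OF that(1) gG[OF that(2)]] that Ic x by (simp add: M.smult_assoc1)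
  have idl: "ideal I R"
  proof (rule idealI)
    show "ring R" by (rule M.R.ring_axioms)
    show "subgroup I (add_monoid R)"
    proof (rule M.R.add.subgroupI)
      show "I \<subseteq> carrier R" using Ic by auto
      show "I \<noteq> {}" using Gz x M.smult_l_null M.R.zero_closed unfolding I_def by fastforce
      fix a assume a: "a \<in> I"
      have "(\<ominus>\<^bsub>R\<^esub> a) \<odot>\<^bsub>M\<^esub> x = \<ominus>\<^bsub>M\<^esub> (a \<odot>\<^bsub>M\<^esub> x)" using a Ic x by (simp add: M.smult_l_minus)
      then show "\<ominus>\<^bsub>R\<^esub> a \<in> I" using partial_linear_neg[OF G gG[OF a]] Ic[OF a] unfolding I_def by (simp, metis)
    next
      fix a b assume "a \<in> I" "b \<in> I"
      then show "a \<oplus>\<^bsub>R\<^esub> b \<in> I" using addI[of a b] Ic[of a] Ic[of b] unfolding I_def by blast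
    qed
    fix a r assume a: "a \<in> I" and r: "r \<in> carrier R"
    show "r \<otimes>\<^bsub>R\<^esub> a \<in> I" using smI[OF r a] r Ic[OF a] unfolding I_def by blast
    then show "a \<otimes>\<^bsub>R\<^esub> r \<in> I" using r Ic[OF a] by (simp add: M.R.m_comm)
  qed
  have "\<exists>e\<in>carrier N. \<forall>r\<in>I. g r = r \<odot>\<^bsub>N\<^esub> e"
  proof (rule baer[unfolded baer_property_def, rule_format], intro conjI ballI)
    show "g \<in> I \<rightarrow> carrier N" using gG Gsub by blast
  qed (use idl gI addI smI in blast)+
  then obtain e where e: "e \<in> carrier N" and ge: "\<And>r. r \<in> I \<Longrightarrow> g r = r \<odot>\<^bsub>N\<^esub> e" by blast
  define G' where "G' = {(u \<oplus>\<^bsub>M\<^esub> r \<odot>\<^bsub>M\<^esub> x, v \<oplus>\<^bsub>N\<^esub> r \<odot>\<^bsub>N\<^esub> e) | u v r. (u, v) \<in> G \<and> r \<in> carrier R}"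
  have G'I: "(u \<oplus>\<^bsub>M\<^esub> r \<odot>\<^bsub>M\<^esub> x, v \<oplus>\<^bsub>N\<^esub> r \<odot>\<^bsub>N\<^esub> e) \<in> G'" if "(u, v) \<in> G" "r \<in> carrier R" for u v r
    using that unfolding G'_def by blast
  have sub: "G \<subseteq> G'"
  proof
    fix z assume "z \<in> G"
    then obtain u v where uv: "z = (u, v)" "(u, v) \<in> G" by (cases z) auto
    from G'I[OF uv(2) M.R.zero_closed] show "z \<in> G'" using Gsub[OF uv(2)] x e uv(1) by simp
  qed
  have "partial_linear R M N G'"
    unfolding partial_linear_def
  proof (intro conjI allI impI ballI)
    show "G' \<subseteq> carrier M \<times> carrier N" 
    proof
      fix z assume "z \<in> G'"
      then obtain u v r where "(u, v) \<in> G" "r \<in> carrier R"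
        "z = (u \<oplus>\<^bsub>M\<^esub> r \<odot>\<^bsub>M\<^esub> x, v \<oplus>\<^bsub>N\<^esub> r \<odot>\<^bsub>N\<^esub> e)" unfolding G'_def by blast
      then show "z \<in> carrier M \<times> carrier N" using Gsub[of u v] x e by simp
    qed
    show "(\<zero>\<^bsub>M\<^esub>, \<zero>\<^bsub>N\<^esub>) \<in> G'" using sub Gz by blast
    fix a b a' b' assume "(a, b) \<in> G' \<and> (a', b') \<in> G'"
    then obtain u v r u' v' r' where h: "(u, v) \<in> G" "(u', v') \<in> G" "r \<in> carrier R" "r' \<in> carrier R"
      "a = u \<oplus>\<^bsub>M\<^esub> r \<odot>\<^bsub>M\<^esub> x" "b = v \<oplus>\<^bsub>N\<^esub> r \<odot>\<^bsub>N\<^esub> e"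
      "a' = u' \<oplus>\<^bsub>M\<^esub> r' \<odot>\<^bsub>M\<^esub> x" "b' = v' \<oplus>\<^bsub>N\<^esub> r' \<odot>\<^bsub>N\<^esub> e"
      unfolding G'_def by blast
    have "a \<oplus>\<^bsub>M\<^esub> a' = (u \<oplus>\<^bsub>M\<^esub> u') \<oplus>\<^bsub>M\<^esub> (r \<oplus>\<^bsub>R\<^esub> r') \<odot>\<^bsub>M\<^esub> x"
      using h Gsub x by (simp add: M.smult_l_distr M.a_ac)
    moreover have "b \<oplus>\<^bsub>N\<^esub> b' = (v \<oplus>\<^bsub>N\<^esub> v') \<oplus>\<^bsub>N\<^esub> (r \<oplus>\<^bsub>R\<^esub> r') \<odot>\<^bsub>N\<^esub> e"
      using h Gsub e by (simp add: N.smult_l_distr N.a_ac)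
    ultimately show "(a \<oplus>\<^bsub>M\<^esub> a', b \<oplus>\<^bsub>N\<^esub> b') \<in> G'"
      using G'I[OF Gadd[OF h(1,2)], of "r \<oplus>\<^bsub>R\<^esub> r'"] h by simp
  next
    fix s a b assume s: "s \<in> carrier R" and "(a, b) \<in> G'"
    then obtain u v r where h: "(u, v) \<in> G" "r \<in> carrier R"
      "a = u \<oplus>\<^bsub>M\<^esub> r \<odot>\<^bsub>M\<^esub> x" "b = v \<oplus>\<^bsub>N\<^esub> r \<odot>\<^bsub>N\<^esub> e"
      unfolding G'_def by blast
    show "(s \<odot>\<^bsub>M\<^esub> a, s \<odot>\<^bsub>N\<^esub> b) \<in> G'"
      using G'I[OF Gsm[OF s h(1)], of "s \<otimes>\<^bsub>R\<^esub> r"] h s Gsub x e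
      by (simp add: M.smult_r_distr N.smult_r_distr M.smult_assoc1 N.smult_assoc1)
  next
    fix b assume "(\<zero>\<^bsub>M\<^esub>, b) \<in> G'"
    then obtain u v r where h: "(u, v) \<in> G" "r \<in> carrier R"
      "\<zero>\<^bsub>M\<^esub> = u \<oplus>\<^bsub>M\<^esub> r \<odot>\<^bsub>M\<^esub> x" "b = v \<oplus>\<^bsub>N\<^esub> r \<odot>\<^bsub>N\<^esub> e"
      unfolding G'_def by blast
    \<comment> \<open>A relation 0 = u + r x puts \<open>r\<close> into \<open>I\<close>, so r e is
      the value of \<open>G\<close> at r x = -u, namely -v, and cancels v.\<close>
    have "r \<odot>\<^bsub>M\<^esub> x = \<ominus>\<^bsub>M\<^esub> u" using h Gsub x
      by (metis M.add.inv_equality M.add.m_comm M.smult_closed)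
    then have rG: "(r \<odot>\<^bsub>M\<^esub> x, \<ominus>\<^bsub>N\<^esub> v) \<in> G" using partial_linear_neg[OF G h(1)] by simp
    then have "r \<in> I" using h unfolding I_def by blast
    then have "r \<odot>\<^bsub>N\<^esub> e = \<ominus>\<^bsub>N\<^esub> v" using ge gI[OF rG] by simp
    then show "b = \<zero>\<^bsub>N\<^esub>" using h Gsub by (simp add: N.r_neg)
  qed
  moreover have "(\<zero>\<^bsub>M\<^esub> \<oplus>\<^bsub>M\<^esub> \<one>\<^bsub>R\<^esub> \<odot>\<^bsub>M\<^esub> x, \<zero>\<^bsub>N\<^esub> \<oplus>\<^bsub>N\<^esub> \<one>\<^bsub>R\<^esub> \<odot>\<^bsub>N\<^esub> e) \<in> G'"
    using G'I[OF Gz M.R.one_closed] .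
  then have "x \<in> Domain G'" using x by auto
  ultimately show ?thesis using sub by blast
qed

text \<open>The annihilator condition makes r x \<mapsto> r y well defined on the cyclic submodule
  of \<open>x\<close>. A maximal partial extension, provided by Zorn's lemma, is defined everywhere,
  since otherwise \<open>partial_linear_extend\<close> would enlarge it.\<close>

lemma linear_map_extend_cyclic:
  assumes baer: baer_property and x: "x \<in> carrier M" and y: "y \<in> carrier N"
    and ann: "\<And>r. r \<in> carrier R \<Longrightarrow> r \<odot>\<^bsub>M\<^esub> x = \<zero>\<^bsub>M\<^esub> \<Longrightarrow> r \<odot>\<^bsub>N\<^esub> y = \<zero>\<^bsub>N\<^esub>"
  shows "\<exists>\<phi>\<in>linear_maps R M N. \<phi> x = y"
proof -
  define G0 where "G0 = {(r \<odot>\<^bsub>M\<^esub> x, r \<odot>\<^bsub>N\<^esub> y) | r. r \<in> carrier R}"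
  have G0I: "(r \<odot>\<^bsub>M\<^esub> x, r \<odot>\<^bsub>N\<^esub> y) \<in> G0" if "r \<in> carrier R" for r using that unfolding G0_def by blast
  have G0: "partial_linear R M N G0"
    unfolding partial_linear_def
  proof (intro conjI allI impI ballI)
    show "G0 \<subseteq> carrier M \<times> carrier N" using x y unfolding G0_def by auto
    show "(\<zero>\<^bsub>M\<^esub>, \<zero>\<^bsub>N\<^esub>) \<in> G0" using G0I[OF M.R.zero_closed] x y by simp
    fix a b a' b' assume "(a, b) \<in> G0 \<and> (a', b') \<in> G0"
    then obtain r r' where h: "r \<in> carrier R" "r' \<in> carrier R"
      "a = r \<odot>\<^bsub>M\<^esub> x" "b = r \<odot>\<^bsub>N\<^esub> y" "a' = r' \<odot>\<^bsub>M\<^esub> x" "b' = r' \<odot>\<^bsub>N\<^esub> y"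
      unfolding G0_def by blast
    then show "(a \<oplus>\<^bsub>M\<^esub> a', b \<oplus>\<^bsub>N\<^esub> b') \<in> G0"
      using G0I[of "r \<oplus>\<^bsub>R\<^esub> r'"] x y by (simp add: M.smult_l_distr N.smult_l_distr)
  next
    fix s a b assume s: "s \<in> carrier R" and "(a, b) \<in> G0"
    then obtain r where h: "r \<in> carrier R" "a = r \<odot>\<^bsub>M\<^esub> x" "b = r \<odot>\<^bsub>N\<^esub> y" unfolding G0_def by blast
    then show "(s \<odot>\<^bsub>M\<^esub> a, s \<odot>\<^bsub>N\<^esub> b) \<in> G0"
      using G0I[of "s \<otimes>\<^bsub>R\<^esub> r"] s x y by (simp add: M.smult_assoc1 N.smult_assoc1)
  next
    fix b assume "(\<zero>\<^bsub>M\<^esub>, b) \<in> G0"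
    then show "b = \<zero>\<^bsub>N\<^esub>" using ann unfolding G0_def by force
  qed
  define A where "A = {G. partial_linear R M N G \<and> G0 \<subseteq> G}"
  have "\<exists>G\<in>A. \<forall>X\<in>A. G \<subseteq> X \<longrightarrow> X = G"
  proof (rule subset_Zorn_nonempty)
    show "A \<noteq> {}" using G0 unfolding A_def by blast
    fix K assume K0: "K \<noteq> {}" and K: "subset.chain A K"
    have KA: "\<And>X. X \<in> K \<Longrightarrow> partial_linear R M N X \<and> G0 \<subseteq> X" and
      Kc: "\<And>X Y. X \<in> K \<Longrightarrow> Y \<in> K \<Longrightarrow> X \<subseteq> Y \<or> Y \<subseteq> X"
      using K unfolding A_def subset.chain_def by blast+
    have "partial_linear R M N (\<Union>K)"
      unfolding partial_linear_def
    proof (intro conjI allI impI ballI)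
      show "\<Union>K \<subseteq> carrier M \<times> carrier N" using KA unfolding partial_linear_def by blast
      show "(\<zero>\<^bsub>M\<^esub>, \<zero>\<^bsub>N\<^esub>) \<in> \<Union>K" using KA K0 unfolding partial_linear_def by blast
      fix a b a' b' assume "(a, b) \<in> \<Union>K \<and> (a', b') \<in> \<Union>K"
      then obtain X where "X \<in> K" "(a, b) \<in> X" "(a', b') \<in> X" using Kc by blast
      then show "(a \<oplus>\<^bsub>M\<^esub> a', b \<oplus>\<^bsub>N\<^esub> b') \<in> \<Union>K" using KA unfolding partial_linear_def by blast
    next
      fix s a b assume s: "s \<in> carrier R" and "(a, b) \<in> \<Union>K"
      then show "(s \<odot>\<^bsub>M\<^esub> a, s \<odot>\<^bsub>N\<^esub> b) \<in> \<Union>K" using KA unfolding partial_linear_def by blast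
    next
      fix b assume "(\<zero>\<^bsub>M\<^esub>, b) \<in> \<Union>K"
      then show "b = \<zero>\<^bsub>N\<^esub>" using KA unfolding partial_linear_def by blast
    qed
    then show "\<Union>K \<in> A" using KA K0 unfolding A_def by blast
  qed
  then obtain G where GA: "G \<in> A" and maxA: "\<And>X. X \<in> A \<Longrightarrow> G \<subseteq> X \<Longrightarrow> X = G" by blast
  then have G: "partial_linear R M N G" "G0 \<subseteq> G" unfolding A_def by auto
  have max: "X = G" if "partial_linear R M N X" "G \<subseteq> X" for X
    using maxA[of X] that G(2) unfolding A_def by simp
  have dom: "\<exists>b. (a, b) \<in> G" if "a \<in> carrier M" for a
    using partial_linear_extend[OF baer G(1) that] max by (metis DomainE)
  define \<phi> where "\<phi> = (\<lambda>a\<in>carrier M. THE b. (a, b) \<in> G)"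
  have \<phi>: "\<phi> a = b" if "(a, b) \<in> G" for a b
    using that G(1) partial_linear_unique[OF G(1)] unfolding \<phi>_def partial_linear_def by auto
  have \<phi>G: "(a, \<phi> a) \<in> G" if "a \<in> carrier M" for a using dom[OF that] \<phi> by auto
  have "\<phi> \<in> linear_maps R M N"
    unfolding linear_maps_def
  proof (intro CollectI conjI ballI)
    show "\<phi> \<in> carrier M \<rightarrow>\<^sub>E carrier N"
    proof (rule PiE_I)
      fix a assume "a \<in> carrier M" then show "\<phi> a \<in> carrier N"
        using \<phi>G G(1) unfolding partial_linear_def by blast
    qed (simp add: \<phi>_def)
    fix a b assume "a \<in> carrier M" "b \<in> carrier M"
    then show "\<phi> (a \<oplus>\<^bsub>M\<^esub> b) = \<phi> a \<oplus>\<^bsub>N\<^esub> \<phi> b"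
      using \<phi>[of "a \<oplus>\<^bsub>M\<^esub> b"] \<phi>G G(1) unfolding partial_linear_def by blast
  next
    fix r a assume ra: "r \<in> carrier R" "a \<in> carrier M"
    have "(r \<odot>\<^bsub>M\<^esub> a, r \<odot>\<^bsub>N\<^esub> \<phi> a) \<in> G"
      using \<phi>G[OF ra(2)] ra(1) G(1) unfolding partial_linear_def by blast
    then show "\<phi> (r \<odot>\<^bsub>M\<^esub> a) = r \<odot>\<^bsub>N\<^esub> \<phi> a" by (rule \<phi>)
  qed
  moreover have "(x, y) \<in> G" using subsetD[OF G(2) G0I[OF M.R.one_closed]] x y by simp
  then have "\<phi> x = y" using \<phi> by blast
  ultimately show ?thesis by blast
qed

end

subsection \<open>Transport of structure\<close>

text \<open>Copies \<open>M\<close> along an injection \<open>g\<close> of its carrier into another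
  type. Modules have to be moved into \<open>'k list set\<close> before the hypotheses on
  \<open>E\<close> can be applied to them.\<close>

definition transport_module :: "('k, 'a, 'y) module_scheme \<Rightarrow> ('a \<Rightarrow> 'n) \<Rightarrow> ('k, 'n) module" where
  "transport_module M g = \<lparr>carrier = g ` carrier M, mult = undefined, one = undefined,
     zero = g \<zero>\<^bsub>M\<^esub>,
     add = (\<lambda>u v. g (inv_into (carrier M) g u \<oplus>\<^bsub>M\<^esub> inv_into (carrier M) g v)),
     smult = (\<lambda>r u. g (r \<odot>\<^bsub>M\<^esub> inv_into (carrier M) g u))\<rparr>"

lemma transport_module_simps:
  assumes "inj_on g (carrier M)"
  shows "carrier (transport_module M g) = g ` carrier M"
    "\<zero>\<^bsub>transport_module M g\<^esub> = g \<zero>\<^bsub>M\<^esub>"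
    "x \<in> carrier M \<Longrightarrow> y \<in> carrier M \<Longrightarrow> g x \<oplus>\<^bsub>transport_module M g\<^esub> g y = g (x \<oplus>\<^bsub>M\<^esub> y)"
    "x \<in> carrier M \<Longrightarrow> r \<odot>\<^bsub>transport_module M g\<^esub> g x = g (r \<odot>\<^bsub>M\<^esub> x)"
  using assms by (simp_all add: transport_module_def)

lemma module_transport:
  assumes "module R M" and g: "inj_on g (carrier M)"
  shows "module R (transport_module M g)"
proof -
  interpret module R M by fact
  note S = transport_module_simps[OF g]
  show ?thesis
  proof (rule moduleI)
    show "cring R" by (rule R.is_cring)
    show "abelian_group (transport_module M g)"
    proof (rule abelian_groupI)
      fix u assume "u \<in> carrier (transport_module M g)"
      then obtain x where x: "x \<in> carrier M" "u = g x" using S by auto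
      then have "g (\<ominus>\<^bsub>M\<^esub> x) \<in> carrier (transport_module M g) \<and>
        g (\<ominus>\<^bsub>M\<^esub> x) \<oplus>\<^bsub>transport_module M g\<^esub> u = \<zero>\<^bsub>transport_module M g\<^esub>"
        by (simp add: S M.l_neg)
      then show "\<exists>v\<in>carrier (transport_module M g). v \<oplus>\<^bsub>transport_module M g\<^esub> u = \<zero>\<^bsub>transport_module M g\<^esub>"
        by blast
    qed (auto simp: S M.a_ac)
  qed (auto simp: S smult_l_distr smult_r_distr smult_assoc1)
qed

definition ideal_module :: "('k, 'x) ring_scheme \<Rightarrow> 'k set \<Rightarrow> ('k, 'k) module" where
  "ideal_module R I = \<lparr>carrier = I, mult = undefined, one = undefined,
     zero = \<zero>\<^bsub>R\<^esub>, add = add R, smult = mult R\<rparr>"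

lemma module_ideal_module:
  assumes "cring R" "ideal I R"
  shows "module R (ideal_module R I)"
proof -
  interpret cring R by fact
  interpret I: ideal I R by fact
  note [simp] = ideal_module_def
  show ?thesis
  proof (rule moduleI)
    show "abelian_group (ideal_module R I)"
    proof (rule abelian_groupI)
      fix x assume "x \<in> carrier (ideal_module R I)"
      then have "\<ominus>\<^bsub>R\<^esub> x \<in> I \<and> \<ominus>\<^bsub>R\<^esub> x \<oplus>\<^bsub>R\<^esub> x = \<zero>\<^bsub>R\<^esub>" using I.Icarr l_neg by auto
      then show "\<exists>y\<in>carrier (ideal_module R I). y \<oplus>\<^bsub>ideal_module R I\<^esub> x = \<zero>\<^bsub>ideal_module R I\<^esub>" by auto
    qed (use I.Icarr in \<open>auto simp: a_ac I.a_closed\<close>)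
  qed (use I.Icarr I.I_l_closed in \<open>auto simp: l_distr r_distr m_assoc assms(1)\<close>)
qed

text \<open>The inclusion of \<open>I\<close> into the ring becomes a test for injectivity once both
  are copied into \<open>'k list set\<close>. Extending \<open>g\<close> to the whole ring and
  evaluating at one gives the element \<open>e\<close>.\<close>

lemma injective_module_baer:
  assumes E: "injective_module TYPE('k list set) (R :: ('k, 'x) ring_scheme) E"
    and I: "ideal I R" and g: "g \<in> I \<rightarrow> carrier E"
    and add: "\<And>r s. r \<in> I \<Longrightarrow> s \<in> I \<Longrightarrow> g (r \<oplus>\<^bsub>R\<^esub> s) = g r \<oplus>\<^bsub>E\<^esub> g s"
    and smult: "\<And>r s. r \<in> carrier R \<Longrightarrow> s \<in> I \<Longrightarrow> g (r \<otimes>\<^bsub>R\<^esub> s) = r \<odot>\<^bsub>E\<^esub> g s"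
  shows "\<exists>e\<in>carrier E. \<forall>r\<in>I. g r = r \<odot>\<^bsub>E\<^esub> e"
proof -
  interpret E: module R E using E unfolding injective_module_def by blast
  interpret I: ideal I R by fact
  define b :: "'k \<Rightarrow> 'k list set" where "b r = {[r]}" for r
  have binj: "inj_on b A" for A unfolding b_def inj_on_def by simp
  have R: "ideal (carrier R) R" by (rule E.R.oneideal)
  define M where "M = transport_module (ideal_module R I) b"
  define N where "N = transport_module (ideal_module R (carrier R)) b"
  have mM: "module R M" and mN: "module R N"
    unfolding M_def N_def by (intro module_transport module_ideal_module E.R.is_cring I R binj)+
  have MS: "carrier M = b ` I" "\<And>x y. x \<in> I \<Longrightarrow> y \<in> I \<Longrightarrow> b x \<oplus>\<^bsub>M\<^esub> b y = b (x \<oplus>\<^bsub>R\<^esub> y)"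
    "\<And>r x. x \<in> I \<Longrightarrow> r \<odot>\<^bsub>M\<^esub> b x = b (r \<otimes>\<^bsub>R\<^esub> x)"
    unfolding M_def by (auto simp: transport_module_simps binj ideal_module_def)
  have NS: "carrier N = b ` carrier R"
    "\<And>x y. x \<in> carrier R \<Longrightarrow> y \<in> carrier R \<Longrightarrow> b x \<oplus>\<^bsub>N\<^esub> b y = b (x \<oplus>\<^bsub>R\<^esub> y)"
    "\<And>r x. x \<in> carrier R \<Longrightarrow> r \<odot>\<^bsub>N\<^esub> b x = b (r \<otimes>\<^bsub>R\<^esub> x)"
    unfolding N_def by (auto simp: transport_module_simps binj ideal_module_def)
  define j where "j = (\<lambda>u\<in>carrier M. u)"
  define f where "f = (\<lambda>u\<in>carrier M. g (the_inv b u))"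
  have tb: "the_inv b (b r) = r" for r by (rule the_inv_f_f[OF binj])
  have j: "j \<in> linear_maps R M N"
    unfolding linear_maps_def j_def
    using I.Icarr I.I_l_closed by (auto simp: MS NS I.a_closed)
  have f: "f \<in> linear_maps R M E"
    unfolding linear_maps_def f_def
    using g I.I_l_closed by (auto simp: MS tb I.a_closed add smult)
  have "inj_on j (carrier M)" unfolding j_def inj_on_def by simp
  then obtain h where h: "h \<in> linear_maps R N E" "\<And>x. x \<in> carrier M \<Longrightarrow> h (j x) = f x"
    using E[unfolded injective_module_def, THEN conjunct2, rule_format, of j M N f] j f mM mN by auto
  have one: "b \<one>\<^bsub>R\<^esub> \<in> carrier N" using NS by auto
  have "g r = r \<odot>\<^bsub>E\<^esub> h (b \<one>\<^bsub>R\<^esub>)" if r: "r \<in> I" for r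
  proof -
    have "g r = f (b r)" unfolding f_def using r MS tb by simp
    also have "\<dots> = h (b r)" using h(2)[of "b r"] r MS unfolding j_def by simp
    also have "b r = r \<odot>\<^bsub>N\<^esub> b \<one>\<^bsub>R\<^esub>" using r NS I.Icarr by simp
    finally show ?thesis using h(1) r I.Icarr one by (simp add: linear_maps_smult)
  qed
  moreover have "h (b \<one>\<^bsub>R\<^esub>) \<in> carrier E" using h(1) one by (rule linear_maps_closed)
  ultimately show ?thesis by blast
qed

text \<open>\<open>M\<close> may have any carrier type; the lemma is meant for
  \<open>Ext1 C X Y\<close>. The cyclic submodule generated by \<open>x\<close> does fit into the
  type of test modules, so the cogenerator property gives a functional there that does not vanish at
  \<open>x\<close>, and the Baer property yields a functional on all of \<open>M\<close> with the
  same value at \<open>x\<close>.\<close>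

lemma injective_cogenerator_separates:
  fixes R :: "('k, 'x) ring_scheme"
  assumes E: "injective_cogenerator R E" and M: "module R M"
    and x: "x \<in> carrier M" "x \<noteq> \<zero>\<^bsub>M\<^esub>"
  shows "\<exists>\<phi>\<in>linear_maps R M E. \<phi> x \<noteq> \<zero>\<^bsub>E\<^esub>"
proof -
  have Ei: "injective_module TYPE('k list set) R E" and Ec: "cogenerator_module TYPE('k list set) R E"
    and mE: "module R E"
    using E unfolding injective_cogenerator_def injective_module_def by blast+
  interpret two_modules R M E using M mE unfolding two_modules_def by blast
  define H where "H = {r \<odot>\<^bsub>M\<^esub> x | r. r \<in> carrier R}"
  have HI: "r \<odot>\<^bsub>M\<^esub> x \<in> H" if "r \<in> carrier R" for r using that unfolding H_def by blast
  have sub: "submodule H R M"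
  proof (rule M.submoduleI)
    show "H \<subseteq> carrier M" using x unfolding H_def by auto
    show "\<zero>\<^bsub>M\<^esub> \<in> H" using HI[OF M.R.zero_closed] x by simp
    fix a assume "a \<in> H"
    then obtain r where "r \<in> carrier R" "a = r \<odot>\<^bsub>M\<^esub> x" unfolding H_def by blast
    then show "\<ominus>\<^bsub>M\<^esub> a \<in> H" using HI[of "\<ominus>\<^bsub>R\<^esub> r"] x by (simp add: M.smult_l_minus)
  next
    fix a b assume "a \<in> H" "b \<in> H"
    then obtain r s where "r \<in> carrier R" "a = r \<odot>\<^bsub>M\<^esub> x" "s \<in> carrier R" "b = s \<odot>\<^bsub>M\<^esub> x"
      unfolding H_def by blast
    then show "a \<oplus>\<^bsub>M\<^esub> b \<in> H" using HI[of "r \<oplus>\<^bsub>R\<^esub> s"] x by (simp add: M.smult_l_distr)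
  next
    fix s a assume "s \<in> carrier R" "a \<in> H"
    then obtain r where "s \<in> carrier R" "r \<in> carrier R" "a = r \<odot>\<^bsub>M\<^esub> x" unfolding H_def by blast
    then show "s \<odot>\<^bsub>M\<^esub> a \<in> H" using HI[of "s \<otimes>\<^bsub>R\<^esub> r"] x by (simp add: M.smult_assoc1)
  qed
  \<comment> \<open>A copy of the cyclic module generated by \<open>x\<close> inside the type of test modules: an element is
    encoded by the set of its coefficients.\<close>
  define c :: "'c \<Rightarrow> 'k list set" where "c u = {[r] | r. r \<in> carrier R \<and> r \<odot>\<^bsub>M\<^esub> x = u}" for u
  let ?H = "M\<lparr>carrier := H\<rparr>"
  have inj: "inj_on c (carrier ?H)"
  proof (rule inj_onI)
    fix u v assume "u \<in> carrier ?H" "c u = c v"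
    then obtain r where "r \<in> carrier R" "u = r \<odot>\<^bsub>M\<^esub> x" "[r] \<in> c v" unfolding H_def c_def by auto
    then show "u = v" unfolding c_def by auto
  qed
  have mH: "module R ?H" using submodule.submodule_is_module[OF sub M] .
  note mT = module_transport[OF mH inj]
  note S = transport_module_simps[OF inj]
  have xH: "x \<in> H" using HI[OF M.R.one_closed] x by simp
  have zH: "\<zero>\<^bsub>M\<^esub> \<in> H" using HI[OF M.R.zero_closed] x by simp
  have "c x \<noteq> \<zero>\<^bsub>transport_module ?H c\<^esub>" using inj_onD[OF inj, of x "\<zero>\<^bsub>M\<^esub>"] xH zH x by (auto simp: S)
  then obtain f where f: "f \<in> linear_maps R (transport_module ?H c) E" "f (c x) \<noteq> \<zero>\<^bsub>E\<^esub>"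
    using Ec mT xH unfolding cogenerator_module_def by (force simp: S)
  have cx: "c x \<in> carrier (transport_module ?H c)" using xH by (simp add: S)
  have "r \<odot>\<^bsub>E\<^esub> f (c x) = \<zero>\<^bsub>E\<^esub>" if "r \<in> carrier R" "r \<odot>\<^bsub>M\<^esub> x = \<zero>\<^bsub>M\<^esub>" for r
  proof -
    have "r \<odot>\<^bsub>E\<^esub> f (c x) = f (r \<odot>\<^bsub>transport_module ?H c\<^esub> c x)"
      using f(1) that(1) cx by (simp add: linear_maps_smult)
    also have "r \<odot>\<^bsub>transport_module ?H c\<^esub> c x = \<zero>\<^bsub>transport_module ?H c\<^esub>"
      using that xH by (simp add: S)
    finally show ?thesis using linear_maps_zero[OF mT mE f(1)] by simp
  qed
  moreover have baer_property
    unfolding baer_property_def by (intro allI impI injective_module_baer[OF Ei]) auto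
  moreover have "f (c x) \<in> carrier E" using f(1) cx by (rule linear_maps_closed)
  ultimately obtain \<phi> where "\<phi> \<in> linear_maps R M E" "\<phi> x = f (c x)"
    using linear_map_extend_cyclic[of x "f (c x)"] x by blast
  then show ?thesis using f(2) by metis
qed

subsection \<open>Descending chains of submodules\<close>

definition lin_span :: "('k, 'x) ring_scheme \<Rightarrow> ('k, 'a, 'y) module_scheme \<Rightarrow> 'a set \<Rightarrow> 'a set" where
  "lin_span R M S = \<Inter>{N. submodule N R M \<and> S \<subseteq> N}"

context module begin

lemma submodule_lin_span:
  assumes "S \<subseteq> carrier M"
  shows "submodule (lin_span R M S) R M"
proof (rule submoduleI)
  show "lin_span R M S \<subseteq> carrier M"
    unfolding lin_span_def using assms carrier_is_submodule by auto
  show "\<zero>\<^bsub>M\<^esub> \<in> lin_span R M S"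
    unfolding lin_span_def using submodule.axioms(1) subgroup.one_closed by fastforce
  fix a b assume "a \<in> lin_span R M S" "b \<in> lin_span R M S"
  then show "a \<oplus>\<^bsub>M\<^esub> b \<in> lin_span R M S" unfolding lin_span_def using submoduleE(5) by blast
next
  fix a assume "a \<in> lin_span R M S"
  then show "\<ominus>\<^bsub>M\<^esub> a \<in> lin_span R M S" unfolding lin_span_def using submoduleE(3) by blast
next
  fix r a assume "r \<in> carrier R" "a \<in> lin_span R M S"
  then show "r \<odot>\<^bsub>M\<^esub> a \<in> lin_span R M S" unfolding lin_span_def using submoduleE(4) by blast
qed

lemma submodule_zero: "submodule N R M \<Longrightarrow> \<zero>\<^bsub>M\<^esub> \<in> N"
  using submodule.axioms(1) subgroup.one_closed by fastforce

lemma lin_span_superset: "S \<subseteq> lin_span R M S"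
  unfolding lin_span_def by auto

lemma lin_span_insert:
  assumes x: "x \<in> carrier M" and S: "S \<subseteq> carrier M" and y: "y \<in> lin_span R M (insert x S)"
  shows "\<exists>r\<in>carrier R. \<exists>s\<in>lin_span R M S. y = r \<odot>\<^bsub>M\<^esub> x \<oplus>\<^bsub>M\<^esub> s"
proof -
  define N where "N = {r \<odot>\<^bsub>M\<^esub> x \<oplus>\<^bsub>M\<^esub> s | r s. r \<in> carrier R \<and> s \<in> lin_span R M S}"
  have NI: "r \<odot>\<^bsub>M\<^esub> x \<oplus>\<^bsub>M\<^esub> s \<in> N" if "r \<in> carrier R" "s \<in> lin_span R M S" for r s
    using that unfolding N_def by blast
  note L = submodule_lin_span[OF S]
  note LE = submoduleE[OF L]
  note Lc = subsetD[OF LE(1)]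
  have "submodule N R M"
  proof (rule submoduleI)
    show "N \<subseteq> carrier M" using x Lc unfolding N_def by auto
    show "\<zero>\<^bsub>M\<^esub> \<in> N" using NI[OF R.zero_closed submodule_zero[OF L]] x by simp
    fix a assume "a \<in> N"
    then obtain r s where h: "r \<in> carrier R" "s \<in> lin_span R M S" "a = r \<odot>\<^bsub>M\<^esub> x \<oplus>\<^bsub>M\<^esub> s"
      unfolding N_def by blast
    then show "\<ominus>\<^bsub>M\<^esub> a \<in> N" using NI[OF R.add.inv_closed[OF h(1)] LE(3)[OF h(2)]] x Lc
      by (simp add: smult_l_minus M.minus_add)
  next
    fix a b assume "a \<in> N" "b \<in> N"
    then obtain r s r' s' where h: "r \<in> carrier R" "s \<in> lin_span R M S" "a = r \<odot>\<^bsub>M\<^esub> x \<oplus>\<^bsub>M\<^esub> s"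
      "r' \<in> carrier R" "s' \<in> lin_span R M S" "b = r' \<odot>\<^bsub>M\<^esub> x \<oplus>\<^bsub>M\<^esub> s'"
      unfolding N_def by blast
    then show "a \<oplus>\<^bsub>M\<^esub> b \<in> N" using NI[OF R.add.m_closed[OF h(1,4)] LE(5)[OF h(2,5)]] x Lc
      by (simp add: smult_l_distr M.a_ac)
  next
    fix t a assume t: "t \<in> carrier R" and "a \<in> N"
    then obtain r s where h: "r \<in> carrier R" "s \<in> lin_span R M S" "a = r \<odot>\<^bsub>M\<^esub> x \<oplus>\<^bsub>M\<^esub> s"
      unfolding N_def by blast
    then show "t \<odot>\<^bsub>M\<^esub> a \<in> N" using NI[OF R.m_closed[OF t h(1)] LE(4)[OF t h(2)]] x Lc t
      by (simp add: smult_r_distr smult_assoc1)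
  qed
  moreover have "x \<in> N" using NI[OF R.one_closed submodule_zero[OF L]] x by simp
  moreover have "S \<subseteq> N"
  proof
    fix s assume s: "s \<in> S"
    then have "s \<in> lin_span R M S" using lin_span_superset by blast
    from NI[OF R.zero_closed this] show "s \<in> N" using x s S by auto
  qed
  ultimately have "y \<in> N" using y unfolding lin_span_def by blast
  then show ?thesis unfolding N_def by blast
qed

lemma submodule_Int:
  assumes "submodule A R M" "submodule B R M"
  shows "submodule (A \<inter> B) R M"
proof (rule submoduleI)
  show "\<zero>\<^bsub>M\<^esub> \<in> A \<inter> B" using assms submodule_zero by blast
  show "A \<inter> B \<subseteq> carrier M" using submoduleE(1)[OF assms(1)] by blast
qed (auto intro: submoduleE(3-5)[OF assms(1)] submoduleE(3-5)[OF assms(2)])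

text \<open>With \<open>A\<close> the span of the remaining generators, these are the coefficients
  at \<open>x\<close> of elements of \<open>B\<close>; the ideal records how \<open>B\<close> meets
  the cosets of \<open>A\<close>.\<close>

lemma ideal_of_coefficients:
  assumes x: "x \<in> carrier M" and A: "submodule A R M" and B: "submodule B R M"
  shows "ideal {r \<in> carrier R. \<exists>s\<in>A. r \<odot>\<^bsub>M\<^esub> x \<oplus>\<^bsub>M\<^esub> s \<in> B} R" (is "ideal ?I R")
proof (rule idealI)
  note AE = submoduleE[OF A] and BE = submoduleE[OF B]
  note Ac = subsetD[OF AE(1)]
  show "ring R" by (rule R.ring_axioms)
  show "subgroup ?I (add_monoid R)"
  proof (rule R.add.subgroupI)
    show "?I \<subseteq> carrier R" by auto
    have "\<zero>\<^bsub>R\<^esub> \<in> ?I" using submodule_zero[OF A] submodule_zero[OF B] x by force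
    then show "?I \<noteq> {}" by blast
    fix a assume "a \<in> ?I"
    then obtain s where h: "a \<in> carrier R" "s \<in> A" "a \<odot>\<^bsub>M\<^esub> x \<oplus>\<^bsub>M\<^esub> s \<in> B" by blast
    have "(\<ominus>\<^bsub>R\<^esub> a) \<odot>\<^bsub>M\<^esub> x \<oplus>\<^bsub>M\<^esub> (\<ominus>\<^bsub>M\<^esub> s) \<in> B"
      using BE(3)[OF h(3)] h x Ac by (simp add: smult_l_minus M.minus_add)
    then show "\<ominus>\<^bsub>R\<^esub> a \<in> ?I" using h AE(3) by blast
  next
    fix a b assume "a \<in> ?I" "b \<in> ?I"
    then obtain s t where h: "a \<in> carrier R" "s \<in> A" "a \<odot>\<^bsub>M\<^esub> x \<oplus>\<^bsub>M\<^esub> s \<in> B"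
      "b \<in> carrier R" "t \<in> A" "b \<odot>\<^bsub>M\<^esub> x \<oplus>\<^bsub>M\<^esub> t \<in> B" by blast
    have "(a \<oplus>\<^bsub>R\<^esub> b) \<odot>\<^bsub>M\<^esub> x \<oplus>\<^bsub>M\<^esub> (s \<oplus>\<^bsub>M\<^esub> t) \<in> B"
      using BE(5)[OF h(3,6)] h x Ac by (simp add: smult_l_distr M.a_ac)
    then show "a \<oplus>\<^bsub>R\<^esub> b \<in> ?I" using h AE(5) by blast
  qed
  fix a r assume "a \<in> ?I" and r: "r \<in> carrier R"
  then obtain s where h: "a \<in> carrier R" "s \<in> A" "a \<odot>\<^bsub>M\<^esub> x \<oplus>\<^bsub>M\<^esub> s \<in> B" by blast
  have "(r \<otimes>\<^bsub>R\<^esub> a) \<odot>\<^bsub>M\<^esub> x \<oplus>\<^bsub>M\<^esub> (r \<odot>\<^bsub>M\<^esub> s) \<in> B"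
    using BE(4)[OF r h(3)] h x Ac r by (simp add: smult_r_distr smult_assoc1)
  then show "r \<otimes>\<^bsub>R\<^esub> a \<in> ?I" using h r AE(4) by blast
  then show "a \<otimes>\<^bsub>R\<^esub> r \<in> ?I" using h r by (simp add: R.m_comm)
qed

text \<open>Induction on the generators reduces the chain condition to that for ideals: along the
  chain, a member is determined by its ideal of coefficients at the new generator \<open>x\<close>
  together with its intersection with the span of the others. This is the usual argument with a
  submodule and its quotient, carried out with ideals instead of quotient modules.\<close>

lemma artinian_chain_stabilizes:
  assumes art: "artinian_cring R" and "finite S" and "S \<subseteq> carrier M"
    and "\<And>n::nat. submodule (N n) R M" "\<And>n. N (Suc n) \<subseteq> N n" "\<And>n. N n \<subseteq> lin_span R M S"
  shows "\<exists>n0. \<forall>n\<ge>n0. N n = N n0"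
  using assms(2-)
proof (induction S arbitrary: N rule: finite_induct)
  case empty
  have "submodule {\<zero>\<^bsub>M\<^esub>} R M" by (rule submoduleI) auto
  then have "N n \<subseteq> {\<zero>\<^bsub>M\<^esub>}" for n using empty(4)[of n] unfolding lin_span_def by auto
  then have "N n = {\<zero>\<^bsub>M\<^esub>}" for n using submodule_zero[OF empty(2)] by blast
  then show ?case by auto
next
  case (insert x S)
  have x: "x \<in> carrier M" and S: "S \<subseteq> carrier M" using insert.prems by auto
  note L = submodule_lin_span[OF S]
  define I where "I n = {r \<in> carrier R. \<exists>s\<in>lin_span R M S. r \<odot>\<^bsub>M\<^esub> x \<oplus>\<^bsub>M\<^esub> s \<in> N n}" for n
  have "\<And>n. ideal (I n) R" unfolding I_def by (rule ideal_of_coefficients[OF x L insert.prems(2)])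
  moreover have "\<And>n. I (Suc n) \<subseteq> I n" unfolding I_def using insert.prems(3) by blast
  ultimately obtain n1 where n1: "\<And>n. n \<ge> n1 \<Longrightarrow> I n = I n1"
    using artinian_cring.dcc[OF art, of I] by blast
  have "\<exists>n0. \<forall>n\<ge>n0. N n \<inter> lin_span R M S = N n0 \<inter> lin_span R M S"
    by (rule insert.IH[OF S submodule_Int[OF insert.prems(2) L]]) (use insert.prems(3) in blast)+
  then obtain n2 where n2: "\<And>n. n \<ge> n2 \<Longrightarrow> N n \<inter> lin_span R M S = N n2 \<inter> lin_span R M S" by blast
  define m where "m = max n1 n2"
  have dec: "N n \<subseteq> N m" if "n \<ge> m" for n using lift_Suc_antimono_le[of N] insert.prems(3) that by blast
  have "N m \<subseteq> N n" if n: "n \<ge> m" for n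
  proof
    fix y assume y: "y \<in> N m"
    obtain r s where rs: "r \<in> carrier R" "s \<in> lin_span R M S" "y = r \<odot>\<^bsub>M\<^esub> x \<oplus>\<^bsub>M\<^esub> s"
      using lin_span_insert[OF x S] insert.prems(4) y by blast
    have "r \<in> I m" using rs y unfolding I_def by blast
    then have "r \<in> I n" using n1[of m] n1[of n] n unfolding m_def by simp
    then obtain s' where s': "s' \<in> lin_span R M S" "r \<odot>\<^bsub>M\<^esub> x \<oplus>\<^bsub>M\<^esub> s' \<in> N n" unfolding I_def by blast
    \<comment> \<open>\<open>y\<close> and r x + s' have the same coefficient at \<open>x\<close>;
      their difference s - s' therefore lies in the span of \<open>S\<close>, where the chain is
      already constant.\<close>
    have c: "s \<in> carrier M" "s' \<in> carrier M" using rs s' submoduleE(1)[OF L] by auto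
    have "\<ominus>\<^bsub>M\<^esub> (r \<odot>\<^bsub>M\<^esub> x \<oplus>\<^bsub>M\<^esub> s') \<in> N m"
      using s' dec[OF n] submoduleE(3)[OF insert.prems(2)] by blast
    then have "y \<oplus>\<^bsub>M\<^esub> \<ominus>\<^bsub>M\<^esub> (r \<odot>\<^bsub>M\<^esub> x \<oplus>\<^bsub>M\<^esub> s') \<in> N m"
      using y submoduleE(5)[OF insert.prems(2)] by blast
    also have eq: "y \<oplus>\<^bsub>M\<^esub> \<ominus>\<^bsub>M\<^esub> (r \<odot>\<^bsub>M\<^esub> x \<oplus>\<^bsub>M\<^esub> s') = s \<oplus>\<^bsub>M\<^esub> \<ominus>\<^bsub>M\<^esub> s'"
    proof -
      have "y \<oplus>\<^bsub>M\<^esub> \<ominus>\<^bsub>M\<^esub> (r \<odot>\<^bsub>M\<^esub> x \<oplus>\<^bsub>M\<^esub> s')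
        = (r \<odot>\<^bsub>M\<^esub> x \<oplus>\<^bsub>M\<^esub> \<ominus>\<^bsub>M\<^esub> (r \<odot>\<^bsub>M\<^esub> x)) \<oplus>\<^bsub>M\<^esub> (s \<oplus>\<^bsub>M\<^esub> \<ominus>\<^bsub>M\<^esub> s')"
        using rs(1) c x unfolding rs(3)
        by (simp only: M.minus_add M.a_ac smult_closed M.a_closed M.a_inv_closed)
      then show ?thesis using rs(1) c x by (simp add: M.r_neg)
    qed
    finally have "s \<oplus>\<^bsub>M\<^esub> \<ominus>\<^bsub>M\<^esub> s' \<in> N m \<inter> lin_span R M S"
      using rs s' submoduleE(3,5)[OF L] by blast
    then have "s \<oplus>\<^bsub>M\<^esub> \<ominus>\<^bsub>M\<^esub> s' \<in> N n" using n2[of m] n2[of n] n unfolding m_def by auto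
    then have "y \<oplus>\<^bsub>M\<^esub> \<ominus>\<^bsub>M\<^esub> (r \<odot>\<^bsub>M\<^esub> x \<oplus>\<^bsub>M\<^esub> s') \<oplus>\<^bsub>M\<^esub> (r \<odot>\<^bsub>M\<^esub> x \<oplus>\<^bsub>M\<^esub> s') \<in> N n"
      using s' eq submoduleE(5)[OF insert.prems(2)] by simp
    moreover have "y \<oplus>\<^bsub>M\<^esub> \<ominus>\<^bsub>M\<^esub> (r \<odot>\<^bsub>M\<^esub> x \<oplus>\<^bsub>M\<^esub> s') \<oplus>\<^bsub>M\<^esub> (r \<odot>\<^bsub>M\<^esub> x \<oplus>\<^bsub>M\<^esub> s') = y"
      using rs c x by (simp add: M.a_assoc M.l_neg)
    ultimately show "y \<in> N n" by simp
  qed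
  then show ?case using dec by blast
qed

end

text \<open>A family without a minimal member would yield, by dependent choice, a strictly
  descending sequence. The lemma is applied to the images of Hom(c, t) for varying epimorphisms
  \<open>t\<close>.\<close>

lemma artinian_minimal_submodule:
  assumes art: "artinian_cring R" and fg: "finitely_generated_module R M"
    and sub: "\<And>N. N \<in> \<N> \<Longrightarrow> submodule N R M" and "\<N> \<noteq> {}"
  shows "\<exists>N\<in>\<N>. \<forall>N'\<in>\<N>. \<not> N' \<subset> N"
proof (rule ccontr)
  assume no: "\<not> ?thesis"
  interpret module R M using fg unfolding finitely_generated_module_def by blast
  obtain S where S: "finite S" "S \<subseteq> carrier M" "\<forall>N. submodule N R M \<and> S \<subseteq> N \<longrightarrow> N = carrier M"
    using fg unfolding finitely_generated_module_def by blast
  have span: "lin_span R M S = carrier M"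
    using S(3) submodule_lin_span[OF S(2)] lin_span_superset[of S] by simp
  obtain f :: "nat \<Rightarrow> 'c set" where f: "\<And>n. f n \<in> \<N>" "\<And>n. f (Suc n) \<subset> f n"
  proof (atomize_elim, rule ex_forward[OF dependent_nat_choice[of "\<lambda>_ N. N \<in> \<N>" "\<lambda>_ N N'. N' \<subset> N"]])
    show "\<exists>N. N \<in> \<N>" using \<open>\<N> \<noteq> {}\<close> by blast
    show "\<exists>N'. N' \<in> \<N> \<and> N' \<subset> N" if "N \<in> \<N>" for N using no that by blast
  qed blast
  have "\<exists>n0. \<forall>n\<ge>n0. f n = f n0"
    by (rule artinian_chain_stabilizes[OF art S(1,2)]) (use f sub span submoduleE(1) in \<open>auto simp: psubset_eq\<close>)
  then show False using f(2) by (metis le_SucI order_refl psubset_eq)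
qed

section \<open>Linear and abelian categories\<close>

subsection \<open>The opposite category\<close>

text \<open>The definitions of dual notions match so closely that these rules rewrite a statement
  about \<open>opposite C\<close> into its dual about \<open>C\<close>. Many dual lemmas below are
  instances at \<open>opposite C\<close> followed by simplification.\<close>

lemma opposite_sel [simp]:
  "Obj (opposite C) = Obj C" "Arr (opposite C) = Arr C" "Dom (opposite C) = Cod C"
  "Cod (opposite C) = Dom C" "Ide (opposite C) = Ide C"
  "f \<bullet>\<^bsub>opposite C\<^esub> g = g \<bullet>\<^bsub>C\<^esub> f" "Zero (opposite C) X Y = Zero C Y X"
  "Plus (opposite C) = Plus C" "Scal (opposite C) = Scal C"
  unfolding opposite_def by simp_all

lemma opposite_opposite [simp]: "opposite (opposite C) = C"
  unfolding opposite_def by simp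

lemma Hom_opposite [simp]: "Hom (opposite C) X Y = Hom C Y X"
  unfolding Hom_def by auto

lemma HomMod_opposite [simp]: "HomMod (opposite C) X Y = HomMod C Y X"
  unfolding HomMod_def by simp

lemma monomorphism_opposite [simp]: "monomorphism (opposite C) = epimorphism C"
  unfolding monomorphism_def epimorphism_def by simp

lemma epimorphism_opposite [simp]: "epimorphism (opposite C) = monomorphism C"
  unfolding monomorphism_def epimorphism_def by simp

lemma zero_object_opposite [simp]: "zero_object (opposite C) = zero_object C"
  unfolding zero_object_def by (intro ext) auto

lemma is_kernel_opposite [simp]: "is_kernel (opposite C) = is_cokernel C"
  unfolding is_kernel_def is_cokernel_def by simp

lemma is_cokernel_opposite [simp]: "is_cokernel (opposite C) = is_kernel C"
  unfolding is_kernel_def is_cokernel_def by simp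

lemma is_biproduct_opposite [simp]:
  "is_biproduct (opposite C) X Y B jX jY qX qY = is_biproduct C X Y B qX qY jX jY"
  unfolding is_biproduct_def by auto

lemma is_pullback_opposite [simp]: "is_pullback (opposite C) = is_pushout C"
  unfolding is_pullback_def is_pushout_def by simp

subsection \<open>Calculus of morphisms\<close>

context category begin

lemma HomI: "f \<in> Arr C \<Longrightarrow> Dom C f = X \<Longrightarrow> Cod C f = Y \<Longrightarrow> f \<in> Hom C X Y"
  unfolding Hom_def by simp

lemma HomD: "f \<in> Hom C X Y \<Longrightarrow> f \<in> Arr C \<and> Dom C f = X \<and> Cod C f = Y"
  unfolding Hom_def by simp

lemma Hom_Obj: "f \<in> Hom C X Y \<Longrightarrow> X \<in> Obj C \<and> Y \<in> Obj C"
  using Dom_Obj Cod_Obj unfolding Hom_def by auto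

declare Dom_Obj [simp] Cod_Obj [simp]

lemma Ide_sel [simp]:
  assumes "X \<in> Obj C"
  shows "Ide C X \<in> Arr C" "Dom C (Ide C X) = X" "Cod C (Ide C X) = X"
  using Ide_Hom[OF assms] unfolding Hom_def by auto

lemma Comp_sel [simp]:
  assumes "f \<in> Arr C" "g \<in> Arr C" "Cod C f = Dom C g"
  shows "g \<bullet> f \<in> Arr C" "Dom C (g \<bullet> f) = Dom C f" "Cod C (g \<bullet> f) = Cod C g"
  using Comp_Hom[of f "Dom C f" "Cod C f" g "Cod C g"] assms unfolding Hom_def by auto

lemma Comp_Ide_simp [simp]: "f \<in> Arr C \<Longrightarrow> Dom C f = X \<Longrightarrow> f \<bullet> Ide C X = f"
  using Comp_Ide[of f] unfolding Hom_def by auto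

lemma Ide_Comp_simp [simp]: "f \<in> Arr C \<Longrightarrow> Cod C f = X \<Longrightarrow> Ide C X \<bullet> f = f"
  using Ide_Comp[of f] unfolding Hom_def by auto

lemma Comp_assoc_simp [simp]:
  assumes "f \<in> Arr C" "g \<in> Arr C" "h \<in> Arr C" "Cod C f = Dom C g" "Cod C g = Dom C h"
  shows "(h \<bullet> g) \<bullet> f = h \<bullet> g \<bullet> f"
  using Comp_assoc[of f "Dom C f" "Cod C f" g "Cod C g" h "Cod C h"] assms unfolding Hom_def by auto

text \<open>\<open>Comp_assoc_simp\<close> nests compositions to the right, so an equation for
  \<open>g \<bullet> f\<close> no longer matches inside \<open>g \<bullet> f \<bullet> x\<close>;
  this is its form under that nesting.\<close>

lemma Comp_reduce:
  assumes "g \<bullet> f = h" "f \<in> Arr C" "g \<in> Arr C" "Cod C f = Dom C g" "x \<in> Arr C" "Cod C x = Dom C f"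
  shows "g \<bullet> f \<bullet> x = h \<bullet> x"
  using Comp_assoc_simp[of x f g] assms by simp

end

lemma (in category) category_opposite: "category (opposite C)"
  by unfold_locales
(auto simp: Hom_def)

lemma (in linear_category) linear_category_opposite: "linear_category k (opposite C)"
proof (intro linear_category.intro linear_category_axioms.intro category_opposite K.is_cring)
qed (auto simp: HomMod_module Comp_Plus_left Comp_Plus_right Comp_Scal_left Comp_Scal_right)

lemma (in abelian_category) abelian_category_opposite: "abelian_category k (opposite C)"
proof (intro abelian_category.intro abelian_category_axioms.intro linear_category_opposite)
  fix X Y assume "X \<in> Obj (opposite C)" "Y \<in> Obj (opposite C)"
  then show "\<exists>B jX jY qX qY. is_biproduct (opposite C) X Y B jX jY qX qY"
    using ex_biproduct[of X Y] by simp metis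
qed (auto simp: ex_zero_object ex_kernel ex_cokernel mono_is_kernel epi_is_cokernel)

context linear_category begin

lemma Plus_sel [simp]:
  assumes "f \<in> Arr C" "g \<in> Arr C" "Dom C f = Dom C g" "Cod C f = Cod C g"
  shows "f \<boxplus> g \<in> Arr C" "Dom C (f \<boxplus> g) = Dom C g" "Cod C (f \<boxplus> g) = Cod C g"
proof -
  interpret module k "HomMod C (Dom C f) (Cod C f)" using assms by (intro HomMod_module) auto
  have "f \<boxplus> g \<in> Hom C (Dom C f) (Cod C f)"
    using add.m_closed[of f g] assms unfolding HomMod_def Hom_def by simp
  then show "f \<boxplus> g \<in> Arr C" "Dom C (f \<boxplus> g) = Dom C g" "Cod C (f \<boxplus> g) = Cod C g"
    using assms unfolding Hom_def by auto
qed

lemma Scal_sel [simp]: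
  assumes "f \<in> Arr C" "r \<in> carrier k"
  shows "Scal C r f \<in> Arr C" "Dom C (Scal C r f) = Dom C f" "Cod C (Scal C r f) = Cod C f"
proof -
  interpret module k "HomMod C (Dom C f) (Cod C f)" using assms by (intro HomMod_module) auto
  have "Scal C r f \<in> Hom C (Dom C f) (Cod C f)"
    using smult_closed[of r f] assms unfolding HomMod_def Hom_def by simp
  then show "Scal C r f \<in> Arr C" "Dom C (Scal C r f) = Dom C f" "Cod C (Scal C r f) = Cod C f"
    unfolding Hom_def by auto
qed

lemma Zero_sel [simp]:
  assumes "X \<in> Obj C" "Y \<in> Obj C"
  shows "Zero C X Y \<in> Arr C" "Dom C (Zero C X Y) = X" "Cod C (Zero C X Y) = Y"
proof -
  interpret module k "HomMod C X Y" using assms by (intro HomMod_module)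
  show "Zero C X Y \<in> Arr C" "Dom C (Zero C X Y) = X" "Cod C (Zero C X Y) = Y"
    using M.zero_closed unfolding HomMod_def Hom_def by auto
qed

lemma Zero_Hom: "X \<in> Obj C \<Longrightarrow> Y \<in> Obj C \<Longrightarrow> Zero C X Y \<in> Hom C X Y"
  by (simp add: Hom_def)

lemma Plus_Hom: "f \<in> Hom C X Y \<Longrightarrow> g \<in> Hom C X Y \<Longrightarrow> f \<boxplus> g \<in> Hom C X Y"
  by (simp add: Hom_def)

lemma Scal_Hom: "r \<in> carrier k \<Longrightarrow> f \<in> Hom C X Y \<Longrightarrow> Scal C r f \<in> Hom C X Y"
  by (simp add: Hom_def)

text \<open>Negation through the scalar -1 commutes with composition by the scalar laws, and it
  avoids naming the Hom-module in which the inverse is taken.\<close>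

definition neg where
  "neg f = Scal C (\<ominus>\<^bsub>k\<^esub> \<one>\<^bsub>k\<^esub>) f"

lemma neg_sel [simp]:
  assumes "f \<in> Arr C"
  shows "neg f \<in> Arr C" "Dom C (neg f) = Dom C f" "Cod C (neg f) = Cod C f"
  using assms unfolding neg_def by simp_all

lemma Plus_assoc:
  assumes "f \<in> Hom C X Y" "g \<in> Hom C X Y" "h \<in> Hom C X Y"
  shows "f \<boxplus> g \<boxplus> h = f \<boxplus> (g \<boxplus> h)"
proof -
  interpret module k "HomMod C X Y" using assms by (intro HomMod_module) (auto dest: Hom_Obj)
  show ?thesis using M.a_assoc[of f g h] assms unfolding HomMod_def by simp
qed

lemma Plus_commute:
  assumes "f \<in> Hom C X Y" "g \<in> Hom C X Y"
  shows "f \<boxplus> g = g \<boxplus> f"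
proof -
  interpret module k "HomMod C X Y" using assms by (intro HomMod_module) (auto dest: Hom_Obj)
  show ?thesis using M.a_comm[of f g] assms unfolding HomMod_def by simp
qed

lemma Plus_Zero [simp]:
  assumes "f \<in> Arr C" "Dom C f = X" "Cod C f = Y"
  shows "f \<boxplus> Zero C X Y = f" "Zero C X Y \<boxplus> f = f"
proof -
  interpret module k "HomMod C X Y" using assms by (intro HomMod_module) auto
  show "f \<boxplus> Zero C X Y = f" "Zero C X Y \<boxplus> f = f"
    using M.r_zero[of f] M.l_zero[of f] assms unfolding HomMod_def Hom_def by simp_all
qed

lemma Plus_neg [simp]:
  assumes "f \<in> Arr C"
  shows "f \<boxplus> neg f = Zero C (Dom C f) (Cod C f)" "neg f \<boxplus> f = Zero C (Dom C f) (Cod C f)"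
proof -
  interpret module k "HomMod C (Dom C f) (Cod C f)" using assms by (intro HomMod_module) auto
  show "f \<boxplus> neg f = Zero C (Dom C f) (Cod C f)" "neg f \<boxplus> f = Zero C (Dom C f) (Cod C f)"
    using smult_l_minus[OF K.one_closed, of f] M.r_neg[of f] M.l_neg[of f] smult_one[of f] assms
    unfolding neg_def HomMod_def Hom_def by simp_all
qed

lemma Plus_neg_eq_Zero:
  assumes "f \<in> Hom C X Y" "g \<in> Hom C X Y" "f \<boxplus> neg g = Zero C X Y"
  shows "f = g"
proof -
  have g: "neg g \<in> Hom C X Y" using assms(2) by (simp add: Hom_def)
  have "f = f \<boxplus> (neg g \<boxplus> g)" using assms(1,2) by (simp add: Hom_def)
  also have "\<dots> = Zero C X Y \<boxplus> g" using Plus_assoc[OF assms(1) g assms(2)] assms(3) by simp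
  finally show ?thesis using assms(2) by (simp add: Hom_def)
qed

lemma Comp_Plus_simp [simp]:
  assumes "f \<in> Arr C" "f' \<in> Arr C" "g \<in> Arr C" "Dom C f = Dom C f'" "Cod C f = Cod C f'" "Cod C f' = Dom C g"
  shows "g \<bullet> (f \<boxplus> f') = g \<bullet> f \<boxplus> g \<bullet> f'"
  by (rule Comp_Plus_right[of _ "Dom C f" "Cod C f" _ _ "Cod C g"]) (use assms in \<open>simp_all add: Hom_def\<close>)

lemma Plus_Comp_simp [simp]:
  assumes "f \<in> Arr C" "g \<in> Arr C" "g' \<in> Arr C" "Dom C g = Dom C g'" "Cod C g = Cod C g'" "Cod C f = Dom C g'"
  shows "(g \<boxplus> g') \<bullet> f = g \<bullet> f \<boxplus> g' \<bullet> f"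
  by (rule Comp_Plus_left[of _ "Dom C f" "Cod C f" _ "Cod C g"]) (use assms in \<open>simp_all add: Hom_def\<close>)

lemma Comp_Scal_simp [simp]:
  assumes "f \<in> Arr C" "g \<in> Arr C" "Cod C f = Dom C g" "r \<in> carrier k"
  shows "g \<bullet> Scal C r f = Scal C r (g \<bullet> f)" "Scal C r g \<bullet> f = Scal C r (g \<bullet> f)"
  using Comp_Scal_right[of r f "Dom C f" "Cod C f" g "Cod C g"]
    Comp_Scal_left[of r f "Dom C f" "Cod C f" g "Cod C g"] assms by (simp_all add: Hom_def)

lemma Comp_neg [simp]:
  assumes "f \<in> Arr C" "g \<in> Arr C" "Cod C f = Dom C g"
  shows "g \<bullet> neg f = neg (g \<bullet> f)" "neg g \<bullet> f = neg (g \<bullet> f)"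
  using assms unfolding neg_def by simp_all

lemma Scal_null:
  assumes "f \<in> Arr C"
  shows "Scal C \<zero>\<^bsub>k\<^esub> f = Zero C (Dom C f) (Cod C f)"
proof -
  interpret module k "HomMod C (Dom C f) (Cod C f)" using assms by (intro HomMod_module) auto
  show ?thesis using smult_l_null[of f] assms unfolding HomMod_def Hom_def by simp
qed

lemma Scal_Zero:
  assumes "r \<in> carrier k" "X \<in> Obj C" "Y \<in> Obj C"
  shows "Scal C r (Zero C X Y) = Zero C X Y"
proof -
  interpret module k "HomMod C X Y" using assms by (intro HomMod_module) auto
  show ?thesis using smult_r_null[of r] assms unfolding HomMod_def by simp
qed

lemma neg_Zero [simp]: "X \<in> Obj C \<Longrightarrow> Y \<in> Obj C \<Longrightarrow> neg (Zero C X Y) = Zero C X Y"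
  unfolding neg_def by (simp add: Scal_Zero)

lemma Comp_Zero [simp]:
  assumes "f \<in> Arr C" "W \<in> Obj C"
  shows "Dom C f = X \<Longrightarrow> f \<bullet> Zero C W X = Zero C W (Cod C f)"
    "Cod C f = X \<Longrightarrow> Zero C X W \<bullet> f = Zero C (Dom C f) W"
proof -
  assume X: "Dom C f = X"
  have "f \<bullet> Scal C \<zero>\<^bsub>k\<^esub> (Zero C W X) = Scal C \<zero>\<^bsub>k\<^esub> (f \<bullet> Zero C W X)"
    using assms X by (intro Comp_Scal_simp) auto
  then show "f \<bullet> Zero C W X = Zero C W (Cod C f)" using assms X by (auto simp: Scal_null)
next
  assume X: "Cod C f = X"
  have "Scal C \<zero>\<^bsub>k\<^esub> (Zero C X W) \<bullet> f = Scal C \<zero>\<^bsub>k\<^esub> (Zero C X W \<bullet> f)"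
    using assms X by (intro Comp_Scal_simp) auto
  then show "Zero C X W \<bullet> f = Zero C (Dom C f) W" using assms X by (auto simp: Scal_null)
qed

lemma monomorphism_cancel:
  assumes "monomorphism C m" "f \<in> Arr C" "g \<in> Arr C" "Dom C f = Dom C g"
    "Cod C f = Dom C m" "Cod C g = Dom C m" "m \<bullet> f = m \<bullet> g"
  shows "f = g"
  using assms unfolding monomorphism_def Hom_def by blast

lemma monomorphismI:
  assumes "m \<in> Arr C"
    and z: "\<And>t. t \<in> Arr C \<Longrightarrow> Cod C t = Dom C m \<Longrightarrow> m \<bullet> t = Zero C (Dom C t) (Cod C m) \<Longrightarrow>
      t = Zero C (Dom C t) (Dom C m)"
  shows "monomorphism C m"
  unfolding monomorphism_def
proof (intro conjI allI ballI impI)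
  fix T f g assume h: "f \<in> Hom C T (Dom C m)" "g \<in> Hom C T (Dom C m)" "m \<bullet> f = m \<bullet> g"
  have "f \<boxplus> neg g = Zero C T (Dom C m)"
    using z[of "f \<boxplus> neg g"] h assms(1) by (simp add: Hom_def)
  then show "f = g" by (rule Plus_neg_eq_Zero[OF h(1,2)])
qed (rule assms(1))

lemma monomorphism_Zero:
  assumes "monomorphism C m" "t \<in> Arr C" "Cod C t = Dom C m" "m \<bullet> t = Zero C (Dom C t) (Cod C m)"
  shows "t = Zero C (Dom C t) (Dom C m)"
proof -
  have "m \<in> Arr C" using assms(1) unfolding monomorphism_def by simp
  then show ?thesis using assms(2-) by - (rule monomorphism_cancel[OF assms(1)], auto)
qed

lemmas epimorphismI = linear_category.monomorphismI[OF linear_category_opposite, simplified]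
lemmas epimorphism_Zero = linear_category.monomorphism_Zero[OF linear_category_opposite, simplified]

lemma is_kernelD:
  assumes "is_kernel C f i"
  shows "f \<in> Arr C" "i \<in> Arr C" "Cod C i = Dom C f" "f \<bullet> i = Zero C (Dom C i) (Cod C f)"
  using assms unfolding is_kernel_def by auto

lemma kernel_factor:
  assumes "is_kernel C f i" "t \<in> Arr C" "Cod C t = Dom C f" "f \<bullet> t = Zero C (Dom C t) (Cod C f)"
  obtains u where "u \<in> Arr C" "Dom C u = Dom C t" "Cod C u = Dom C i" "i \<bullet> u = t"
proof -
  have "Dom C t \<in> Obj C" using assms by simp
  then have "\<exists>u. u \<in> Hom C (Dom C t) (Dom C i) \<and> i \<bullet> u = t"
    using assms unfolding is_kernel_def Hom_def by blast
  then show ?thesis using that unfolding Hom_def by blast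
qed

lemma kernel_monomorphism:
  assumes "is_kernel C f i"
  shows "monomorphism C i"
  unfolding monomorphism_def
proof (intro conjI allI ballI impI)
  note D = is_kernelD[OF assms]
  show "i \<in> Arr C" by (rule D)
  fix T s t assume h: "s \<in> Hom C T (Dom C i)" "t \<in> Hom C T (Dom C i)" "i \<bullet> s = i \<bullet> t"
  then have s: "s \<in> Arr C" "Dom C s = T" "Cod C s = Dom C i" and T: "T \<in> Obj C"
    by (auto simp: Hom_def)
  have "f \<bullet> i \<bullet> s = Zero C T (Cod C f)"
    using D s Comp_reduce[OF D(4) D(2,1,3) s(1,3)] by simp
  moreover have "i \<bullet> s \<in> Hom C T (Dom C f)" using s D by (simp add: Hom_def)
  ultimately have "\<exists>!u. u \<in> Hom C T (Dom C i) \<and> i \<bullet> u = i \<bullet> s"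
    using assms T unfolding is_kernel_def by blast
  then show "s = t" using h by metis
qed

lemma is_kernelI:
  assumes "f \<in> Arr C" "Cod C i = Dom C f" "f \<bullet> i = Zero C (Dom C i) (Cod C f)" and i: "monomorphism C i"
    and "\<And>t. t \<in> Arr C \<Longrightarrow> Cod C t = Dom C f \<Longrightarrow> f \<bullet> t = Zero C (Dom C t) (Cod C f) \<Longrightarrow>
       \<exists>u. u \<in> Arr C \<and> Dom C u = Dom C t \<and> Cod C u = Dom C i \<and> i \<bullet> u = t"
  shows "is_kernel C f i"
  unfolding is_kernel_def
proof (intro conjI ballI impI)
  fix T t assume "t \<in> Hom C T (Dom C f)" "f \<bullet> t = Zero C T (Cod C f)"
  then obtain u where u: "u \<in> Hom C T (Dom C i)" "i \<bullet> u = t"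
    using assms(5)[of t] unfolding Hom_def by blast
  then show "\<exists>!u. u \<in> Hom C T (Dom C i) \<and> i \<bullet> u = t"
    by (intro ex1I[of _ u]) (use i in \<open>auto simp: Hom_def intro: monomorphism_cancel\<close>)
qed (use assms in \<open>auto simp: monomorphism_def\<close>)

lemmas is_cokernelD = linear_category.is_kernelD[OF linear_category_opposite, simplified]
lemmas cokernel_factor = linear_category.kernel_factor[OF linear_category_opposite, simplified]
lemmas cokernel_epimorphism = linear_category.kernel_monomorphism[OF linear_category_opposite, simplified]
lemmas is_cokernelI = linear_category.is_kernelI[OF linear_category_opposite, simplified]

lemma is_biproductD:
  assumes "is_biproduct C X Y B jX jY qX qY"
  shows "X \<in> Obj C" "Y \<in> Obj C" "B \<in> Obj C"
    "jX \<in> Arr C" "Dom C jX = X" "Cod C jX = B" "jY \<in> Arr C" "Dom C jY = Y" "Cod C jY = B"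
    "qX \<in> Arr C" "Dom C qX = B" "Cod C qX = X" "qY \<in> Arr C" "Dom C qY = B" "Cod C qY = Y"
    "qX \<bullet> jX = Ide C X" "qY \<bullet> jY = Ide C Y" "qX \<bullet> jY = Zero C Y X" "qY \<bullet> jX = Zero C X Y"
    "jX \<bullet> qX \<boxplus> jY \<bullet> qY = Ide C B"
  using assms unfolding is_biproduct_def Hom_def by auto

lemma is_biproduct_reduce:
  assumes "is_biproduct C X Y B jX jY qX qY" "x \<in> Arr C"
  shows "Cod C x = X \<Longrightarrow> qX \<bullet> jX \<bullet> x = x" "Cod C x = Y \<Longrightarrow> qY \<bullet> jY \<bullet> x = x"
    "Cod C x = Y \<Longrightarrow> qX \<bullet> jY \<bullet> x = Zero C (Dom C x) X" "Cod C x = X \<Longrightarrow> qY \<bullet> jX \<bullet> x = Zero C (Dom C x) Y"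
  using is_biproductD[OF assms(1)] assms(2) by (simp_all add: Comp_reduce)

end

section \<open>Epimorphisms, kernels and pullbacks in abelian categories\<close>

context abelian_category begin

text \<open>\<open>m\<close> is the kernel of some \<open>f\<close>, and \<open>m\<close> being epi
  forces \<open>f\<close> to vanish. The identity then factors through \<open>m\<close>, which gives
  a one-sided inverse; as \<open>m\<close> is mono, it is two-sided.\<close>

lemma mono_epi_isomorphism:
  assumes m: "monomorphism C m" and e: "epimorphism C m"
  shows "isomorphism C m"
proof -
  have mA: "m \<in> Arr C" using m unfolding monomorphism_def by simp
  obtain f where f: "is_kernel C f m" using mono_is_kernel[OF m] by blast
  note D = is_kernelD[OF f]
  have f0: "f = Zero C (Dom C f) (Cod C f)"
    using epimorphism_Zero[OF e, of f] D by simp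
  have fI: "f \<bullet> Ide C (Dom C f) = Zero C (Dom C f) (Cod C f)" using f0 D by simp
  obtain s where s: "s \<in> Arr C" "Dom C s = Dom C f" "Cod C s = Dom C m" "m \<bullet> s = Ide C (Dom C f)"
    by (rule kernel_factor[OF f, of "Ide C (Dom C f)"]) (use D fI in auto)
  have "m \<bullet> s \<bullet> m = m" using Comp_reduce[OF s(4)] s D by simp
  then have "s \<bullet> m = Ide C (Dom C m)" using s D
    by - (rule monomorphism_cancel[OF m], auto)
  then show ?thesis using s D unfolding isomorphism_def Hom_def by auto
qed

text \<open>\<open>e\<close> is the cokernel of some \<open>f\<close>, which factors through the
  kernel \<open>i\<close>; so whatever kills \<open>i\<close> kills \<open>f\<close> and factors
  through \<open>e\<close>.\<close>

lemma epimorphism_cokernel_of_kernel: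
  assumes e: "epimorphism C e" and i: "is_kernel C e i"
  shows "is_cokernel C i e"
proof -
  obtain f where f: "is_cokernel C f e" using epi_is_cokernel[OF e] by blast
  note D = is_kernelD[OF i] and F = is_cokernelD[OF f]
  obtain u where u: "u \<in> Arr C" "Dom C u = Dom C f" "Cod C u = Dom C i" "i \<bullet> u = f"
    by (rule kernel_factor[OF i, of f]) (use D F in auto)
  show ?thesis
  proof (rule is_cokernelI)
    fix t assume t: "t \<in> Arr C" "Dom C t = Cod C i" "t \<bullet> i = Zero C (Dom C i) (Cod C t)"
    have "t \<bullet> f = (t \<bullet> i) \<bullet> u" using Comp_assoc_simp[of u i t] u t D by simp
    also have "\<dots> = Zero C (Dom C f) (Cod C t)" unfolding t(3) using u t D by simp
    finally obtain v where "v \<in> Arr C" "Cod C v = Cod C t" "Dom C v = Cod C e" "v \<bullet> e = t"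
      by (rule cokernel_factor[OF f, rotated 2]) (use t D F in auto)
    then show "\<exists>v. v \<in> Arr C \<and> Cod C v = Cod C t \<and> Dom C v = Cod C e \<and> v \<bullet> e = t" by blast
  qed (use D e in auto)
qed

text \<open>The pullback is the kernel \<open>m\<close> of d = (f, -p) on the biproduct of the
  domains. Since \<open>p\<close> is epi so is \<open>d\<close>, hence \<open>d\<close> is the
  cokernel of \<open>m\<close>; that is what makes the projection \<open>p'\<close> epi.\<close>

lemma epimorphism_pullback:
  assumes f: "f \<in> Arr C" and p: "epimorphism C p" and fp: "Cod C f = Cod C p"
  obtains g p' where "is_pullback C f p g p'" "epimorphism C p'"
proof -
  have pA: "p \<in> Arr C" using p unfolding epimorphism_def by simp
  obtain B j1 j2 q1 q2 where B: "is_biproduct C (Dom C f) (Dom C p) B j1 j2 q1 q2"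
    using ex_biproduct[of "Dom C f" "Dom C p"] f pA by auto
  note BD = is_biproductD[OF B] and BR = is_biproduct_reduce[OF B]
  define d where "d = f \<bullet> q1 \<boxplus> neg (p \<bullet> q2)"
  have d: "d \<in> Arr C" "Dom C d = B" "Cod C d = Cod C p" unfolding d_def using f pA fp BD by simp_all
  have dj1: "d \<bullet> j1 = f" unfolding d_def using f pA fp BD by simp
  have dj2: "d \<bullet> j2 = neg p" unfolding d_def using f pA fp BD by simp
  have dep: "epimorphism C d"
  proof (rule epimorphismI)
    fix t assume t: "t \<in> Arr C" "Dom C t = Cod C d" "t \<bullet> d = Zero C (Dom C d) (Cod C t)"
    have "t \<bullet> neg p = (t \<bullet> d) \<bullet> j2" using Comp_assoc_simp[of j2 d t] t d BD pA dj2 by simp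
    also have "\<dots> = Zero C (Dom C p) (Cod C t)" unfolding t(3) using t d BD by simp
    finally have "neg (t \<bullet> p) = Zero C (Dom C p) (Cod C t)" using t d pA by simp
    moreover have "t \<bullet> p \<boxplus> neg (t \<bullet> p) = Zero C (Dom C p) (Cod C t)" using t d pA by simp
    ultimately have "t \<bullet> p = Zero C (Dom C p) (Cod C t)" using t d pA by simp
    then show "t = Zero C (Cod C d) (Cod C t)" using epimorphism_Zero[OF p, of t] t d by simp
  qed (rule d)
  obtain m where m: "is_kernel C d m" using ex_kernel d by blast
  note M = is_kernelD[OF m]
  note dcok = epimorphism_cokernel_of_kernel[OF dep m]
  define p' where "p' = q1 \<bullet> m"
  define g where "g = q2 \<bullet> m"
  have p': "p' \<in> Arr C" "Dom C p' = Dom C m" "Cod C p' = Dom C f" unfolding p'_def using M d BD by auto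
  have g: "g \<in> Arr C" "Dom C g = Dom C m" "Cod C g = Dom C p" unfolding g_def using M d BD by auto
  have "f \<bullet> p' \<boxplus> neg (p \<bullet> g) = d \<bullet> m" unfolding d_def p'_def g_def using M d BD f pA fp by simp
  then have sq: "f \<bullet> p' = p \<bullet> g"
    using M d p' g f pA fp by - (rule Plus_neg_eq_Zero[of _ "Dom C m" "Cod C p"], auto simp: Hom_def)
  have "is_pullback C f p g p'"
    unfolding is_pullback_def
  proof (intro conjI ballI impI)
    fix T a b assume T: "T \<in> Obj C" and a: "a \<in> Hom C T (Dom C f)" and b: "b \<in> Hom C T (Dom C p)"
      and ab: "f \<bullet> a = p \<bullet> b"
    have A: "a \<in> Arr C" "Dom C a = T" "Cod C a = Dom C f" "b \<in> Arr C" "Dom C b = T" "Cod C b = Dom C p"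
      using a b by (auto simp: Hom_def)
    define c where "c = j1 \<bullet> a \<boxplus> j2 \<bullet> b"
    have c: "c \<in> Arr C" "Dom C c = T" "Cod C c = B" unfolding c_def using A BD by auto
    have q1c: "q1 \<bullet> c = a" and q2c: "q2 \<bullet> c = b" unfolding c_def using A BD T by (simp_all add: BR)
    have "d \<bullet> c = Zero C T (Cod C d)"
      unfolding c_def using A BD d Comp_reduce[OF dj1] Comp_reduce[OF dj2] ab pA f fp by simp
    then obtain u where u: "u \<in> Arr C" "Dom C u = T" "Cod C u = Dom C m" "m \<bullet> u = c"
      using kernel_factor[OF m, of c] c d by metis
    have uu: "p' \<bullet> u = a" "g \<bullet> u = b" unfolding p'_def g_def using u M d BD q1c q2c by auto
    show "\<exists>!u. u \<in> Hom C T (Dom C p') \<and> p' \<bullet> u = a \<and> g \<bullet> u = b"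
    proof (rule ex1I[of _ u])
      show "u \<in> Hom C T (Dom C p') \<and> p' \<bullet> u = a \<and> g \<bullet> u = b" using u uu p' by (auto simp: Hom_def)
      fix v assume v: "v \<in> Hom C T (Dom C p') \<and> p' \<bullet> v = a \<and> g \<bullet> v = b"
      then have V: "v \<in> Arr C" "Dom C v = T" "Cod C v = Dom C m" using p' by (auto simp: Hom_def)
      have "m \<bullet> v = (j1 \<bullet> q1 \<boxplus> j2 \<bullet> q2) \<bullet> m \<bullet> v" unfolding BD(20) using V M d by simp
      also have "\<dots> = j1 \<bullet> (p' \<bullet> v) \<boxplus> j2 \<bullet> (g \<bullet> v)"
        unfolding p'_def g_def using V M d BD(1-15) by simp
      also have "\<dots> = m \<bullet> u" using v u unfolding c_def by simp
      finally show "v = u" using V u M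
        by - (rule monomorphism_cancel[OF kernel_monomorphism[OF m]], auto)
    qed
  qed (use f pA fp p' g sq in auto)
  moreover have "epimorphism C p'"
  proof (rule epimorphismI)
    fix t assume t: "t \<in> Arr C" "Dom C t = Cod C p'" "t \<bullet> p' = Zero C (Dom C p') (Cod C t)"
    \<comment> \<open>If \<open>t\<close> kills \<open>p'\<close>, then t q1 kills \<open>m\<close>
      and equals v d; restricting to the second summand gives v p = 0, so v = 0, t q1 = 0 and t =
      0.\<close>
    have "(t \<bullet> q1) \<bullet> m = Zero C (Dom C m) (Cod C t)" using t p' BD M d unfolding p'_def by simp
    then obtain v where v: "v \<in> Arr C" "Cod C v = Cod C t" "Dom C v = Cod C d" "v \<bullet> d = t \<bullet> q1"
      using cokernel_factor[OF dcok, of "t \<bullet> q1"] t p' BD M d by (metis Comp_sel)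
    have "neg (v \<bullet> p) = (v \<bullet> d) \<bullet> j2" using Comp_assoc_simp[of j2 d v] v d BD pA dj2 by simp
    also have "\<dots> = Zero C (Dom C p) (Cod C t)" unfolding v(4) using t p' BD by simp
    finally have "neg (v \<bullet> p) = Zero C (Dom C p) (Cod C t)" .
    moreover have "v \<bullet> p \<boxplus> neg (v \<bullet> p) = Zero C (Dom C p) (Cod C t)" using v d pA by simp
    ultimately have "v \<bullet> p = Zero C (Dom C p) (Cod C t)" using v d pA by simp
    then have "v = Zero C (Cod C p) (Cod C t)" using epimorphism_Zero[OF p, of v] v d by simp
    then have "t \<bullet> q1 = Zero C B (Cod C t)" using v d t pA by simp
    then have "(t \<bullet> q1) \<bullet> j1 = Zero C (Dom C f) (Cod C t)" using BD t p' by simp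
    then show "t = Zero C (Cod C p') (Cod C t)" using t p' BD by simp
  qed (rule p')
  ultimately show ?thesis using that by blast
qed

end

section \<open>Extensions\<close>

text \<open>A morphism from \<open>e'\<close> to \<open>e\<close> of short exact sequences with end
  maps \<open>h\<close> and \<open>f\<close>; the middle map is left existential. Equivalence,
  pullback and pushout of extensions are all instances with identities among the end maps, so
  composing such morphisms replaces most diagram chases.\<close>

definition ext_mor :: "('k, 'o, 'm) lincat \<Rightarrow> 'm \<Rightarrow> 'm \<Rightarrow> 'm \<times> 'm \<Rightarrow> 'm \<times> 'm \<Rightarrow> bool" where
  "ext_mor C h f e' e \<longleftrightarrow> (\<exists>g\<in>Arr C. Dom C g = Cod C (fst e') \<and> Cod C g = Cod C (fst e) \<and>
     g \<bullet>\<^bsub>C\<^esub> fst e' = fst e \<bullet>\<^bsub>C\<^esub> h \<and> snd e \<bullet>\<^bsub>C\<^esub> g = f \<bullet>\<^bsub>C\<^esub> snd e')"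

lemma extensions_opposite: "(p, i) \<in> extensions (opposite C) Y X \<longleftrightarrow> (i, p) \<in> extensions C X Y"
  unfolding extensions_def by auto

context abelian_category begin

lemma extensionsD:
  assumes "(i, p) \<in> extensions C X Y"
  shows "i \<in> Arr C" "p \<in> Arr C" "Dom C i = Y" "Dom C p = Cod C i" "Cod C p = X"
    "p \<bullet> i = Zero C Y X" "X \<in> Obj C" "Y \<in> Obj C"
    "monomorphism C i" "epimorphism C p" "is_kernel C p i" "is_cokernel C i p"
proof -
  show *: "is_kernel C p i" "is_cokernel C i p" using assms unfolding extensions_def by auto
  then show "monomorphism C i" "epimorphism C p"
    using kernel_monomorphism cokernel_epimorphism by blast+
  have h: "Dom C i = Y" "Cod C p = X" using assms unfolding extensions_def by auto
  then show "Dom C i = Y" "Cod C p = X" "i \<in> Arr C" "p \<in> Arr C" "Dom C p = Cod C i" "p \<bullet> i = Zero C Y X"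
    using is_kernelD[OF *(1)] by auto
  show "X \<in> Obj C" "Y \<in> Obj C" using is_kernelD[OF *(1)] h by auto
qed

lemma extensions_of_epimorphism:
  assumes "epimorphism C p" "is_kernel C p i"
  shows "(i, p) \<in> extensions C (Cod C p) (Dom C i)"
  using epimorphism_cokernel_of_kernel[OF assms] assms(2) unfolding extensions_def by simp

lemma ext_morI:
  assumes "g \<in> Arr C" "Dom C g = Cod C i'" "Cod C g = Cod C i" "g \<bullet> i' = i \<bullet> h" "p \<bullet> g = f \<bullet> p'"
  shows "ext_mor C h f (i', p') (i, p)"
  using assms unfolding ext_mor_def by auto

lemma ext_morE:
  assumes "ext_mor C h f (i', p') (i, p)"
  obtains g where "g \<in> Arr C" "Dom C g = Cod C i'" "Cod C g = Cod C i" "g \<bullet> i' = i \<bullet> h" "p \<bullet> g = f \<bullet> p'"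
  using assms unfolding ext_mor_def by auto

section \<open>The short five lemma and pullbacks of extensions\<close>

lemma ext_mor_opposite:
  "ext_mor (opposite C) f h (p, i) (p', i') \<longleftrightarrow> ext_mor C h f (i', p') (i, p)"
  if "(i, p) \<in> extensions C X Y" "(i', p') \<in> extensions C X' Y'"
  unfolding ext_mor_def using extensionsD[OF that(1)] extensionsD[OF that(2)] by auto

lemma ext_mor_comp:
  assumes "e1 \<in> extensions C X1 Y1" "e2 \<in> extensions C X2 Y2" "e3 \<in> extensions C X3 Y3"
    "h \<in> Hom C Y1 Y2" "f \<in> Hom C X1 X2" "h' \<in> Hom C Y2 Y3" "f' \<in> Hom C X2 X3"
    "ext_mor C h f e1 e2" "ext_mor C h' f' e2 e3"
  shows "ext_mor C (h' \<bullet> h) (f' \<bullet> f) e1 e3"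
proof -
  obtain i1 p1 i2 p2 i3 p3 where e: "e1 = (i1, p1)" "e2 = (i2, p2)" "e3 = (i3, p3)" by (metis surj_pair)
  note D1 = extensionsD[OF assms(1)[unfolded e]] and D2 = extensionsD[OF assms(2)[unfolded e]]
    and D3 = extensionsD[OF assms(3)[unfolded e]]
  obtain g where g: "g \<in> Arr C" "Dom C g = Cod C i1" "Cod C g = Cod C i2" "g \<bullet> i1 = i2 \<bullet> h" "p2 \<bullet> g = f \<bullet> p1"
    using assms(8) unfolding e by (rule ext_morE)
  obtain g' where g': "g' \<in> Arr C" "Dom C g' = Cod C i2" "Cod C g' = Cod C i3" "g' \<bullet> i2 = i3 \<bullet> h'" "p3 \<bullet> g' = f' \<bullet> p2"
    using assms(9) unfolding e by (rule ext_morE)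
  have H: "h \<in> Arr C" "Dom C h = Y1" "Cod C h = Y2" "f \<in> Arr C" "Dom C f = X1" "Cod C f = X2"
    "h' \<in> Arr C" "Dom C h' = Y2" "Cod C h' = Y3" "f' \<in> Arr C" "Dom C f' = X2" "Cod C f' = X3"
    using assms(4-7) unfolding Hom_def by auto
  show ?thesis unfolding e
  proof (rule ext_morI[of "g' \<bullet> g"])
    show "(g' \<bullet> g) \<bullet> i1 = i3 \<bullet> h' \<bullet> h" using g g' D1 D2 D3 H Comp_reduce[OF g'(4), of h] by simp
    show "p3 \<bullet> g' \<bullet> g = (f' \<bullet> f) \<bullet> p1" using g g' D1 D2 D3 H Comp_reduce[OF g'(5), of g] by simp
  qed (use g g' in auto)
qed

text \<open>Half of the short five lemma: a \<open>t\<close> killed by \<open>g\<close> is killed by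
  \<open>p\<close>, so it comes from the kernel, on which \<open>g\<close> restricts to the
  monomorphism \<open>i'\<close>.\<close>

lemma ext_morphism_mono:
  assumes e: "(i, p) \<in> extensions C X Y" and e': "(i', p') \<in> extensions C X Y"
    and g: "g \<in> Arr C" "Dom C g = Cod C i" "Cod C g = Cod C i'" "g \<bullet> i = i'" "p' \<bullet> g = p"
  shows "monomorphism C g"
proof (rule monomorphismI)
  note D = extensionsD[OF e] and D' = extensionsD[OF e']
  fix t assume t: "t \<in> Arr C" "Cod C t = Dom C g" "g \<bullet> t = Zero C (Dom C t) (Cod C g)"
  have "p \<bullet> t = p' \<bullet> g \<bullet> t" using Comp_reduce[OF g(5), of t] g(1-3) t(1,2) D D' by simp
  then have "p \<bullet> t = Zero C (Dom C t) X" unfolding t(3) using g(1-3) t(1,2) D D' by simp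
  then obtain u where u: "u \<in> Arr C" "Dom C u = Dom C t" "Cod C u = Dom C i" "i \<bullet> u = t"
    using kernel_factor[OF D(11), of t] t(1,2) g D by metis
  have "i' \<bullet> u = g \<bullet> t" using Comp_reduce[OF g(4), of u] u g(1-3) D D' by simp
  then have uz: "u = Zero C (Dom C t) Y" using t u monomorphism_Zero[OF D'(9), of u] g D D' by simp
  have "i \<bullet> u = Zero C (Dom C t) (Cod C i)" unfolding uz using t(1) D by simp
  then show "t = Zero C (Dom C t) (Dom C g)" using u g by simp
qed (rule g)

text \<open>The other half of the short five lemma is the same lemma in \<open>opposite C\<close>,
  where the two extensions exchange their places.\<close>

lemma ext_morphism_isomorphism:
  assumes e: "(i, p) \<in> extensions C X Y" and e': "(i', p') \<in> extensions C X Y"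
    and g: "g \<in> Arr C" "Dom C g = Cod C i" "Cod C g = Cod C i'" "g \<bullet> i = i'" "p' \<bullet> g = p"
  shows "isomorphism C g"
proof (rule mono_epi_isomorphism)
  note D = extensionsD[OF e] and D' = extensionsD[OF e']
  show "monomorphism C g" by (rule ext_morphism_mono[OF assms])
  have "monomorphism (opposite C) g"
    by (rule abelian_category.ext_morphism_mono[OF abelian_category_opposite, of p' i' Y X p i])
      (use e e' g D D' in \<open>simp_all add: extensions_opposite\<close>)
  then show "epimorphism C g" by simp
qed

text \<open>By the short five lemma the middle map is automatically invertible, so equivalence is
  just an \<open>ext_mor\<close> with identities at both ends.\<close>

lemma ext_equiv_iff:
  "(e, e') \<in> ext_equiv C X Y \<longleftrightarrow>
     e \<in> extensions C X Y \<and> e' \<in> extensions C X Y \<and> ext_mor C (Ide C Y) (Ide C X) e e'"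
proof -
  obtain i p i' p' where e: "e = (i, p)" "e' = (i', p')" by (metis surj_pair)
  show ?thesis unfolding e
  proof (cases "(i, p) \<in> extensions C X Y \<and> (i', p') \<in> extensions C X Y")
    case True
    then have "(i, p) \<in> extensions C X Y" "(i', p') \<in> extensions C X Y" by auto
    note D = extensionsD[OF this(1)] and D' = extensionsD[OF this(2)]
      and iso = ext_morphism_isomorphism[OF this]
    show "((i, p), (i', p')) \<in> ext_equiv C X Y \<longleftrightarrow> (i, p) \<in> extensions C X Y \<and>
       (i', p') \<in> extensions C X Y \<and> ext_mor C (Ide C Y) (Ide C X) (i, p) (i', p')"
    proof
      assume "((i, p), (i', p')) \<in> ext_equiv C X Y"
      then show "(i, p) \<in> extensions C X Y \<and>
       (i', p') \<in> extensions C X Y \<and> ext_mor C (Ide C Y) (Ide C X) (i, p) (i', p')"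
        using True D D' unfolding ext_equiv_def ext_mor_def Hom_def by auto
    next
      assume "(i, p) \<in> extensions C X Y \<and>
       (i', p') \<in> extensions C X Y \<and> ext_mor C (Ide C Y) (Ide C X) (i, p) (i', p')"
      then obtain g where "g \<in> Arr C" "Dom C g = Cod C i" "Cod C g = Cod C i'" "g \<bullet> i = i'" "p' \<bullet> g = p"
        using D D' unfolding ext_mor_def by auto
      then show "((i, p), (i', p')) \<in> ext_equiv C X Y"
        using True iso[of g] unfolding ext_equiv_def Hom_def by auto
    qed
  next
    case False
    then show "((i, p), (i', p')) \<in> ext_equiv C X Y \<longleftrightarrow> (i, p) \<in> extensions C X Y \<and>
       (i', p') \<in> extensions C X Y \<and> ext_mor C (Ide C Y) (Ide C X) (i, p) (i', p')"
      unfolding ext_equiv_def by auto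
  qed
qed

lemma equiv_ext_equiv: "equiv (extensions C X Y) (ext_equiv C X Y)"
proof (rule equivI)
  show "ext_equiv C X Y \<subseteq> extensions C X Y \<times> extensions C X Y" by (auto simp: ext_equiv_iff)
  show "refl_on (extensions C X Y) (ext_equiv C X Y)"
  proof (rule refl_onI)
    fix e assume e: "e \<in> extensions C X Y"
    obtain i p where [simp]: "e = (i, p)" by (cases e)
    note D = extensionsD[OF e[unfolded \<open>e = (i, p)\<close>]]
    have "ext_mor C (Ide C Y) (Ide C X) e e"
      unfolding \<open>e = (i, p)\<close> by (rule ext_morI[of "Ide C (Cod C i)"]) (use D in auto)
    then show "(e, e) \<in> ext_equiv C X Y" using e by (simp only: ext_equiv_iff)
  qed
  show "sym (ext_equiv C X Y)"
  proof (rule symI)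
    fix e e' assume h: "(e, e') \<in> ext_equiv C X Y"
    obtain i p i' p' where e: "e = (i, p)" "e' = (i', p')" by (metis surj_pair)
    have ee: "(i, p) \<in> extensions C X Y" "(i', p') \<in> extensions C X Y" using h unfolding e ext_equiv_iff by auto
    note D = extensionsD[OF ee(1)] and D' = extensionsD[OF ee(2)]
    from h obtain g g' where g: "g \<in> Arr C" "Dom C g = Cod C i" "Cod C g = Cod C i'" "g \<bullet> i = i'" "p' \<bullet> g = p"
      and g': "g' \<in> Arr C" "Dom C g' = Cod C i'" "Cod C g' = Cod C i"
      "g' \<bullet> g = Ide C (Cod C i)" "g \<bullet> g' = Ide C (Cod C i')"
      unfolding e ext_equiv_def isomorphism_def Hom_def by auto
    have "ext_mor C (Ide C Y) (Ide C X) e' e" unfolding e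
    proof (rule ext_morI[of g'])
      show "g' \<bullet> i' = i \<bullet> Ide C Y" using Comp_reduce[OF g'(4), of i] g g' D D' by simp
      have "p \<bullet> g' = p' \<bullet> g \<bullet> g'" using Comp_reduce[OF g(5), of g'] g(1-3) g'(1-3) D D' by simp
      then show "p \<bullet> g' = Ide C X \<bullet> p'" unfolding g'(5) using D' by simp
    qed (use g' in auto)
    then show "(e', e) \<in> ext_equiv C X Y" using ee unfolding e ext_equiv_iff by simp
  qed
  show "trans (ext_equiv C X Y)"
  proof (rule transI)
    fix e1 e2 e3 assume h: "(e1, e2) \<in> ext_equiv C X Y" "(e2, e3) \<in> ext_equiv C X Y"
    then have e: "e1 \<in> extensions C X Y" "e2 \<in> extensions C X Y" "e3 \<in> extensions C X Y"
      unfolding ext_equiv_iff by auto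
    have o: "X \<in> Obj C" "Y \<in> Obj C" using e(1) extensionsD by (metis surj_pair)+
    have "ext_mor C (Ide C Y \<bullet> Ide C Y) (Ide C X \<bullet> Ide C X) e1 e3"
      by (rule ext_mor_comp[OF e]) (use h o Ide_Hom in \<open>auto simp: ext_equiv_iff\<close>)
    then show "(e1, e3) \<in> ext_equiv C X Y" using e o unfolding ext_equiv_iff by simp
  qed
qed

lemma ext_pullback:
  assumes e: "(i, p) \<in> extensions C X Y" and f: "f \<in> Arr C" "Cod C f = X"
  obtains i' p' g where "(i', p') \<in> extensions C (Dom C f) Y" "is_pullback C f p g p'" "g \<bullet> i' = i"
proof -
  note D = extensionsD[OF e]
  obtain g p' where pb: "is_pullback C f p g p'" and p': "epimorphism C p'"
    using epimorphism_pullback[OF f(1) D(10)] f D by metis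
  have A: "g \<in> Arr C" "p' \<in> Arr C" "Dom C g = Dom C p'" "Cod C p' = Dom C f" "Cod C g = Cod C i"
    "f \<bullet> p' = p \<bullet> g" using pb D unfolding is_pullback_def by auto
  have U: "\<exists>!u. u \<in> Hom C T (Dom C p') \<and> p' \<bullet> u = a \<and> g \<bullet> u = b"
    if "a \<in> Hom C T (Dom C f)" "b \<in> Hom C T (Dom C p)" "f \<bullet> a = p \<bullet> b" for T a b
    using pb that Hom_Obj[OF that(1)] unfolding is_pullback_def by blast
  \<comment> \<open>The pair (0, i) is compatible with \<open>f\<close> and \<open>p\<close>, so it
    induces the new kernel map \<open>i'\<close>.\<close>
  have "f \<bullet> Zero C Y (Dom C f) = p \<bullet> i" using f D by simp
  then have "\<exists>u. u \<in> Hom C Y (Dom C p') \<and> p' \<bullet> u = Zero C Y (Dom C f) \<and> g \<bullet> u = i"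
    using U[of "Zero C Y (Dom C f)" Y i] f D by (auto simp: Hom_def)
  then obtain i' where i': "i' \<in> Arr C" "Dom C i' = Y" "Cod C i' = Dom C p'"
    "p' \<bullet> i' = Zero C Y (Dom C f)" "g \<bullet> i' = i" unfolding Hom_def by auto
  have "is_kernel C p' i'"
  proof (rule is_kernelI)
    show "monomorphism C i'"
    proof (rule monomorphismI)
      fix t assume t: "t \<in> Arr C" "Cod C t = Dom C i'" "i' \<bullet> t = Zero C (Dom C t) (Cod C i')"
      have "i \<bullet> t = g \<bullet> i' \<bullet> t" using Comp_reduce[OF i'(5), of t] t(1,2) i'(1-3) A by simp
      also have "\<dots> = Zero C (Dom C t) (Cod C i)" unfolding t(3) using t i' A by simp
      finally show "t = Zero C (Dom C t) (Dom C i')" using monomorphism_Zero[OF D(9), of t] t i' D by simp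
    qed (rule i')
    fix t assume t: "t \<in> Arr C" "Cod C t = Dom C p'" "p' \<bullet> t = Zero C (Dom C t) (Cod C p')"
    have "p \<bullet> g \<bullet> t = f \<bullet> p' \<bullet> t" using Comp_reduce[OF A(6)[symmetric], of t] t(1,2) A(1-5) D f by simp
    also have "\<dots> = Zero C (Dom C t) X" unfolding t(3) using t A f D by simp
    finally obtain u where u: "u \<in> Arr C" "Dom C u = Dom C t" "Cod C u = Dom C i" "i \<bullet> u = g \<bullet> t"
      using kernel_factor[OF D(11), of "g \<bullet> t"] t A D by (metis Comp_sel)
    \<comment> \<open>\<open>i' \<bullet> u\<close> and \<open>t\<close> have the same two
      components, hence agree by uniqueness in the pullback.\<close>
    have "\<exists>!w. w \<in> Hom C (Dom C t) (Dom C p') \<and> p' \<bullet> w = p' \<bullet> t \<and> g \<bullet> w = g \<bullet> t"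
      using U[of "p' \<bullet> t" "Dom C t" "g \<bullet> t"] t A f D Comp_reduce[OF A(6), of t] by (simp add: Hom_def)
    moreover have "p' \<bullet> i' \<bullet> u = p' \<bullet> t" "g \<bullet> i' \<bullet> u = g \<bullet> t"
      using Comp_reduce[OF i'(4), of u] Comp_reduce[OF i'(5), of u] u t i' A D f by simp_all
    ultimately have "i' \<bullet> u = t" using t u i' D by (metis Comp_sel HomI)
    then show "\<exists>u. u \<in> Arr C \<and> Dom C u = Dom C t \<and> Cod C u = Dom C i' \<and> i' \<bullet> u = t" using u i' D by auto
  qed (use A i' in auto)
  then have "(i', p') \<in> extensions C (Dom C f) Y" using extensions_of_epimorphism[OF p'] A i' by metis
  then show ?thesis using that pb i' by blast
qed

text \<open>The universal property of the pullback at the level of extensions: a morphism over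
  \<open>f\<close> factors through the pulled back extension, now with an identity on the right
  end.\<close>

lemma ext_factor_pullback:
  assumes e': "(i', p') \<in> extensions C X' Y'" and e: "(i, p) \<in> extensions C X Y"
    and e2: "(i2, p2) \<in> extensions C X' Y" and pb: "is_pullback C f p g2 p2" "g2 \<bullet> i2 = i"
    and h: "h \<in> Hom C Y' Y"
    and g: "g \<in> Arr C" "Dom C g = Cod C i'" "Cod C g = Cod C i" "g \<bullet> i' = i \<bullet> h" "p \<bullet> g = f \<bullet> p'"
  obtains u where "u \<in> Arr C" "Dom C u = Cod C i'" "Cod C u = Cod C i2" "u \<bullet> i' = i2 \<bullet> h"
    "p2 \<bullet> u = p'" "g2 \<bullet> u = g"
proof -
  note D' = extensionsD[OF e'] and D = extensionsD[OF e] and D2 = extensionsD[OF e2]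
  have A: "f \<in> Arr C" "Dom C f = X'" "Cod C f = X" "g2 \<in> Arr C" "Dom C g2 = Cod C i2" "Cod C g2 = Cod C i"
    "f \<bullet> p2 = p \<bullet> g2" using pb D D2 unfolding is_pullback_def by auto
  have H: "h \<in> Arr C" "Dom C h = Y'" "Cod C h = Y" using h unfolding Hom_def by auto
  have U: "\<exists>!u. u \<in> Hom C T (Dom C p2) \<and> p2 \<bullet> u = a \<and> g2 \<bullet> u = b"
    if "a \<in> Hom C T (Dom C f)" "b \<in> Hom C T (Dom C p)" "f \<bullet> a = p \<bullet> b" for T a b
    using pb(1) that Hom_Obj[OF that(1)] unfolding is_pullback_def by blast
  have "\<exists>u. u \<in> Hom C (Cod C i') (Dom C p2) \<and> p2 \<bullet> u = p' \<and> g2 \<bullet> u = g"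
    using U[of p' "Cod C i'" g] g D' D A by (auto simp: Hom_def)
  then obtain u where u: "u \<in> Arr C" "Dom C u = Cod C i'" "Cod C u = Cod C i2" "p2 \<bullet> u = p'" "g2 \<bullet> u = g"
    using D2 by (auto simp: Hom_def)
  have "f \<bullet> Zero C Y' X' = p \<bullet> i \<bullet> h" using A D D' H Comp_reduce[OF D(6), of h] by simp
  then have "\<exists>!w. w \<in> Hom C Y' (Dom C p2) \<and> p2 \<bullet> w = Zero C Y' X' \<and> g2 \<bullet> w = i \<bullet> h"
    using A D D' H by (intro U) (auto simp: Hom_def)
  moreover have "p2 \<bullet> u \<bullet> i' = Zero C Y' X'" using Comp_reduce[OF u(4), of i'] u D' D2 by simp
  moreover have "g2 \<bullet> u \<bullet> i' = i \<bullet> h" using Comp_reduce[OF u(5), of i'] u D' D2 A g by simp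
  moreover have "p2 \<bullet> i2 \<bullet> h = Zero C Y' X'" using Comp_reduce[OF D2(6), of h] H D' D2 by simp
  moreover have "g2 \<bullet> i2 \<bullet> h = i \<bullet> h" using Comp_reduce[OF pb(2), of h] H D' D2 D A by simp
  moreover have "u \<bullet> i' \<in> Hom C Y' (Dom C p2)" "i2 \<bullet> h \<in> Hom C Y' (Dom C p2)"
    using u H D' D2 by (auto simp: Hom_def)
  ultimately have "u \<bullet> i' = i2 \<bullet> h" by blast
  then show ?thesis using that u by blast
qed

text \<open>Comparison with a pullback known to exist gives a map with identities on both ends,
  invertible by the short five lemma. So for extensions with the same kernel, commuting squares are
  automatically pullbacks.\<close>

lemma ext_morphism_is_pullback:
  assumes e': "(i', p') \<in> extensions C X' Y" and e: "(i, p) \<in> extensions C X Y" and f: "f \<in> Hom C X' X"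
    and g: "g \<in> Arr C" "Dom C g = Cod C i'" "Cod C g = Cod C i" "g \<bullet> i' = i" "p \<bullet> g = f \<bullet> p'"
  shows "is_pullback C f p g p'"
proof -
  note D' = extensionsD[OF e'] and D = extensionsD[OF e]
  have F: "f \<in> Arr C" "Dom C f = X'" "Cod C f = X" using f unfolding Hom_def by auto
  obtain i2 p2 g2 where e2: "(i2, p2) \<in> extensions C X' Y" and pb: "is_pullback C f p g2 p2" "g2 \<bullet> i2 = i"
    using ext_pullback[OF e F(1,3)] F(2) by metis
  note D2 = extensionsD[OF e2]
  have G2: "g2 \<in> Arr C" "Dom C g2 = Cod C i2" "Cod C g2 = Cod C i" "f \<bullet> p2 = p \<bullet> g2"
    using pb D D2 unfolding is_pullback_def by auto
  obtain u where u: "u \<in> Arr C" "Dom C u = Cod C i'" "Cod C u = Cod C i2" "u \<bullet> i' = i2 \<bullet> Ide C Y"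
    "p2 \<bullet> u = p'" "g2 \<bullet> u = g"
    by (rule ext_factor_pullback[OF e' e e2 pb, of "Ide C Y" g]) (use g D Ide_Hom in auto)
  have "isomorphism C u" using ext_morphism_isomorphism[OF e' e2, of u] u D2 by simp
  then obtain v where v: "v \<in> Arr C" "Dom C v = Cod C i2" "Cod C v = Cod C i'"
    "v \<bullet> u = Ide C (Cod C i')" "u \<bullet> v = Ide C (Cod C i2)"
    using u unfolding isomorphism_def Hom_def by auto
  show ?thesis
    unfolding is_pullback_def
  proof (intro conjI ballI impI)
    fix T a b assume T: "T \<in> Obj C" and ab: "a \<in> Hom C T (Dom C f)" "b \<in> Hom C T (Dom C p)" "f \<bullet> a = p \<bullet> b"
    have "\<exists>!u. u \<in> Hom C T (Dom C p2) \<and> p2 \<bullet> u = a \<and> g2 \<bullet> u = b"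
      using pb(1) T ab unfolding is_pullback_def by blast
    then obtain w where w: "w \<in> Hom C T (Dom C p2)" "p2 \<bullet> w = a" "g2 \<bullet> w = b"
      and wu: "\<And>w'. w' \<in> Hom C T (Dom C p2) \<Longrightarrow> p2 \<bullet> w' = a \<Longrightarrow> g2 \<bullet> w' = b \<Longrightarrow> w' = w" by blast
    have W: "w \<in> Arr C" "Dom C w = T" "Cod C w = Cod C i2" using w D2 by (auto simp: Hom_def)
    show "\<exists>!x. x \<in> Hom C T (Dom C p') \<and> p' \<bullet> x = a \<and> g \<bullet> x = b"
    proof (rule ex1I[of _ "v \<bullet> w"])
      have "p' \<bullet> v \<bullet> w = p2 \<bullet> u \<bullet> v \<bullet> w" "g \<bullet> v \<bullet> w = g2 \<bullet> u \<bullet> v \<bullet> w"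
        using Comp_reduce[OF u(5), of "v \<bullet> w"] Comp_reduce[OF u(6), of "v \<bullet> w"] u(1-3) v(1-3) W D2 G2 by simp_all
      moreover have "u \<bullet> v \<bullet> w = w" using Comp_reduce[OF v(5), of w] u(1-3) v(1-3) W by simp
      ultimately show "v \<bullet> w \<in> Hom C T (Dom C p') \<and> p' \<bullet> v \<bullet> w = a \<and> g \<bullet> v \<bullet> w = b"
        using w v W D' by (simp add: Hom_def)
      fix x assume x: "x \<in> Hom C T (Dom C p') \<and> p' \<bullet> x = a \<and> g \<bullet> x = b"
      then have X: "x \<in> Arr C" "Dom C x = T" "Cod C x = Cod C i'" using D' by (auto simp: Hom_def)
      have "p2 \<bullet> u \<bullet> x = a" "g2 \<bullet> u \<bullet> x = b"
        using Comp_reduce[OF u(5), of x] Comp_reduce[OF u(6), of x] u(1-3) X D2 G2 x by simp_all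
      then have "u \<bullet> x = w" using wu[of "u \<bullet> x"] u X D2 by (simp add: Hom_def)
      then show "x = v \<bullet> w" using Comp_reduce[OF v(4), of x] u v X by simp
    qed
  qed (use F g D D' in auto)
qed

subsection \<open>Functoriality of \<open>Ext\<^sup>1\<close>\<close>

abbreviation Ext where "Ext X Y \<equiv> carrier (Ext1 C X Y)"

definition ext_class where "ext_class X Y e = ext_equiv C X Y `` {e}"

lemma Ext_iff: "\<xi> \<in> Ext X Y \<longleftrightarrow> (\<exists>e\<in>extensions C X Y. \<xi> = ext_class X Y e)"
  unfolding Ext1_def ext_class_def quotient_def by auto

lemma ext_class_mem: "e \<in> extensions C X Y \<Longrightarrow> e \<in> ext_class X Y e"
  unfolding ext_class_def by (rule equiv_class_self[OF equiv_ext_equiv])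

lemma ext_class_in_Ext: "e \<in> extensions C X Y \<Longrightarrow> ext_class X Y e \<in> Ext X Y"
  unfolding Ext_iff by blast

lemma Ext_subset: "\<xi> \<in> Ext X Y \<Longrightarrow> \<xi> \<subseteq> extensions C X Y"
  unfolding Ext_iff ext_class_def using ext_equiv_iff by auto

lemma Ext_eq_class: "\<xi> \<in> Ext X Y \<Longrightarrow> e \<in> \<xi> \<Longrightarrow> \<xi> = ext_class X Y e"
  unfolding Ext_iff ext_class_def using equiv_class_eq[OF equiv_ext_equiv] by blast

lemma Ext_mem_iff:
  assumes "\<xi> \<in> Ext X Y" "e \<in> \<xi>"
  shows "e' \<in> \<xi> \<longleftrightarrow> e' \<in> extensions C X Y \<and> ext_mor C (Ide C Y) (Ide C X) e' e"
proof -
  have "e' \<in> \<xi> \<longleftrightarrow> (e', e) \<in> ext_equiv C X Y"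
    using Ext_eq_class[OF assms] equiv_ext_equiv[of X Y] unfolding ext_class_def equiv_def by (blast dest: symD)
  then show ?thesis using Ext_subset[OF assms(1)] assms(2) unfolding ext_equiv_iff by auto
qed

lemma Ext_nonempty: "\<xi> \<in> Ext X Y \<Longrightarrow> \<exists>e. e \<in> \<xi>"
  unfolding Ext_iff using ext_class_mem by blast

text \<open>Classes that meet coincide; equalities such as functoriality of the pullback are proved
  by exhibiting one common representative.\<close>

lemma Ext_eqI: "\<xi> \<in> Ext X Y \<Longrightarrow> \<zeta> \<in> Ext X Y \<Longrightarrow> e \<in> \<xi> \<Longrightarrow> e \<in> \<zeta> \<Longrightarrow> \<xi> = \<zeta>"
  using Ext_eq_class by metis

lemma Ext_Obj: "\<xi> \<in> Ext X Y \<Longrightarrow> X \<in> Obj C \<and> Y \<in> Obj C"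
  using Ext_nonempty Ext_subset extensionsD(7,8) by (metis subsetD surj_pair)

lemma ext_mor_cong:
  assumes "\<xi> \<in> Ext X Y" "\<xi>' \<in> Ext X' Y'" "e1 \<in> \<xi>" "e2 \<in> \<xi>" "e1' \<in> \<xi>'" "e2' \<in> \<xi>'"
    "h \<in> Hom C Y' Y" "f \<in> Hom C X' X" "ext_mor C h f e1' e1"
  shows "ext_mor C h f e2' e2"
proof -
  have e: "e1 \<in> extensions C X Y" "e2 \<in> extensions C X Y" "e1' \<in> extensions C X' Y'" "e2' \<in> extensions C X' Y'"
    using assms Ext_subset by blast+
  have ids: "Ide C X \<in> Hom C X X" "Ide C Y \<in> Hom C Y Y" "Ide C X' \<in> Hom C X' X'" "Ide C Y' \<in> Hom C Y' Y'"
    using assms(1,2) Ext_Obj Ide_Hom by auto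
  have "ext_mor C (Ide C Y') (Ide C X') e2' e1'" using Ext_mem_iff assms by blast
  from ext_mor_comp[OF e(4,3,1) ids(4,3) assms(7,8) this assms(9)]
  have "ext_mor C h f e2' e1" using assms(7,8) by (simp add: Comp_Ide)
  moreover have "ext_mor C (Ide C Y) (Ide C X) e1 e2" using Ext_mem_iff assms by blast
  ultimately have "ext_mor C (Ide C Y \<bullet> h) (Ide C X \<bullet> f) e2' e2"
    by (rule ext_mor_comp[OF e(4,1,2) assms(7,8) ids(2,1)])
  then show ?thesis using assms(7,8) by (simp add: Ide_Comp)
qed

text \<open>One representative of \<open>\<xi>\<close> suffices, and being a pullback reduces to the
  existence of a morphism of extensions; this makes pullbacks of classes accessible to composition
  arguments.\<close>

lemma ext_pull_mem_iff:
  assumes \<xi>: "\<xi> \<in> Ext X Y" and e: "e \<in> \<xi>" and f: "f \<in> Hom C X' X"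
  shows "e' \<in> ext_pull C f \<xi> \<longleftrightarrow> e' \<in> extensions C X' Y \<and> ext_mor C (Ide C Y) f e' e"
proof
  have F: "f \<in> Arr C" "Dom C f = X'" "Cod C f = X" using f unfolding Hom_def by auto
  obtain i' p' where e': "e' = (i', p')" by (cases e')
  {
    assume "e' \<in> ext_pull C f \<xi>"
    then obtain i1 p1 g where h: "(i1, p1) \<in> \<xi>" "(i', p') \<in> extensions C X' (Dom C i1)"
      "is_pullback C f p1 g p'" "g \<bullet> i' = i1" unfolding ext_pull_def e' using F by auto
    have e1: "(i1, p1) \<in> extensions C X Y" using h Ext_subset[OF \<xi>] by blast
    note D1 = extensionsD[OF e1]
    have e'X: "(i', p') \<in> extensions C X' Y" using h D1 by simp
    note D' = extensionsD[OF e'X]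
    have m: "ext_mor C (Ide C Y) f (i', p') (i1, p1)"
      using h D1 D' unfolding is_pullback_def by (intro ext_morI[of g]) auto
    have "ext_mor C (Ide C Y) f e' e" unfolding e'
      by (rule ext_mor_cong[OF \<xi> ext_class_in_Ext[OF e'X] h(1) e ext_class_mem[OF e'X] ext_class_mem[OF e'X] _ f m])
        (use D1 Ide_Hom in auto)
    then show "e' \<in> extensions C X' Y \<and> ext_mor C (Ide C Y) f e' e" using e'X e' by simp
  }
  assume a: "e' \<in> extensions C X' Y \<and> ext_mor C (Ide C Y) f e' e"
  obtain i p where ip: "e = (i, p)" by (cases e)
  have eX: "(i, p) \<in> extensions C X Y" using e ip Ext_subset[OF \<xi>] by blast
  have e'X: "(i', p') \<in> extensions C X' Y" using a e' by simp
  note D = extensionsD[OF eX] and D' = extensionsD[OF e'X]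
  obtain g where g: "g \<in> Arr C" "Dom C g = Cod C i'" "Cod C g = Cod C i" "g \<bullet> i' = i \<bullet> Ide C Y" "p \<bullet> g = f \<bullet> p'"
    using a unfolding e' ip by (auto elim: ext_morE)
  have "is_pullback C f p g p'" using g D by (intro ext_morphism_is_pullback[OF e'X eX f]) auto
  then show "e' \<in> ext_pull C f \<xi>" unfolding ext_pull_def using e e' ip e'X D g F by auto
qed

text \<open>The set of all pullbacks of all representatives is a single full equivalence class: one
  pullback is constructed, and its universal property compares every other one with it.\<close>

lemma ext_pull_closed:
  assumes \<xi>: "\<xi> \<in> Ext X Y" and f: "f \<in> Hom C X' X"
  shows "ext_pull C f \<xi> \<in> Ext X' Y"
proof -
  have F: "f \<in> Arr C" "Dom C f = X'" "Cod C f = X" using f unfolding Hom_def by auto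
  obtain i p where e: "(i, p) \<in> \<xi>" using Ext_nonempty[OF \<xi>] by auto
  have eX: "(i, p) \<in> extensions C X Y" using e Ext_subset[OF \<xi>] by blast
  note D = extensionsD[OF eX]
  obtain i2 p2 g2 where e2: "(i2, p2) \<in> extensions C X' Y" and pb: "is_pullback C f p g2 p2" "g2 \<bullet> i2 = i"
    using ext_pullback[OF eX F(1,3)] F(2) by metis
  note D2 = extensionsD[OF e2]
  have m: "ext_mor C (Ide C Y) f (i2, p2) (i, p)"
    using pb D D2 unfolding is_pullback_def by (intro ext_morI[of g2]) auto
  note e2c = ext_class_in_Ext[OF e2] and e2m = ext_class_mem[OF e2]
  have "e' \<in> ext_pull C f \<xi> \<longleftrightarrow> e' \<in> ext_class X' Y (i2, p2)" for e'
  proof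
    assume "e' \<in> ext_class X' Y (i2, p2)"
    then have "e' \<in> extensions C X' Y" "ext_mor C (Ide C Y) f e' (i, p)"
      using Ext_subset[OF e2c] ext_mor_cong[OF \<xi> e2c e e e2m _ _ f m] Ide_Hom[of Y] D by blast+
    then show "e' \<in> ext_pull C f \<xi>" using ext_pull_mem_iff[OF \<xi> e f] by blast
  next
    assume "e' \<in> ext_pull C f \<xi>"
    then have a: "e' \<in> extensions C X' Y" "ext_mor C (Ide C Y) f e' (i, p)"
      using ext_pull_mem_iff[OF \<xi> e f] by blast+
    obtain i' p' where e': "e' = (i', p')" by (cases e')
    obtain g where g: "g \<in> Arr C" "Dom C g = Cod C i'" "Cod C g = Cod C i" "g \<bullet> i' = i \<bullet> Ide C Y" "p \<bullet> g = f \<bullet> p'"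
      using a unfolding e' by (auto elim: ext_morE)
    note D' = extensionsD[OF a(1)[unfolded e']]
    obtain u where "u \<in> Arr C" "Dom C u = Cod C i'" "Cod C u = Cod C i2" "u \<bullet> i' = i2 \<bullet> Ide C Y"
      "p2 \<bullet> u = p'" "g2 \<bullet> u = g"
      by (rule ext_factor_pullback[OF a(1)[unfolded e'] eX e2 pb _ g]) (use D Ide_Hom in auto)
    then have "ext_mor C (Ide C Y) (Ide C X') e' (i2, p2)" unfolding e'
      using D' by (intro ext_morI[of u]) auto
    then show "e' \<in> ext_class X' Y (i2, p2)" using Ext_mem_iff[OF e2c e2m] a by blast
  qed
  then have "ext_pull C f \<xi> = ext_class X' Y (i2, p2)" by blast
  then show ?thesis using e2c by simp
qed

end

section \<open>Pushouts of extensions, by duality\<close>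

lemma mem_swap_image: "e \<in> prod.swap ` A \<longleftrightarrow> prod.swap e \<in> A"
  by (metis image_eqI imageE swap_swap)

lemma swap_image_swap_image: "prod.swap ` prod.swap ` A = A"
  by (simp add: image_image)

lemma extensions_opposite_iff: "e \<in> extensions (opposite C) Y X \<longleftrightarrow> prod.swap e \<in> extensions C X Y"
  using extensions_opposite[of "fst e" "snd e"] by (simp add: prod.swap_def)

text \<open>Reversing arrows turns the pair \<open>(i, p)\<close> into \<open>(p, i)\<close> and a
  pushout along \<open>h\<close> into a pullback, so facts on \<open>ext_push\<close> are facts on
  \<open>ext_pull\<close> in \<open>opposite C\<close>, up to swapping components.\<close>

lemma ext_push_opposite: "ext_push C h \<xi> = prod.swap ` ext_pull (opposite C) h (prod.swap ` \<xi>)"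
proof -
  have "(i', p') \<in> ext_push C h \<xi> \<longleftrightarrow> (p', i') \<in> ext_pull (opposite C) h (prod.swap ` \<xi>)" for i' p'
    unfolding ext_push_def ext_pull_def by (fastforce simp: extensions_opposite)
  then have "e \<in> ext_push C h \<xi> \<longleftrightarrow> prod.swap e \<in> ext_pull (opposite C) h (prod.swap ` \<xi>)" for e
    by (cases e) simp
  then show ?thesis unfolding set_eq_iff mem_swap_image by blast
qed

context abelian_category begin

lemma ext_mor_opposite_iff:
  assumes "e \<in> extensions C X Y" "e' \<in> extensions C X' Y'"
  shows "ext_mor (opposite C) f h (prod.swap e) (prod.swap e') \<longleftrightarrow> ext_mor C h f e' e"
  using assms ext_mor_opposite by (cases e; cases e') auto

lemma ext_equiv_opposite_iff:
  "(e, e') \<in> ext_equiv (opposite C) Y X \<longleftrightarrow> (prod.swap e', prod.swap e) \<in> ext_equiv C X Y"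
proof -
  have "(e, e') \<in> ext_equiv (opposite C) Y X \<longleftrightarrow> e \<in> extensions (opposite C) Y X \<and>
     e' \<in> extensions (opposite C) Y X \<and> ext_mor (opposite C) (Ide C X) (Ide C Y) e e'"
    using abelian_category.ext_equiv_iff[OF abelian_category_opposite] by simp
  then show ?thesis
    using ext_mor_opposite_iff[of "prod.swap e" X Y "prod.swap e'" X Y]
    unfolding ext_equiv_iff extensions_opposite_iff by auto
qed

lemma Ext_opposite:
  assumes "\<xi> \<in> Ext X Y"
  shows "prod.swap ` \<xi> \<in> carrier (Ext1 (opposite C) Y X)"
proof -
  obtain e where e: "e \<in> extensions C X Y" "\<xi> = ext_equiv C X Y `` {e}"
    using assms unfolding Ext_iff ext_class_def by blast
  have s: "(e, e') \<in> ext_equiv C X Y \<longleftrightarrow> (e', e) \<in> ext_equiv C X Y" for e'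
    using equiv_ext_equiv[of X Y] unfolding equiv_def by (blast dest: symD)
  have "e' \<in> prod.swap ` \<xi> \<longleftrightarrow> (prod.swap e, e') \<in> ext_equiv (opposite C) Y X" for e'
    unfolding ext_equiv_opposite_iff e(2) mem_swap_image by (simp add: s)
  then have "prod.swap ` \<xi> = ext_equiv (opposite C) Y X `` {prod.swap e}" by blast
  then show ?thesis using e unfolding Ext1_def quotient_def
    by (auto simp: extensions_opposite_iff intro!: bexI[of _ "prod.swap e"])
qed

lemma ext_push_mem_iff:
  assumes \<xi>: "\<xi> \<in> Ext X Y" and e: "e \<in> \<xi>" and h: "h \<in> Hom C Y Y'"
  shows "e' \<in> ext_push C h \<xi> \<longleftrightarrow> e' \<in> extensions C X Y' \<and> ext_mor C h (Ide C X) e e'"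
proof -
  have eX: "e \<in> extensions C X Y" using Ext_subset[OF \<xi>] e by blast
  have "e' \<in> ext_push C h \<xi> \<longleftrightarrow> prod.swap e' \<in> ext_pull (opposite C) h (prod.swap ` \<xi>)"
    unfolding ext_push_opposite mem_swap_image ..
  also have "\<dots> \<longleftrightarrow> prod.swap e' \<in> extensions (opposite C) Y' X \<and>
      ext_mor (opposite C) (Ide C X) h (prod.swap e') (prod.swap e)"
    using abelian_category.ext_pull_mem_iff[OF abelian_category_opposite Ext_opposite[OF \<xi>], of "prod.swap e" h Y']
      e h by simp
  also have "\<dots> \<longleftrightarrow> e' \<in> extensions C X Y' \<and> ext_mor C h (Ide C X) e e'"
    using ext_mor_opposite_iff[OF _ eX, of e' X Y'] by (auto simp: extensions_opposite_iff)
  finally show ?thesis .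
qed

lemma ext_push_closed:
  assumes \<xi>: "\<xi> \<in> Ext X Y" and h: "h \<in> Hom C Y Y'"
  shows "ext_push C h \<xi> \<in> Ext X Y'"
proof -
  have "ext_pull (opposite C) h (prod.swap ` \<xi>) \<in> carrier (Ext1 (opposite C) Y' X)"
    by (rule abelian_category.ext_pull_closed[OF abelian_category_opposite Ext_opposite[OF \<xi>]]) (use h in simp)
  from abelian_category.Ext_opposite[OF abelian_category_opposite this]
  show ?thesis unfolding ext_push_opposite by simp
qed

text \<open>A morphism with ends \<open>h\<close> and \<open>f\<close> factors into one with ends
  \<open>h\<close> and identity, followed by one with ends identity and \<open>f\<close>; the
  extension in between is a common representative of the pushout and the pullback. Identities in Ext
  can thus be read off from explicit morphisms.\<close>

lemma ext_mor_iff: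
  assumes \<xi>: "\<xi> \<in> Ext X Y" and \<xi>': "\<xi>' \<in> Ext X' Y'" and e: "e \<in> \<xi>" and e': "e' \<in> \<xi>'"
    and h: "h \<in> Hom C Y' Y" and f: "f \<in> Hom C X' X"
  shows "ext_mor C h f e' e \<longleftrightarrow> ext_push C h \<xi>' = ext_pull C f \<xi>"
proof
  have eX: "e \<in> extensions C X Y" and e'X: "e' \<in> extensions C X' Y'" using Ext_subset \<xi> \<xi>' e e' by blast+
  note cl = ext_push_closed[OF \<xi>' h] ext_pull_closed[OF \<xi> f]
  have O: "Ide C Y \<in> Hom C Y Y" "Ide C X' \<in> Hom C X' X'" using Ext_Obj[OF \<xi>] Ext_Obj[OF \<xi>'] Ide_Hom by auto
  {
    assume a: "ext_mor C h f e' e"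
    obtain e2 where e2: "e2 \<in> ext_pull C f \<xi>" using Ext_nonempty[OF cl(2)] by blast
    obtain i p i' p' i2 p2 where ip: "e = (i, p)" "e' = (i', p')" "e2 = (i2, p2)" by (metis surj_pair)
    have e2X: "(i2, p2) \<in> extensions C X' Y" "ext_mor C (Ide C Y) f (i2, p2) (i, p)"
      using e2 ext_pull_mem_iff[OF \<xi> e f] unfolding ip by auto
    note D = extensionsD[OF eX[unfolded ip]] and D' = extensionsD[OF e'X[unfolded ip]] and D2 = extensionsD[OF e2X(1)]
    obtain g2 where g2: "g2 \<in> Arr C" "Dom C g2 = Cod C i2" "Cod C g2 = Cod C i" "g2 \<bullet> i2 = i \<bullet> Ide C Y"
      "p \<bullet> g2 = f \<bullet> p2" using e2X(2) by (rule ext_morE)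
    have gi: "g2 \<bullet> i2 = i" using g2 D by simp
    have pb: "is_pullback C f p g2 p2"
      by (rule ext_morphism_is_pullback[OF e2X(1) eX[unfolded ip] f g2(1-3) gi g2(5)])
    obtain g where g: "g \<in> Arr C" "Dom C g = Cod C i'" "Cod C g = Cod C i" "g \<bullet> i' = i \<bullet> h"
      "p \<bullet> g = f \<bullet> p'" using a[unfolded ip] by (rule ext_morE)
    obtain u where "u \<in> Arr C" "Dom C u = Cod C i'" "Cod C u = Cod C i2" "u \<bullet> i' = i2 \<bullet> h"
      "p2 \<bullet> u = p'" "g2 \<bullet> u = g"
      by (rule ext_factor_pullback[OF e'X[unfolded ip] eX[unfolded ip] e2X(1) pb gi h g])
    then have "ext_mor C h (Ide C X') e' e2" unfolding ip using D' by (intro ext_morI[of u]) auto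
    then have "e2 \<in> ext_push C h \<xi>'" using ext_push_mem_iff[OF \<xi>' e' h] e2X ip by blast
    then show "ext_push C h \<xi>' = ext_pull C f \<xi>" using Ext_eqI[OF cl] e2 by blast
  }
  assume eq: "ext_push C h \<xi>' = ext_pull C f \<xi>"
  obtain e2 where e2: "e2 \<in> ext_pull C f \<xi>" using Ext_nonempty[OF cl(2)] by blast
  then have 1: "e2 \<in> extensions C X' Y" "ext_mor C (Ide C Y) f e2 e" using ext_pull_mem_iff[OF \<xi> e f] by auto
  have 2: "ext_mor C h (Ide C X') e' e2" using e2 ext_push_mem_iff[OF \<xi>' e' h] eq by auto
  have "ext_mor C (Ide C Y \<bullet> h) (f \<bullet> Ide C X') e' e"
    by (rule ext_mor_comp[OF e'X 1(1) eX h O(2,1) f 2 1(2)])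
  then show "ext_mor C h f e' e" using h f by (simp add: Ide_Comp Comp_Ide)
qed

lemma ext_pull_comp:
  assumes \<xi>: "\<xi> \<in> Ext X Y" and f: "f \<in> Hom C X' X" and g: "g \<in> Hom C X'' X'"
  shows "ext_pull C g (ext_pull C f \<xi>) = ext_pull C (f \<bullet> g) \<xi>"
proof -
  note 1 = ext_pull_closed[OF \<xi> f] note 2 = ext_pull_closed[OF 1 g]
  obtain e e1 e2 where e: "e \<in> \<xi>" "e1 \<in> ext_pull C f \<xi>" "e2 \<in> ext_pull C g (ext_pull C f \<xi>)"
    using Ext_nonempty \<xi> 1 2 by meson
  have I: "Ide C Y \<in> Hom C Y Y" using Ext_Obj[OF \<xi>] Ide_Hom by auto
  have eX: "e \<in> extensions C X Y" using Ext_subset[OF \<xi>] e by blast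
  have m1: "e1 \<in> extensions C X' Y" "ext_mor C (Ide C Y) f e1 e" using ext_pull_mem_iff[OF \<xi> e(1) f] e(2) by auto
  have m2: "e2 \<in> extensions C X'' Y" "ext_mor C (Ide C Y) g e2 e1" using ext_pull_mem_iff[OF 1 e(2) g] e(3) by auto
  have "ext_mor C (Ide C Y \<bullet> Ide C Y) (f \<bullet> g) e2 e"
    by (rule ext_mor_comp[OF m2(1) m1(1) eX I g I f m2(2) m1(2)])
  then have "e2 \<in> ext_pull C (f \<bullet> g) \<xi>"
    using ext_pull_mem_iff[OF \<xi> e(1) Comp_Hom[OF g f]] m2 I by (simp add: Comp_Ide)
  then show ?thesis using Ext_eqI[OF 2 ext_pull_closed[OF \<xi> Comp_Hom[OF g f]] e(3)] by blast
qed

lemma ext_pull_Ide: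
  assumes \<xi>: "\<xi> \<in> Ext X Y"
  shows "ext_pull C (Ide C X) \<xi> = \<xi>"
proof -
  have I: "Ide C X \<in> Hom C X X" using Ext_Obj[OF \<xi>] Ide_Hom by auto
  obtain e where e: "e \<in> \<xi>" using Ext_nonempty[OF \<xi>] by blast
  have "e \<in> ext_pull C (Ide C X) \<xi>" using ext_pull_mem_iff[OF \<xi> e I] Ext_mem_iff[OF \<xi> e] e by blast
  then show ?thesis using Ext_eqI[OF ext_pull_closed[OF \<xi> I] \<xi>] e by blast
qed

text \<open>The pullback morphism into \<open>\<xi>\<close> followed by the pushout morphism out of
  it has ends \<open>h\<close> and \<open>f\<close>; \<open>ext_mor_iff\<close> turns this composite
  into the exchange law.\<close>

lemma ext_push_pull:
  assumes \<xi>: "\<xi> \<in> Ext X Y" and f: "f \<in> Hom C X' X" and h: "h \<in> Hom C Y Y'"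
  shows "ext_push C h (ext_pull C f \<xi>) = ext_pull C f (ext_push C h \<xi>)"
proof -
  note 1 = ext_pull_closed[OF \<xi> f] note 2 = ext_push_closed[OF \<xi> h]
  obtain e e1 e2 where e: "e \<in> \<xi>" "e1 \<in> ext_pull C f \<xi>" "e2 \<in> ext_push C h \<xi>"
    using Ext_nonempty \<xi> 1 2 by meson
  have I: "Ide C Y \<in> Hom C Y Y" "Ide C X \<in> Hom C X X" using Ext_Obj[OF \<xi>] Ide_Hom by auto
  have eX: "e \<in> extensions C X Y" using Ext_subset[OF \<xi>] e by blast
  have m1: "e1 \<in> extensions C X' Y" "ext_mor C (Ide C Y) f e1 e" using ext_pull_mem_iff[OF \<xi> e(1) f] e(2) by auto
  have m2: "e2 \<in> extensions C X Y'" "ext_mor C h (Ide C X) e e2" using ext_push_mem_iff[OF \<xi> e(1) h] e(3) by auto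
  have "ext_mor C (h \<bullet> Ide C Y) (Ide C X \<bullet> f) e1 e2"
    by (rule ext_mor_comp[OF m1(1) eX m2(1) I(1) f h I(2) m1(2) m2(2)])
  then have "ext_mor C h f e1 e2" using h f by (simp add: Comp_Ide Ide_Comp)
  then show ?thesis using ext_mor_iff[OF 2 1 e(3,2) h f] by simp
qed

text \<open>Multiplication by \<open>r\<close> on all three terms is an endomorphism of the short
  exact sequence. Scalars, defined in \<open>Ext1\<close> on the kernel side, can thus be moved to
  the cokernel side and handled by pullbacks.\<close>

lemma ext_push_Scal:
  assumes \<xi>: "\<xi> \<in> Ext X Y" and r: "r \<in> carrier k"
  shows "ext_push C (Scal C r (Ide C Y)) \<xi> = ext_pull C (Scal C r (Ide C X)) \<xi>"
proof -
  obtain i p where e: "(i, p) \<in> \<xi>" using Ext_nonempty[OF \<xi>] by auto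
  have eX: "(i, p) \<in> extensions C X Y" using Ext_subset[OF \<xi>] e by blast
  note D = extensionsD[OF eX]
  have "ext_mor C (Scal C r (Ide C Y)) (Scal C r (Ide C X)) (i, p) (i, p)"
    by (rule ext_morI[of "Scal C r (Ide C (Cod C i))"]) (use D r in simp_all)
  then show ?thesis
    using ext_mor_iff[OF \<xi> \<xi> e e Scal_Hom[OF r Ide_Hom] Scal_Hom[OF r Ide_Hom]] D by simp
qed

subsection \<open>Direct sums and the Baer sum\<close>

lemma direct_sum_kernel:
  assumes X: "is_biproduct C X1 X2 XX jX1 jX2 qX1 qX2" and Y: "is_biproduct C Y1 Y2 YY jY1 jY2 qY1 qY2"
    and M: "is_biproduct C M1 M2 MM jM1 jM2 qM1 qM2"
    and e1: "(i1, p1) \<in> extensions C X1 Y1" "Cod C i1 = M1" and e2: "(i2, p2) \<in> extensions C X2 Y2" "Cod C i2 = M2"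
  shows "is_kernel C (jX1 \<bullet> p1 \<bullet> qM1 \<boxplus> jX2 \<bullet> p2 \<bullet> qM2) (jM1 \<bullet> i1 \<bullet> qY1 \<boxplus> jM2 \<bullet> i2 \<bullet> qY2)" (is "is_kernel C ?p ?i")
proof (rule is_kernelI)
  note X = is_biproductD[OF X] is_biproduct_reduce[OF X] and Y = is_biproductD[OF Y] is_biproduct_reduce[OF Y]
    and M = is_biproductD[OF M] is_biproduct_reduce[OF M]
  note D1 = extensionsD[OF e1(1)] e1(2) and D2 = extensionsD[OF e2(1)] e2(2)
  have s: "?p \<in> Arr C" "Dom C ?p = MM" "Cod C ?p = XX" "?i \<in> Arr C" "Dom C ?i = YY" "Cod C ?i = MM"
    using X(1-15) Y(1-15) M(1-15) D1 D2 by simp_all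
  show "?p \<in> Arr C" "Cod C ?i = Dom C ?p" using s by simp_all
  \<comment> \<open>Components of the two direct sums. They reduce exactness of the sum to exactness
    of the two summands.\<close>
  have q: "qM1 \<bullet> ?i = i1 \<bullet> qY1" "qM2 \<bullet> ?i = i2 \<bullet> qY2" "qX1 \<bullet> ?p = p1 \<bullet> qM1" "qX2 \<bullet> ?p = p2 \<bullet> qM2"
    "?i \<bullet> jY1 = jM1 \<bullet> i1" "?i \<bullet> jY2 = jM2 \<bullet> i2"
    using X(1-19) Y(1-19) M(1-19) X(21-) Y(21-) M(21-) D1 D2 by simp_all
  have "?p \<bullet> ?i = jX1 \<bullet> p1 \<bullet> (qM1 \<bullet> ?i) \<boxplus> jX2 \<bullet> p2 \<bullet> (qM2 \<bullet> ?i)"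
    using X(1-15) Y(1-15) M(1-15) D1 D2 s by (simp del: Comp_Plus_simp)
  also have "\<dots> = Zero C YY XX" unfolding q
    using X(1-15) Y(1-15) M(1-15) D1 D2 Comp_reduce[OF D1(6), of qY1] Comp_reduce[OF D2(6), of qY2] by simp
  finally show "?p \<bullet> ?i = Zero C (Dom C ?i) (Cod C ?p)" using s by simp
  show "monomorphism C ?i"
  proof (rule monomorphismI)
    fix t assume t: "t \<in> Arr C" "Cod C t = Dom C ?i" "?i \<bullet> t = Zero C (Dom C t) (Cod C ?i)"
    have c: "Cod C t = YY" "Dom C t \<in> Obj C" using t(1,2) s by simp_all
    have "i1 \<bullet> qY1 \<bullet> t = qM1 \<bullet> (?i \<bullet> t)" "i2 \<bullet> qY2 \<bullet> t = qM2 \<bullet> (?i \<bullet> t)"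
      using Comp_reduce[OF q(1), of t] Comp_reduce[OF q(2), of t] s M(1-15) t(1) c D1 D2 Y(1-15)
      by (simp_all del: Comp_Plus_simp Plus_Comp_simp)
    then have "i1 \<bullet> qY1 \<bullet> t = Zero C (Dom C t) M1" "i2 \<bullet> qY2 \<bullet> t = Zero C (Dom C t) M2"
      unfolding t(3) using s M(1-15) c by simp_all
    then have z: "qY1 \<bullet> t = Zero C (Dom C t) Y1" "qY2 \<bullet> t = Zero C (Dom C t) Y2"
      using monomorphism_Zero[OF D1(9), of "qY1 \<bullet> t"] monomorphism_Zero[OF D2(9), of "qY2 \<bullet> t"]
        t(1) c D1 D2 Y(1-15) by simp_all
    have "t = (jY1 \<bullet> qY1 \<boxplus> jY2 \<bullet> qY2) \<bullet> t" unfolding Y(20) using t(1) c by simp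
    also have "\<dots> = jY1 \<bullet> (qY1 \<bullet> t) \<boxplus> jY2 \<bullet> (qY2 \<bullet> t)" using Y(1-15) t(1) c by simp
    also have "\<dots> = Zero C (Dom C t) YY" unfolding z using Y(1-15) c by simp
    finally show "t = Zero C (Dom C t) (Dom C ?i)" using s by simp
  qed (rule s)
  fix t assume t: "t \<in> Arr C" "Cod C t = Dom C ?p" "?p \<bullet> t = Zero C (Dom C t) (Cod C ?p)"
  have c: "Cod C t = MM" "Dom C t \<in> Obj C" using t(1,2) s by simp_all
  have "p1 \<bullet> qM1 \<bullet> t = qX1 \<bullet> (?p \<bullet> t)" "p2 \<bullet> qM2 \<bullet> t = qX2 \<bullet> (?p \<bullet> t)"
    using Comp_reduce[OF q(3), of t] Comp_reduce[OF q(4), of t] s X(1-15) t(1) c D1 D2 M(1-15)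
    by (simp_all del: Comp_Plus_simp Plus_Comp_simp)
  then have "p1 \<bullet> qM1 \<bullet> t = Zero C (Dom C t) X1" "p2 \<bullet> qM2 \<bullet> t = Zero C (Dom C t) X2"
    unfolding t(3) using s X(1-15) c by simp_all
  then obtain u1 u2 where u: "u1 \<in> Arr C" "Dom C u1 = Dom C t" "Cod C u1 = Y1" "i1 \<bullet> u1 = qM1 \<bullet> t"
    "u2 \<in> Arr C" "Dom C u2 = Dom C t" "Cod C u2 = Y2" "i2 \<bullet> u2 = qM2 \<bullet> t"
    using kernel_factor[OF D1(11), of "qM1 \<bullet> t"] kernel_factor[OF D2(11), of "qM2 \<bullet> t"]
      t(1) c D1 D2 M(1-15) by (metis Comp_sel)
  let ?u = "jY1 \<bullet> u1 \<boxplus> jY2 \<bullet> u2"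
  have "?i \<bullet> ?u = (?i \<bullet> jY1) \<bullet> u1 \<boxplus> (?i \<bullet> jY2) \<bullet> u2"
    using s u(1-3,5-7) Y(1-15) by (simp del: Plus_Comp_simp)
  also have "\<dots> = jM1 \<bullet> (i1 \<bullet> u1) \<boxplus> jM2 \<bullet> (i2 \<bullet> u2)" unfolding q using u(1-3,5-7) M(1-15) D1 D2 by simp
  also have "\<dots> = (jM1 \<bullet> qM1 \<boxplus> jM2 \<bullet> qM2) \<bullet> t" unfolding u(4,8) using M(1-15) t(1) c by simp
  also have "\<dots> = t" unfolding M(20) using t(1) c by simp
  finally have "?i \<bullet> ?u = t" .
  then show "\<exists>u. u \<in> Arr C \<and> Dom C u = Dom C t \<and> Cod C u = Dom C ?i \<and> ?i \<bullet> u = t"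
    using u Y(1-15) s by (intro exI[of _ ?u]) simp
qed

lemma direct_sum_extension:
  assumes X: "is_biproduct C X1 X2 XX jX1 jX2 qX1 qX2" and Y: "is_biproduct C Y1 Y2 YY jY1 jY2 qY1 qY2"
    and M: "is_biproduct C M1 M2 MM jM1 jM2 qM1 qM2"
    and e1: "(i1, p1) \<in> extensions C X1 Y1" "Cod C i1 = M1" and e2: "(i2, p2) \<in> extensions C X2 Y2" "Cod C i2 = M2"
  shows "(jM1 \<bullet> i1 \<bullet> qY1 \<boxplus> jM2 \<bullet> i2 \<bullet> qY2, jX1 \<bullet> p1 \<bullet> qM1 \<boxplus> jX2 \<bullet> p2 \<bullet> qM2) \<in> extensions C XX YY"
    (is "(?i, ?p) \<in> _")
proof -
  note X' = is_biproductD[OF X] and Y' = is_biproductD[OF Y] and M' = is_biproductD[OF M]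
  note D1 = extensionsD[OF e1(1)] e1(2) and D2 = extensionsD[OF e2(1)] e2(2)
  have s: "Dom C ?i = YY" "Cod C ?p = XX" using X'(1-15) Y'(1-15) M'(1-15) D1 D2 by simp_all
  have "is_kernel C ?p ?i" by (rule direct_sum_kernel[OF assms])
  \<comment> \<open>Reversing arrows exchanges injections with projections and \<open>i\<close> with
    \<open>p\<close>, so the cokernel property is the kernel lemma in
    \<open>opposite C\<close>.\<close>
  moreover have "is_kernel (opposite C) ((qY1 \<bullet>\<^bsub>opposite C\<^esub> i1 \<bullet>\<^bsub>opposite C\<^esub> jM1) \<boxplus>\<^bsub>opposite C\<^esub> (qY2 \<bullet>\<^bsub>opposite C\<^esub> i2 \<bullet>\<^bsub>opposite C\<^esub> jM2))
     ((qM1 \<bullet>\<^bsub>opposite C\<^esub> p1 \<bullet>\<^bsub>opposite C\<^esub> jX1) \<boxplus>\<^bsub>opposite C\<^esub> (qM2 \<bullet>\<^bsub>opposite C\<^esub> p2 \<bullet>\<^bsub>opposite C\<^esub> jX2))"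
    by (rule abelian_category.direct_sum_kernel[OF abelian_category_opposite,
          of Y1 Y2 YY qY1 qY2 jY1 jY2 X1 X2 XX qX1 qX2 jX1 jX2 M1 M2 MM qM1 qM2 jM1 jM2])
      (use assms D1 D2 in \<open>simp_all add: extensions_opposite\<close>)
  then have "is_cokernel C ?i ?p" using X'(1-15) Y'(1-15) M'(1-15) D1 D2 by simp
  ultimately show ?thesis using s unfolding extensions_def by auto
qed

text \<open>\<open>baer_sum\<close> pulls back the direct sum as a single extension instead of its
  class; this lets the lemmas on classes be used there.\<close>

lemma ext_pull_singleton:
  assumes e: "e \<in> extensions C X Y" and f: "f \<in> Hom C X' X"
  shows "ext_pull C f {e} = ext_pull C f (ext_class X Y e)"
proof
  show "ext_pull C f {e} \<subseteq> ext_pull C f (ext_class X Y e)"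
    using ext_class_mem[OF e] unfolding ext_pull_def by blast
  have F: "f \<in> Arr C" "Dom C f = X'" "Cod C f = X" using f unfolding Hom_def by auto
  show "ext_pull C f (ext_class X Y e) \<subseteq> ext_pull C f {e}"
  proof
    fix e' assume "e' \<in> ext_pull C f (ext_class X Y e)"
    then have a: "e' \<in> extensions C X' Y" "ext_mor C (Ide C Y) f e' e"
      using ext_pull_mem_iff[OF ext_class_in_Ext[OF e] ext_class_mem[OF e] f] by blast+
    obtain i p i' p' where ip: "e = (i, p)" "e' = (i', p')" by (metis surj_pair)
    note D = extensionsD[OF e[unfolded ip]] and D' = extensionsD[OF a(1)[unfolded ip]]
    obtain g where g: "g \<in> Arr C" "Dom C g = Cod C i'" "Cod C g = Cod C i" "g \<bullet> i' = i \<bullet> Ide C Y" "p \<bullet> g = f \<bullet> p'"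
      using a unfolding ip by (auto elim: ext_morE)
    have "is_pullback C f p g p'"
      using g D by (intro ext_morphism_is_pullback[OF a(1)[unfolded ip] e[unfolded ip] f]) auto
    then show "e' \<in> ext_pull C f {e}" unfolding ext_pull_def using ip a D g F by auto
  qed
qed

text \<open>The direct sum of the two pulled back extensions maps to a representative of
  \<open>\<omega>\<close> with ends the codiagonal and the row (a, b); precomposition with the
  diagonal turns the right end into a + b, and \<open>ext_mor_iff\<close> gives the
  identity.\<close>

lemma baer_sum_ext_pull:
  assumes \<omega>: "\<omega> \<in> Ext W Y" and a: "a \<in> Hom C X W" and b: "b \<in> Hom C X W"
  shows "baer_sum C X Y (ext_pull C a \<omega>) (ext_pull C b \<omega>) = ext_pull C (a \<boxplus> b) \<omega>"
proof -
  have O: "X \<in> Obj C" "Y \<in> Obj C" using Ext_Obj[OF \<omega>] Hom_Obj[OF a] by auto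
  have A: "a \<in> Arr C" "Dom C a = X" "Cod C a = W" "b \<in> Arr C" "Dom C b = X" "Cod C b = W"
    using a b unfolding Hom_def by auto
  \<comment> \<open>Proved for all representatives and all biproducts, because
    \<open>baer_sum\<close> quantifies over them existentially: the union collapses to one
    class.\<close>
  have key: "ext_push C (qY1 \<boxplus> qY2) (ext_pull C (jX1 \<boxplus> jX2)
             {(jM1 \<bullet> i1 \<bullet> qY1 \<boxplus> jM2 \<bullet> i2 \<bullet> qY2, jX1 \<bullet> p1 \<bullet> qM1 \<boxplus> jX2 \<bullet> p2 \<bullet> qM2)})
      = ext_pull C (a \<boxplus> b) \<omega>"
    if e1: "(i1, p1) \<in> ext_pull C a \<omega>" and e2: "(i2, p2) \<in> ext_pull C b \<omega>"
      and X: "is_biproduct C X X XX jX1 jX2 qX1 qX2" and Y: "is_biproduct C Y Y YY jY1 jY2 qY1 qY2"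
      and M: "is_biproduct C (Cod C i1) (Cod C i2) MM jM1 jM2 qM1 qM2"
    for i1 p1 i2 p2 XX jX1 jX2 qX1 qX2 YY jY1 jY2 qY1 qY2 MM jM1 jM2 qM1 qM2
  proof -
    obtain i p where o: "(i, p) \<in> \<omega>" using Ext_nonempty[OF \<omega>] by auto
    have oX: "(i, p) \<in> extensions C W Y" using Ext_subset[OF \<omega>] o by blast
    have m1: "(i1, p1) \<in> extensions C X Y" "ext_mor C (Ide C Y) a (i1, p1) (i, p)"
      using e1 ext_pull_mem_iff[OF \<omega> o a] by auto
    have m2: "(i2, p2) \<in> extensions C X Y" "ext_mor C (Ide C Y) b (i2, p2) (i, p)"
      using e2 ext_pull_mem_iff[OF \<omega> o b] by auto
    note D = extensionsD[OF oX] and D1 = extensionsD[OF m1(1)] and D2 = extensionsD[OF m2(1)]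
    note X' = is_biproductD[OF X] is_biproduct_reduce[OF X] and Y' = is_biproductD[OF Y]
      and M' = is_biproductD[OF M] is_biproduct_reduce[OF M]
    let ?i = "jM1 \<bullet> i1 \<bullet> qY1 \<boxplus> jM2 \<bullet> i2 \<bullet> qY2" and ?p = "jX1 \<bullet> p1 \<bullet> qM1 \<boxplus> jX2 \<bullet> p2 \<bullet> qM2"
    have s: "(?i, ?p) \<in> extensions C XX YY" by (rule direct_sum_extension[OF X Y M m1(1) refl m2(1) refl])
    obtain g1 where g1: "g1 \<in> Arr C" "Dom C g1 = Cod C i1" "Cod C g1 = Cod C i" "g1 \<bullet> i1 = i \<bullet> Ide C Y"
      "p \<bullet> g1 = a \<bullet> p1" using m1(2) by (rule ext_morE)
    obtain g2 where g2: "g2 \<in> Arr C" "Dom C g2 = Cod C i2" "Cod C g2 = Cod C i" "g2 \<bullet> i2 = i \<bullet> Ide C Y"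
      "p \<bullet> g2 = b \<bullet> p2" using m2(2) by (rule ext_morE)
    \<comment> \<open>\<open>c\<close> is the row (a, b), \<open>n\<close> the codiagonal and
      \<open>d\<close> the diagonal, so that \<open>c \<bullet> d\<close> is a + b.\<close>
    define c where "c = a \<bullet> qX1 \<boxplus> b \<bullet> qX2"
    define n where "n = qY1 \<boxplus> qY2"
    define d where "d = jX1 \<boxplus> jX2"
    have cH: "c \<in> Hom C XX W" unfolding c_def Hom_def using X'(1-15) A by simp
    have nH: "n \<in> Hom C YY Y" unfolding n_def Hom_def using Y'(1-15) by simp
    have dH: "d \<in> Hom C X XX" unfolding d_def Hom_def using X'(1-15) by simp
    have cd: "c \<bullet> d = a \<boxplus> b" unfolding c_def d_def using X'(1-19) A by simp
    have mor: "ext_mor C n c (?i, ?p) (i, p)"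
    proof (rule ext_morI[of "g1 \<bullet> qM1 \<boxplus> g2 \<bullet> qM2"])
      let ?g = "g1 \<bullet> qM1 \<boxplus> g2 \<bullet> qM2"
      have "?g \<bullet> ?i = (g1 \<bullet> i1) \<bullet> qY1 \<boxplus> (g2 \<bullet> i2) \<bullet> qY2"
        using M'(1-15) M'(21-) g1(1-3) g2(1-3) Y'(1-15) D1 D2 D by simp
      then show "?g \<bullet> ?i = i \<bullet> n" unfolding g1(4) g2(4) n_def using Y'(1-15) D by simp
      have "p \<bullet> ?g = (p \<bullet> g1) \<bullet> qM1 \<boxplus> (p \<bullet> g2) \<bullet> qM2" using M'(1-15) g1(1-3) g2(1-3) D by simp
      then show "p \<bullet> ?g = c \<bullet> ?p" unfolding g1(5) g2(5) c_def
        using M'(1-15) X'(1-15) X'(21-) D1 D2 A by simp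
    qed (use M'(1-15) g1(1-3) g2(1-3) Y'(1-15) D1 D2 D in simp_all)
    note S = ext_class_in_Ext[OF s] and sS = ext_class_mem[OF s]
    note P = ext_pull_closed[OF S dH]
    obtain e' where e': "e' \<in> ext_pull C d (ext_class XX YY (?i, ?p))" using Ext_nonempty[OF P] by blast
    have e'X: "e' \<in> extensions C X YY" "ext_mor C (Ide C YY) d e' (?i, ?p)"
      using e' ext_pull_mem_iff[OF S sS dH] by auto
    have "ext_mor C (n \<bullet> Ide C YY) (c \<bullet> d) e' (i, p)"
      by (rule ext_mor_comp[OF e'X(1) s oX Ide_Hom dH nH cH e'X(2) mor]) (rule Y')
    then have "ext_mor C n (a \<boxplus> b) e' (i, p)" using nH cd by (simp add: Comp_Ide)
    then have "ext_push C n (ext_pull C d (ext_class XX YY (?i, ?p))) = ext_pull C (a \<boxplus> b) \<omega>"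
      using ext_mor_iff[OF \<omega> P o e' nH Plus_Hom[OF a b]] by blast
    then show ?thesis using ext_pull_singleton[OF s dH] unfolding n_def d_def by simp
  qed
  \<comment> \<open>At least one choice of representatives and biproducts has to exist, or the Baer
    sum would be empty.\<close>
  obtain i1 p1 i2 p2 where e: "(i1, p1) \<in> ext_pull C a \<omega>" "(i2, p2) \<in> ext_pull C b \<omega>"
    using Ext_nonempty ext_pull_closed[OF \<omega> a] ext_pull_closed[OF \<omega> b] by (metis surj_pair)
  have i: "Cod C i1 \<in> Obj C" "Cod C i2 \<in> Obj C"
    using e ext_pull_closed[OF \<omega> a] ext_pull_closed[OF \<omega> b] Ext_subset extensionsD(1) by (metis Cod_Obj subsetD)+
  obtain XX jX1 jX2 qX1 qX2 where X: "is_biproduct C X X XX jX1 jX2 qX1 qX2" using ex_biproduct O by metis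
  obtain YY jY1 jY2 qY1 qY2 where Y: "is_biproduct C Y Y YY jY1 jY2 qY1 qY2" using ex_biproduct O by metis
  obtain MM jM1 jM2 qM1 qM2 where M: "is_biproduct C (Cod C i1) (Cod C i2) MM jM1 jM2 qM1 qM2"
    using ex_biproduct i by metis
  show ?thesis
  proof
    show "baer_sum C X Y (ext_pull C a \<omega>) (ext_pull C b \<omega>) \<subseteq> ext_pull C (a \<boxplus> b) \<omega>"
    proof
      fix x assume "x \<in> baer_sum C X Y (ext_pull C a \<omega>) (ext_pull C b \<omega>)"
      then show "x \<in> ext_pull C (a \<boxplus> b) \<omega>"
        unfolding baer_sum_def by (elim CollectE bexE case_prodE exE conjE) (use key in blast)
    qed
    show "ext_pull C (a \<boxplus> b) \<omega> \<subseteq> baer_sum C X Y (ext_pull C a \<omega>) (ext_pull C b \<omega>)"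
    proof
      fix x assume x: "x \<in> ext_pull C (a \<boxplus> b) \<omega>"
      show "x \<in> baer_sum C X Y (ext_pull C a \<omega>) (ext_pull C b \<omega>)"
        unfolding baer_sum_def
        by (rule CollectI, rule bexI[OF _ e(1)], rule case_prodI, rule bexI[OF _ e(2)], rule case_prodI,
            intro exI conjI, rule X, rule Y, rule M) (use x key[OF e X Y M] in simp)
    qed
  qed
qed

text \<open>\<open>\<omega>\<close> is the pushout along the codiagonal of the direct sum of the two
  extensions; pulling it back along the injections of the biproduct recovers the summands.
  \<open>X1\<close> and \<open>X2\<close> may differ, so that a third class can be joined to an
  \<open>\<omega>\<close> already found.\<close>

lemma Ext_joint_pull:
  assumes \<xi>1: "\<xi>1 \<in> Ext X1 Y" and \<xi>2: "\<xi>2 \<in> Ext X2 Y"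
  obtains W a b \<omega> where "\<omega> \<in> Ext W Y" "a \<in> Hom C X1 W" "b \<in> Hom C X2 W"
    "\<xi>1 = ext_pull C a \<omega>" "\<xi>2 = ext_pull C b \<omega>"
proof -
  obtain i1 p1 i2 p2 where e: "(i1, p1) \<in> \<xi>1" "(i2, p2) \<in> \<xi>2"
    using Ext_nonempty \<xi>1 \<xi>2 by (metis surj_pair)
  have eX: "(i1, p1) \<in> extensions C X1 Y" "(i2, p2) \<in> extensions C X2 Y" using e Ext_subset \<xi>1 \<xi>2 by blast+
  note D1 = extensionsD[OF eX(1)] and D2 = extensionsD[OF eX(2)]
  obtain XX jX1 jX2 qX1 qX2 where X: "is_biproduct C X1 X2 XX jX1 jX2 qX1 qX2" using ex_biproduct D1 D2 by metis
  obtain YY jY1 jY2 qY1 qY2 where Y: "is_biproduct C Y Y YY jY1 jY2 qY1 qY2" using ex_biproduct D1 by metis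
  obtain MM jM1 jM2 qM1 qM2 where M: "is_biproduct C (Cod C i1) (Cod C i2) MM jM1 jM2 qM1 qM2"
    using ex_biproduct D1 D2 Cod_Obj by metis
  note X' = is_biproductD[OF X] and Y' = is_biproductD[OF Y] and M' = is_biproductD[OF M]
  let ?i = "jM1 \<bullet> i1 \<bullet> qY1 \<boxplus> jM2 \<bullet> i2 \<bullet> qY2" and ?p = "jX1 \<bullet> p1 \<bullet> qM1 \<boxplus> jX2 \<bullet> p2 \<bullet> qM2"
  have s: "(?i, ?p) \<in> extensions C XX YY" by (rule direct_sum_extension[OF X Y M eX(1) refl eX(2) refl])
  note S = ext_class_in_Ext[OF s] and sS = ext_class_mem[OF s]
  have n: "qY1 \<boxplus> qY2 \<in> Hom C YY Y" unfolding Hom_def using Y' by simp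
  have j: "jX1 \<in> Hom C X1 XX" "jX2 \<in> Hom C X2 XX" "jY1 \<in> Hom C Y YY" "jY2 \<in> Hom C Y YY"
    unfolding Hom_def using X' Y' by simp_all
  define \<omega> where "\<omega> = ext_push C (qY1 \<boxplus> qY2) (ext_class XX YY (?i, ?p))"
  have \<omega>: "\<omega> \<in> Ext XX Y" unfolding \<omega>_def by (rule ext_push_closed[OF S n])
  obtain v where v: "v \<in> \<omega>" using Ext_nonempty[OF \<omega>] by blast
  have vX: "v \<in> extensions C XX Y" "ext_mor C (qY1 \<boxplus> qY2) (Ide C XX) (?i, ?p) v"
    using v ext_push_mem_iff[OF S sS n] unfolding \<omega>_def by auto
  \<comment> \<open>Each summand sits in the direct sum through the injections, and the codiagonal
    composed with an injection of \<open>Y\<close> is the identity.\<close>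
  have "ext_mor C jY1 jX1 (i1, p1) (?i, ?p)"
    by (rule ext_morI[of jM1]) (use X' Y' M' D1 D2 in simp_all)
  from ext_mor_comp[OF eX(1) s vX(1) j(3,1) n Ide_Hom[OF X'(3)] this vX(2)]
  have "ext_mor C (Ide C Y) jX1 (i1, p1) v" using X' Y' by simp
  then have "(i1, p1) \<in> ext_pull C jX1 \<omega>" using ext_pull_mem_iff[OF \<omega> v j(1)] eX by blast
  then have 1: "\<xi>1 = ext_pull C jX1 \<omega>" using Ext_eqI[OF \<xi>1 ext_pull_closed[OF \<omega> j(1)]] e by blast
  have "ext_mor C jY2 jX2 (i2, p2) (?i, ?p)"
    by (rule ext_morI[of jM2]) (use X' Y' M' D1 D2 in simp_all)
  from ext_mor_comp[OF eX(2) s vX(1) j(4,2) n Ide_Hom[OF X'(3)] this vX(2)]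
  have "ext_mor C (Ide C Y) jX2 (i2, p2) v" using X' Y' by simp
  then have "(i2, p2) \<in> ext_pull C jX2 \<omega>" using ext_pull_mem_iff[OF \<omega> v j(2)] eX by blast
  then have 2: "\<xi>2 = ext_pull C jX2 \<omega>" using Ext_eqI[OF \<xi>2 ext_pull_closed[OF \<omega> j(2)]] e by blast
  show ?thesis using that[OF \<omega> j(1,2) 1 2] .
qed

subsection \<open>Split extensions\<close>

text \<open>The map id - s p is killed by \<open>p\<close>, hence equals i r for some
  \<open>r\<close>; cancelling \<open>i\<close> in i r i = i gives the retraction.\<close>

lemma split_retraction:
  assumes e: "(i, p) \<in> extensions C X Y" and s: "s \<in> Hom C X (Dom C p)" "p \<bullet> s = Ide C X"
  obtains r where "r \<in> Hom C (Cod C i) Y" "r \<bullet> i = Ide C Y"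
proof -
  note D = extensionsD[OF e]
  have S: "s \<in> Arr C" "Dom C s = X" "Cod C s = Cod C i" using s D unfolding Hom_def by auto
  define q where "q = Ide C (Cod C i) \<boxplus> neg (s \<bullet> p)"
  have q: "q \<in> Arr C" "Dom C q = Cod C i" "Cod C q = Cod C i" unfolding q_def using S D by simp_all
  have "p \<bullet> q = p \<boxplus> neg (p \<bullet> s \<bullet> p)" unfolding q_def using S D by simp
  also have "p \<bullet> s \<bullet> p = p" using Comp_reduce[OF s(2), of p] S D by simp
  finally have "p \<bullet> q = Zero C (Cod C i) X" using D by simp
  then obtain r where r: "r \<in> Arr C" "Dom C r = Cod C i" "Cod C r = Y" "i \<bullet> r = q"
    using kernel_factor[OF D(11), of q] q D by metis
  have "i \<bullet> r \<bullet> i = q \<bullet> i" using Comp_reduce[OF r(4), of i] r D by simp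
  also have "\<dots> = i" unfolding q_def using S D by simp
  finally have "i \<bullet> r \<bullet> i = i \<bullet> Ide C Y" using D by simp
  then have "r \<bullet> i = Ide C Y" using r(1-3) D by - (rule monomorphism_cancel[OF D(9)], auto)
  then show ?thesis using that r unfolding Hom_def by blast
qed

lemma retraction_split:
  assumes e: "(i, p) \<in> extensions C X Y" and r: "r \<in> Hom C (Cod C i) Y" "r \<bullet> i = Ide C Y"
  obtains s where "s \<in> Hom C X (Dom C p)" "p \<bullet> s = Ide C X"
  by (rule abelian_category.split_retraction[OF abelian_category_opposite, of p i Y X r])
    (use assms in \<open>simp_all add: extensions_opposite\<close>)

lemma split_extensionsE:
  assumes "e \<in> split_extensions C X Y"
  obtains i p s where "e = (i, p)" "(i, p) \<in> extensions C X Y" "s \<in> Hom C X (Dom C p)" "p \<bullet> s = Ide C X"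
  using assms unfolding split_extensions_def by auto

lemma split_extensions_opposite:
  "split_extensions (opposite C) Y X = prod.swap ` split_extensions C X Y"
proof -
  have "(p, i) \<in> split_extensions (opposite C) Y X \<longleftrightarrow> (i, p) \<in> split_extensions C X Y" for i p
    unfolding split_extensions_def
    by (auto simp: extensions_opposite elim: split_retraction retraction_split)
  then have "e \<in> split_extensions (opposite C) Y X \<longleftrightarrow> prod.swap e \<in> split_extensions C X Y" for e
    by (cases e) simp
  then show ?thesis unfolding set_eq_iff mem_swap_image by blast
qed

text \<open>The equality with the whole set of split extensions, rather than an inclusion, is what
  allows that set to serve as the zero of \<open>Ext1\<close>.\<close>

lemma ext_pull_split:
  assumes \<xi>: "\<xi> \<in> Ext X Y" and e: "(i, p) \<in> \<xi>" and t: "t \<in> Hom C T (Dom C p)"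
  shows "ext_pull C (p \<bullet> t) \<xi> = split_extensions C T Y"
proof -
  have eX: "(i, p) \<in> extensions C X Y" using Ext_subset[OF \<xi>] e by blast
  note D = extensionsD[OF eX]
  have A: "t \<in> Arr C" "Dom C t = T" "Cod C t = Cod C i" using t D unfolding Hom_def by auto
  have pt: "p \<bullet> t \<in> Hom C T X" using A D unfolding Hom_def by simp
  have "e' \<in> ext_pull C (p \<bullet> t) \<xi> \<longleftrightarrow> e' \<in> split_extensions C T Y" for e'
  proof
    obtain i' p' where e': "e' = (i', p')" by (cases e')
    {
      assume "e' \<in> ext_pull C (p \<bullet> t) \<xi>"
      then have a: "(i', p') \<in> extensions C T Y" "ext_mor C (Ide C Y) (p \<bullet> t) (i', p') (i, p)"
        using ext_pull_mem_iff[OF \<xi> e pt] e' by auto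
      note D' = extensionsD[OF a(1)]
      obtain g where g: "g \<in> Arr C" "Dom C g = Cod C i'" "Cod C g = Cod C i" "g \<bullet> i' = i \<bullet> Ide C Y"
        "p \<bullet> g = (p \<bullet> t) \<bullet> p'" using a(2) by (rule ext_morE)
      \<comment> \<open>\<open>g\<close> and t p' agree after composition with \<open>p\<close>;
        their difference factors through \<open>i\<close> and yields a retraction of
        \<open>i'\<close>.\<close>
      define q where "q = g \<boxplus> neg (t \<bullet> p')"
      have q: "q \<in> Arr C" "Dom C q = Cod C i'" "Cod C q = Cod C i" unfolding q_def using A D D' g(1-3) by simp_all
      have "p \<bullet> q = Zero C (Cod C i') X" unfolding q_def using A D D' g by simp
      then obtain r where r: "r \<in> Arr C" "Dom C r = Cod C i'" "Cod C r = Y" "i \<bullet> r = q"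
        using kernel_factor[OF D(11), of q] q D by metis
      have "i \<bullet> r \<bullet> i' = q \<bullet> i'" using Comp_reduce[OF r(4), of i'] r D D' by simp
      also have "\<dots> = i \<bullet> Ide C Y" unfolding q_def using A D D' g by simp
      finally have "r \<bullet> i' = Ide C Y" using r(1-3) D D' by - (rule monomorphism_cancel[OF D(9)], auto)
      then obtain s where "s \<in> Hom C T (Dom C p')" "p' \<bullet> s = Ide C T"
        using retraction_split[OF a(1), of r] r unfolding Hom_def by blast
      then show "e' \<in> split_extensions C T Y" unfolding split_extensions_def e' using a by auto
    }
    assume "e' \<in> split_extensions C T Y"
    then obtain s where a: "(i', p') \<in> extensions C T Y" "s \<in> Hom C T (Dom C p')" "p' \<bullet> s = Ide C T"
      unfolding e' by (auto elim: split_extensionsE)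
    note D' = extensionsD[OF a(1)]
    obtain r where r: "r \<in> Hom C (Cod C i') Y" "r \<bullet> i' = Ide C Y" by (rule split_retraction[OF a])
    have R: "r \<in> Arr C" "Dom C r = Cod C i'" "Cod C r = Y" using r unfolding Hom_def by auto
    have "ext_mor C (Ide C Y) (p \<bullet> t) (i', p') (i, p)"
    \<comment> \<open>\<open>r\<close> restores the identity on \<open>Y\<close>, while t p' lies
      over p t; the mixed terms vanish by exactness.\<close>
    proof (rule ext_morI[of "i \<bullet> r \<boxplus> t \<bullet> p'"])
      show "(i \<bullet> r \<boxplus> t \<bullet> p') \<bullet> i' = i \<bullet> Ide C Y" using A R r(2) D D' by simp
      show "p \<bullet> (i \<bullet> r \<boxplus> t \<bullet> p') = (p \<bullet> t) \<bullet> p'" using A R D D' Comp_reduce[OF D(6), of r] by simp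
    qed (use A R D D' in simp_all)
    then show "e' \<in> ext_pull C (p \<bullet> t) \<xi>" using ext_pull_mem_iff[OF \<xi> e pt] a(1) e' by blast
  qed
  then show ?thesis by blast
qed

lemma ext_pull_Zero:
  assumes \<xi>: "\<xi> \<in> Ext X Y" and T: "T \<in> Obj C"
  shows "ext_pull C (Zero C T X) \<xi> = split_extensions C T Y"
proof -
  obtain i p where e: "(i, p) \<in> \<xi>" using Ext_nonempty[OF \<xi>] by auto
  have eX: "(i, p) \<in> extensions C X Y" using Ext_subset[OF \<xi>] e by blast
  note D = extensionsD[OF eX]
  have "p \<bullet> Zero C T (Dom C p) = Zero C T X" using D T by simp
  then show ?thesis using ext_pull_split[OF \<xi> e, of "Zero C T (Dom C p)" T] T D Zero_Hom[of T "Dom C p"] by simp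
qed

text \<open>Extensions of a zero object by \<open>Y\<close> exist trivially; pulling one back along
  the zero map exhibits the split extensions as a class.\<close>

lemma split_extensions_in_Ext:
  assumes "X \<in> Obj C" "Y \<in> Obj C"
  shows "split_extensions C X Y \<in> Ext X Y"
proof -
  obtain Z where Z: "zero_object C Z" using ex_zero_object by blast
  have ZO: "Z \<in> Obj C" using Z unfolding zero_object_def by simp
  have uniq: "f = g" if "f \<in> Hom C Z W" "g \<in> Hom C Z W" for f g W
    using that Z Hom_Obj[OF that(1)] unfolding zero_object_def by blast
  have mono: "monomorphism C (Ide C Y)"
    unfolding monomorphism_def using assms by (auto simp: Hom_def)
  have "is_kernel C (Zero C Y Z) (Ide C Y)"
    by (rule is_kernelI[OF _ _ _ mono]) (use assms ZO in auto)
  moreover have "epimorphism C (Zero C Y Z)"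
    unfolding epimorphism_def using assms ZO uniq by auto
  ultimately have "(Ide C Y, Zero C Y Z) \<in> extensions C Z Y"
    using extensions_of_epimorphism[of "Zero C Y Z" "Ide C Y"] assms ZO by simp
  from ext_class_in_Ext[OF this] show ?thesis
    using ext_pull_Zero[OF _ assms(1)] ext_pull_closed Zero_Hom[OF assms(1) ZO] by metis
qed

text \<open>A section of the pulled back extension, followed by the map to the middle term of
  \<open>(i, p)\<close>, is a lift of \<open>t\<close>.\<close>

lemma ext_pull_split_iff:
  assumes \<xi>: "\<xi> \<in> Ext X Y" and e: "(i, p) \<in> \<xi>" and t: "t \<in> Hom C T X"
  shows "ext_pull C t \<xi> = split_extensions C T Y \<longleftrightarrow> (\<exists>t'\<in>Hom C T (Dom C p). p \<bullet> t' = t)"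
proof
  have eX: "(i, p) \<in> extensions C X Y" using Ext_subset[OF \<xi>] e by blast
  note D = extensionsD[OF eX]
  assume "ext_pull C t \<xi> = split_extensions C T Y"
  then obtain e' where e': "e' \<in> ext_pull C t \<xi>" "e' \<in> split_extensions C T Y"
    using Ext_nonempty[OF ext_pull_closed[OF \<xi> t]] by blast
  then obtain i' p' s where a: "e' = (i', p')" "(i', p') \<in> extensions C T Y" "s \<in> Hom C T (Dom C p')" "p' \<bullet> s = Ide C T"
    by (auto elim: split_extensionsE)
  note D' = extensionsD[OF a(2)]
  have "ext_mor C (Ide C Y) t (i', p') (i, p)" using e'(1) ext_pull_mem_iff[OF \<xi> e t] a by blast
  then obtain g where g: "g \<in> Arr C" "Dom C g = Cod C i'" "Cod C g = Cod C i" "p \<bullet> g = t \<bullet> p'" by (auto elim: ext_morE)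
  have S: "s \<in> Arr C" "Dom C s = T" "Cod C s = Cod C i'" using a D' unfolding Hom_def by auto
  have tA: "t \<in> Arr C" "Dom C t = T" "Cod C t = X" using t unfolding Hom_def by auto
  have "p \<bullet> g \<bullet> s = t" using Comp_reduce[OF g(4), of s] g(1-3) S a(4) D D' tA by simp
  then show "\<exists>t'\<in>Hom C T (Dom C p). p \<bullet> t' = t"
    using g(1-3) S D by (intro bexI[of _ "g \<bullet> s"]) (auto simp: Hom_def)
next
  assume "\<exists>t'\<in>Hom C T (Dom C p). p \<bullet> t' = t"
  then show "ext_pull C t \<xi> = split_extensions C T Y" using ext_pull_split[OF \<xi> e] by blast
qed

lemma ext_push_split_iff:
  assumes \<xi>: "\<xi> \<in> Ext X Y" and e: "(i, p) \<in> \<xi>" and t: "t \<in> Hom C Y T"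
  shows "ext_push C t \<xi> = split_extensions C X T \<longleftrightarrow> (\<exists>t'\<in>Hom C (Cod C i) T. t' \<bullet> i = t)"
proof -
  have "ext_push C t \<xi> = split_extensions C X T \<longleftrightarrow>
      ext_pull (opposite C) t (prod.swap ` \<xi>) = split_extensions (opposite C) T X"
    unfolding ext_push_opposite split_extensions_opposite 
    by (metis swap_image_swap_image)
  also have "\<dots> \<longleftrightarrow> (\<exists>t'\<in>Hom C (Cod C i) T. t' \<bullet> i = t)"
    using abelian_category.ext_pull_split_iff[OF abelian_category_opposite Ext_opposite[OF \<xi>], of p i t T] e t
    by force
  finally show ?thesis .
qed

subsection \<open>The module \<open>Ext\<^sup>1\<close>\<close>

lemma Ext1_sel [simp]:
  "\<zero>\<^bsub>Ext1 C X Y\<^esub> = split_extensions C X Y" "add (Ext1 C X Y) = baer_sum C X Y"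
  "smult (Ext1 C X Y) = (\<lambda>r. ext_push C (Scal C r (Ide C Y)))"
  unfolding Ext1_def by simp_all

lemma ext_pull_smult:
  assumes \<omega>: "\<omega> \<in> Ext W Y" and a: "a \<in> Hom C X W" and r: "r \<in> carrier k"
  shows "ext_push C (Scal C r (Ide C Y)) (ext_pull C a \<omega>) = ext_pull C (Scal C r a) \<omega>"
proof -
  have O: "W \<in> Obj C" "Y \<in> Obj C" using Ext_Obj[OF \<omega>] by auto
  note IY = Scal_Hom[OF r Ide_Hom[OF O(2)]] and IW = Scal_Hom[OF r Ide_Hom[OF O(1)]]
  have "Scal C r (Ide C W) \<bullet> a = Scal C r a" using a r O by (simp add: Hom_def)
  then show ?thesis using ext_push_pull[OF \<omega> a IY] ext_push_Scal[OF \<omega> r] ext_pull_comp[OF \<omega> IW a] by simp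
qed

theorem module_Ext1:
  assumes "X \<in> Obj C" "Y \<in> Obj C"
  shows "module k (Ext1 C X Y)"
proof (rule moduleI)
  show "cring k" by (rule K.is_cring)
  show "abelian_group (Ext1 C X Y)"
  proof (rule abelian_groupI)
    fix \<xi> \<zeta> assume xz: "\<xi> \<in> Ext X Y" "\<zeta> \<in> Ext X Y"
    then obtain W a b \<omega> where h: "\<omega> \<in> Ext W Y" "a \<in> Hom C X W" "b \<in> Hom C X W"
      "\<xi> = ext_pull C a \<omega>" "\<zeta> = ext_pull C b \<omega>" by (rule Ext_joint_pull)
    show "\<xi> \<oplus>\<^bsub>Ext1 C X Y\<^esub> \<zeta> \<in> Ext X Y"
      using baer_sum_ext_pull[OF h(1-3)] ext_pull_closed[OF h(1) Plus_Hom[OF h(2,3)]] h(4,5) by simp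
    show "\<xi> \<oplus>\<^bsub>Ext1 C X Y\<^esub> \<zeta> = \<zeta> \<oplus>\<^bsub>Ext1 C X Y\<^esub> \<xi>"
      using baer_sum_ext_pull[OF h(1-3)] baer_sum_ext_pull[OF h(1,3,2)] Plus_commute[OF h(2,3)] h(4,5) by simp
  next
    show "\<zero>\<^bsub>Ext1 C X Y\<^esub> \<in> Ext X Y" using split_extensions_in_Ext[OF assms] by simp
  next
    fix \<xi>1 \<xi>2 \<xi>3 assume xz: "\<xi>1 \<in> Ext X Y" "\<xi>2 \<in> Ext X Y" "\<xi>3 \<in> Ext X Y"
    obtain W a b \<omega> where h: "\<omega> \<in> Ext W Y" "a \<in> Hom C X W" "b \<in> Hom C X W"
      "\<xi>1 = ext_pull C a \<omega>" "\<xi>2 = ext_pull C b \<omega>" by (rule Ext_joint_pull[OF xz(1,2)])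
    \<comment> \<open>Three classes need a common source: the class \<open>\<omega>\<close> joining
      the first two is itself joined with the third.\<close>
    obtain V j c \<nu> where h': "\<nu> \<in> Ext V Y" "j \<in> Hom C W V" "c \<in> Hom C X V"
      "\<omega> = ext_pull C j \<nu>" "\<xi>3 = ext_pull C c \<nu>" by (rule Ext_joint_pull[OF h(1) xz(3)])
    note ja = Comp_Hom[OF h(2) h'(2)] and jb = Comp_Hom[OF h(3) h'(2)]
    have x: "\<xi>1 = ext_pull C (j \<bullet> a) \<nu>" "\<xi>2 = ext_pull C (j \<bullet> b) \<nu>" "\<xi>3 = ext_pull C c \<nu>"
      using h h' ext_pull_comp[OF h'(1,2)] by auto
    show "\<xi>1 \<oplus>\<^bsub>Ext1 C X Y\<^esub> \<xi>2 \<oplus>\<^bsub>Ext1 C X Y\<^esub> \<xi>3 = \<xi>1 \<oplus>\<^bsub>Ext1 C X Y\<^esub> (\<xi>2 \<oplus>\<^bsub>Ext1 C X Y\<^esub> \<xi>3)"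
      unfolding x using ja jb h'(3)
      by (simp add: baer_sum_ext_pull[OF h'(1)] Plus_Hom Plus_assoc)
  next
    fix \<xi> assume \<xi>: "\<xi> \<in> Ext X Y"
    note I = Ide_Hom[OF assms(1)] and Z = Zero_Hom[OF assms(1,1)]
    \<comment> \<open>The additive inverse of \<open>\<xi>\<close> will be its pullback along
      -id.\<close>
    have n: "neg (Ide C X) \<in> Hom C X X" using assms by (simp add: Hom_def)
    show "\<zero>\<^bsub>Ext1 C X Y\<^esub> \<oplus>\<^bsub>Ext1 C X Y\<^esub> \<xi> = \<xi>"
      using baer_sum_ext_pull[OF \<xi> Z I] ext_pull_Zero[OF \<xi> assms(1)] ext_pull_Ide[OF \<xi>] assms by simp
    have "ext_pull C (neg (Ide C X)) \<xi> \<oplus>\<^bsub>Ext1 C X Y\<^esub> \<xi> = \<zero>\<^bsub>Ext1 C X Y\<^esub>"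
      using baer_sum_ext_pull[OF \<xi> n I] ext_pull_Zero[OF \<xi> assms(1)] ext_pull_Ide[OF \<xi>] assms by simp
    then show "\<exists>\<zeta>\<in>Ext X Y. \<zeta> \<oplus>\<^bsub>Ext1 C X Y\<^esub> \<xi> = \<zero>\<^bsub>Ext1 C X Y\<^esub>"
      using ext_pull_closed[OF \<xi> n] by blast
  qed
  fix r \<xi> assume r: "r \<in> carrier k" and \<xi>: "\<xi> \<in> Ext X Y"
  show "r \<odot>\<^bsub>Ext1 C X Y\<^esub> \<xi> \<in> Ext X Y"
    using ext_push_closed[OF \<xi> Scal_Hom[OF r Ide_Hom[OF assms(2)]]] by simp
next
  fix r s \<xi> assume rs: "r \<in> carrier k" "s \<in> carrier k" and \<xi>: "\<xi> \<in> Ext X Y"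
  note I = Ide_Hom[OF assms(1)]
  interpret H: module k "HomMod C X X" using assms by (intro HomMod_module) auto
  \<comment> \<open>With scalars moved to the right end, the laws for scalars become those of the
    module of endomorphisms of \<open>X\<close>.\<close>
  have d: "Scal C (r \<oplus>\<^bsub>k\<^esub> s) (Ide C X) = Scal C r (Ide C X) \<boxplus> Scal C s (Ide C X)"
    "Scal C (r \<otimes>\<^bsub>k\<^esub> s) (Ide C X) = Scal C r (Scal C s (Ide C X))"
    using H.smult_l_distr[of r s "Ide C X"] H.smult_assoc1[of r s "Ide C X"] I rs unfolding HomMod_def by simp_all
  show "(r \<oplus>\<^bsub>k\<^esub> s) \<odot>\<^bsub>Ext1 C X Y\<^esub> \<xi> = r \<odot>\<^bsub>Ext1 C X Y\<^esub> \<xi> \<oplus>\<^bsub>Ext1 C X Y\<^esub> s \<odot>\<^bsub>Ext1 C X Y\<^esub> \<xi>"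
    using rs d baer_sum_ext_pull[OF \<xi> Scal_Hom[OF rs(1) I] Scal_Hom[OF rs(2) I]]
    by (simp add: ext_push_Scal[OF \<xi>])
  have "ext_push C (Scal C r (Ide C Y)) (ext_pull C (Scal C s (Ide C X)) \<xi>) = ext_pull C (Scal C r (Scal C s (Ide C X))) \<xi>"
    by (rule ext_pull_smult[OF \<xi> Scal_Hom[OF rs(2) I] rs(1)])
  then show "(r \<otimes>\<^bsub>k\<^esub> s) \<odot>\<^bsub>Ext1 C X Y\<^esub> \<xi> = r \<odot>\<^bsub>Ext1 C X Y\<^esub> (s \<odot>\<^bsub>Ext1 C X Y\<^esub> \<xi>)"
    using rs d by (simp add: ext_push_Scal[OF \<xi>])
next
  fix r \<xi> \<zeta> assume r: "r \<in> carrier k" and xz: "\<xi> \<in> Ext X Y" "\<zeta> \<in> Ext X Y"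
  obtain W a b \<omega> where h: "\<omega> \<in> Ext W Y" "a \<in> Hom C X W" "b \<in> Hom C X W"
    "\<xi> = ext_pull C a \<omega>" "\<zeta> = ext_pull C b \<omega>" by (rule Ext_joint_pull[OF xz])
  interpret H: module k "HomMod C X W" using Hom_Obj[OF h(2)] by (intro HomMod_module) auto
  have d: "Scal C r (a \<boxplus> b) = Scal C r a \<boxplus> Scal C r b"
    using H.smult_r_distr[of r a b] h r unfolding HomMod_def by simp
  show "r \<odot>\<^bsub>Ext1 C X Y\<^esub> (\<xi> \<oplus>\<^bsub>Ext1 C X Y\<^esub> \<zeta>) = r \<odot>\<^bsub>Ext1 C X Y\<^esub> \<xi> \<oplus>\<^bsub>Ext1 C X Y\<^esub> r \<odot>\<^bsub>Ext1 C X Y\<^esub> \<zeta>"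
    unfolding h(4,5) using h(2,3) r d
    by (simp add: baer_sum_ext_pull[OF h(1)] Plus_Hom Scal_Hom ext_pull_smult[OF h(1,2)] ext_pull_smult[OF h(1,3)]
        ext_pull_smult[OF h(1) Plus_Hom[OF h(2,3)]])
next
  fix \<xi> assume \<xi>: "\<xi> \<in> Ext X Y"
  interpret H: module k "HomMod C X X" using assms by (intro HomMod_module) auto
  have "Scal C \<one>\<^bsub>k\<^esub> (Ide C X) = Ide C X"
    using H.smult_one[of "Ide C X"] Ide_Hom[OF assms(1)] unfolding HomMod_def by simp
  then show "\<one>\<^bsub>k\<^esub> \<odot>\<^bsub>Ext1 C X Y\<^esub> \<xi> = \<xi>"
    using ext_push_Scal[OF \<xi> K.one_closed] ext_pull_Ide[OF \<xi>] by simp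
qed

text \<open>Linearity of the pullback makes its composite with a functional again a functional, to
  which \<Phi> can be applied.\<close>

lemma ext_pull_linear:
  assumes f: "f \<in> Hom C X' X" and Y: "Y \<in> Obj C"
  shows "\<xi> \<in> Ext X Y \<Longrightarrow> \<zeta> \<in> Ext X Y \<Longrightarrow>
      ext_pull C f (\<xi> \<oplus>\<^bsub>Ext1 C X Y\<^esub> \<zeta>) = ext_pull C f \<xi> \<oplus>\<^bsub>Ext1 C X' Y\<^esub> ext_pull C f \<zeta>"
    and "\<xi> \<in> Ext X Y \<Longrightarrow> r \<in> carrier k \<Longrightarrow>
      ext_pull C f (r \<odot>\<^bsub>Ext1 C X Y\<^esub> \<xi>) = r \<odot>\<^bsub>Ext1 C X' Y\<^esub> ext_pull C f \<xi>"
proof -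
  assume xz: "\<xi> \<in> Ext X Y" "\<zeta> \<in> Ext X Y"
  obtain W a b \<omega> where h: "\<omega> \<in> Ext W Y" "a \<in> Hom C X W" "b \<in> Hom C X W"
    "\<xi> = ext_pull C a \<omega>" "\<zeta> = ext_pull C b \<omega>" by (rule Ext_joint_pull[OF xz])
  note af = Comp_Hom[OF f h(2)] and bf = Comp_Hom[OF f h(3)]
  have "(a \<boxplus> b) \<bullet> f = a \<bullet> f \<boxplus> b \<bullet> f" using f h(2,3) by (simp add: Hom_def)
  then show "ext_pull C f (\<xi> \<oplus>\<^bsub>Ext1 C X Y\<^esub> \<zeta>) = ext_pull C f \<xi> \<oplus>\<^bsub>Ext1 C X' Y\<^esub> ext_pull C f \<zeta>"
    unfolding h(4,5) using baer_sum_ext_pull[OF h(1) h(2,3)] baer_sum_ext_pull[OF h(1) af bf]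
      ext_pull_comp[OF h(1) _ f] h(2,3) Plus_Hom[OF h(2,3)] by simp
next
  assume "\<xi> \<in> Ext X Y" "r \<in> carrier k"
  then show "ext_pull C f (r \<odot>\<^bsub>Ext1 C X Y\<^esub> \<xi>) = r \<odot>\<^bsub>Ext1 C X' Y\<^esub> ext_pull C f \<xi>"
    using ext_push_pull[OF _ f Scal_Hom[OF _ Ide_Hom[OF Y]]] by simp
qed

lemma ext_push_comp:
  assumes \<xi>: "\<xi> \<in> Ext X Y" and f: "f \<in> Hom C Y Y'" and g: "g \<in> Hom C Y' Y''"
  shows "ext_push C g (ext_push C f \<xi>) = ext_push C (g \<bullet> f) \<xi>"
  unfolding ext_push_opposite
  using abelian_category.ext_pull_comp[OF abelian_category_opposite Ext_opposite[OF \<xi>], of f Y' g Y''] f g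
  by (simp add: image_image)

lemma ext_push_linear:
  assumes h: "h \<in> Hom C Y Y'" and X: "X \<in> Obj C"
  shows "\<xi> \<in> Ext X Y \<Longrightarrow> \<zeta> \<in> Ext X Y \<Longrightarrow>
      ext_push C h (\<xi> \<oplus>\<^bsub>Ext1 C X Y\<^esub> \<zeta>) = ext_push C h \<xi> \<oplus>\<^bsub>Ext1 C X Y'\<^esub> ext_push C h \<zeta>"
    and "\<xi> \<in> Ext X Y \<Longrightarrow> r \<in> carrier k \<Longrightarrow>
      ext_push C h (r \<odot>\<^bsub>Ext1 C X Y\<^esub> \<xi>) = r \<odot>\<^bsub>Ext1 C X Y'\<^esub> ext_push C h \<xi>"
proof -
  assume xz: "\<xi> \<in> Ext X Y" "\<zeta> \<in> Ext X Y"
  obtain W a b \<omega> where w: "\<omega> \<in> Ext W Y" "a \<in> Hom C X W" "b \<in> Hom C X W"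
    "\<xi> = ext_pull C a \<omega>" "\<zeta> = ext_pull C b \<omega>" by (rule Ext_joint_pull[OF xz])
  show "ext_push C h (\<xi> \<oplus>\<^bsub>Ext1 C X Y\<^esub> \<zeta>) = ext_push C h \<xi> \<oplus>\<^bsub>Ext1 C X Y'\<^esub> ext_push C h \<zeta>"
    unfolding w(4,5) using baer_sum_ext_pull[OF w(1-3)] baer_sum_ext_pull[OF ext_push_closed[OF w(1) h] w(2,3)]
      ext_push_pull[OF w(1) _ h] w(2,3) Plus_Hom[OF w(2,3)] by simp
next
  assume a: "\<xi> \<in> Ext X Y" "r \<in> carrier k"
  have O: "Y \<in> Obj C" "Y' \<in> Obj C" using Hom_Obj[OF h] by auto
  have "h \<bullet> Scal C r (Ide C Y) = Scal C r (Ide C Y') \<bullet> h" using h a O by (simp add: Hom_def)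
  then show "ext_push C h (r \<odot>\<^bsub>Ext1 C X Y\<^esub> \<xi>) = r \<odot>\<^bsub>Ext1 C X Y'\<^esub> ext_push C h \<xi>"
    using ext_push_comp[OF a(1) Scal_Hom[OF a(2) Ide_Hom[OF O(1)]] h]
      ext_push_comp[OF a(1) h Scal_Hom[OF a(2) Ide_Hom[OF O(2)]]] by simp
qed

end

section \<open>Equivalences of categories\<close>

lemma (in category) isomorphismE:
  assumes "isomorphism C f" "f \<in> Hom C X Y"
  obtains g where "g \<in> Hom C Y X" "g \<bullet> f = Ide C X" "f \<bullet> g = Ide C Y"
  using assms unfolding isomorphism_def Hom_def by auto

lemma is_functorD:
  assumes "is_functor C D F"
  shows "X \<in> Obj C \<Longrightarrow> on_Obj F X \<in> Obj D"
    "f \<in> Hom C X Y \<Longrightarrow> on_Arr F f \<in> Hom D (on_Obj F X) (on_Obj F Y)"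
    "f \<in> Hom C X Y \<Longrightarrow> g \<in> Hom C Y Z \<Longrightarrow> on_Arr F (g \<bullet>\<^bsub>C\<^esub> f) = on_Arr F g \<bullet>\<^bsub>D\<^esub> on_Arr F f"
  using assms unfolding is_functor_def by blast+

lemma (in category) natural_isomorphism_id:
  assumes "naturally_isomorphic C C (comp_functor G F) id_functor"
  obtains \<nu> where "\<And>X. X \<in> Obj C \<Longrightarrow> \<nu> X \<in> Hom C (on_Obj G (on_Obj F X)) X"
    "\<And>X. X \<in> Obj C \<Longrightarrow> isomorphism C (\<nu> X)"
    "\<And>X Y f. f \<in> Hom C X Y \<Longrightarrow> \<nu> Y \<bullet> on_Arr G (on_Arr F f) = f \<bullet> \<nu> X"
proof -
  obtain \<nu> where "\<forall>X\<in>Obj C. \<nu> X \<in> Hom C (on_Obj G (on_Obj F X)) X \<and> isomorphism C (\<nu> X)"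
    "\<forall>X Y. \<forall>f\<in>Hom C X Y. \<nu> Y \<bullet> on_Arr G (on_Arr F f) = f \<bullet> \<nu> X"
    using assms unfolding naturally_isomorphic_def comp_functor_def id_functor_def by auto
  then show ?thesis by (intro that[of \<nu>]) auto
qed

text \<open>A morphism is recovered from its image under \<open>F\<close> by applying
  \<open>G\<close> and conjugating with \<nu>.\<close>

lemma (in category) left_inverse_faithful:
  assumes iso: "naturally_isomorphic C C (comp_functor G F) id_functor"
    and f: "f \<in> Hom C X Y" "f' \<in> Hom C X Y" "on_Arr F f = on_Arr F f'"
  shows "f = f'"
proof -
  obtain \<nu> where \<nu>: "\<And>X. X \<in> Obj C \<Longrightarrow> \<nu> X \<in> Hom C (on_Obj G (on_Obj F X)) X"
    "\<And>X. X \<in> Obj C \<Longrightarrow> isomorphism C (\<nu> X)"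
    "\<And>X Y f. f \<in> Hom C X Y \<Longrightarrow> \<nu> Y \<bullet> on_Arr G (on_Arr F f) = f \<bullet> \<nu> X"
    using natural_isomorphism_id[OF iso] by metis
  have X: "X \<in> Obj C" using Hom_Obj[OF f(1)] by simp
  obtain \<mu> where \<mu>: "\<mu> \<in> Hom C X (on_Obj G (on_Obj F X))" "\<nu> X \<bullet> \<mu> = Ide C X"
    using isomorphismE[OF \<nu>(2)[OF X] \<nu>(1)[OF X]] by metis
  have "f \<bullet> \<nu> X = f' \<bullet> \<nu> X" using \<nu>(3)[OF f(1)] \<nu>(3)[OF f(2)] f(3) by simp
  then have "(f \<bullet> \<nu> X) \<bullet> \<mu> = (f' \<bullet> \<nu> X) \<bullet> \<mu>" by simp
  then have "f \<bullet> Ide C X = f' \<bullet> Ide C X"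
    using Comp_assoc[OF \<mu>(1) \<nu>(1)[OF X] f(1)] Comp_assoc[OF \<mu>(1) \<nu>(1)[OF X] f(2)] \<mu>(2) by simp
  then show ?thesis using f by (simp add: Comp_Ide)
qed

lemma (in category) quasi_inverse_full:
  assumes Q: "quasi_inverse C C F G" and X: "X \<in> Obj C" and Y: "Y \<in> Obj C"
    and g: "g \<in> Hom C (on_Obj F X) (on_Obj F Y)"
  obtains f where "f \<in> Hom C X Y" "on_Arr F f = g"
proof -
  have F: "is_functor C C F" and G: "is_functor C C G"
    and iso: "naturally_isomorphic C C (comp_functor G F) id_functor"
    and iso': "naturally_isomorphic C C (comp_functor F G) id_functor"
    using Q unfolding quasi_inverse_def by auto
  obtain \<nu> where \<nu>: "\<And>X. X \<in> Obj C \<Longrightarrow> \<nu> X \<in> Hom C (on_Obj G (on_Obj F X)) X"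
    "\<And>X. X \<in> Obj C \<Longrightarrow> isomorphism C (\<nu> X)"
    "\<And>X Y f. f \<in> Hom C X Y \<Longrightarrow> \<nu> Y \<bullet> on_Arr G (on_Arr F f) = f \<bullet> \<nu> X"
    using natural_isomorphism_id[OF iso] by metis
  obtain \<mu> where \<mu>: "\<mu> \<in> Hom C X (on_Obj G (on_Obj F X))" "\<mu> \<bullet> \<nu> X = Ide C (on_Obj G (on_Obj F X))"
    using isomorphismE[OF \<nu>(2)[OF X] \<nu>(1)[OF X]] by metis
  obtain \<rho> where \<rho>: "\<rho> \<in> Hom C Y (on_Obj G (on_Obj F Y))" "\<rho> \<bullet> \<nu> Y = Ide C (on_Obj G (on_Obj F Y))"
    using isomorphismE[OF \<nu>(2)[OF Y] \<nu>(1)[OF Y]] by metis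
  have Gg: "on_Arr G g \<in> Hom C (on_Obj G (on_Obj F X)) (on_Obj G (on_Obj F Y))"
    by (rule is_functorD(2)[OF G g])
  \<comment> \<open>The preimage forced by naturality of \<nu>. It satisfies G F f = G g, and
    faithfulness of \<open>G\<close>, from the other natural isomorphism, removes
    \<open>G\<close>.\<close>
  define f where "f = \<nu> Y \<bullet> on_Arr G g \<bullet> \<mu>"
  have f: "f \<in> Hom C X Y" unfolding f_def by (rule Comp_Hom[OF Comp_Hom[OF \<mu>(1) Gg] \<nu>(1)[OF Y]])
  have GFf: "on_Arr G (on_Arr F f) \<in> Hom C (on_Obj G (on_Obj F X)) (on_Obj G (on_Obj F Y))"
    by (rule is_functorD(2)[OF G is_functorD(2)[OF F f]])
  note H = HomD[OF \<nu>(1)[OF X]] HomD[OF \<nu>(1)[OF Y]] HomD[OF \<mu>(1)] HomD[OF \<rho>(1)] HomD[OF Gg] HomD[OF GFf]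
  have "\<nu> Y \<bullet> on_Arr G (on_Arr F f) = \<nu> Y \<bullet> on_Arr G g \<bullet> (\<mu> \<bullet> \<nu> X)"
    unfolding \<nu>(3)[OF f] unfolding f_def using H by simp
  also have "\<dots> = \<nu> Y \<bullet> on_Arr G g" unfolding \<mu>(2) using H by simp
  finally have "\<rho> \<bullet> \<nu> Y \<bullet> on_Arr G (on_Arr F f) = \<rho> \<bullet> \<nu> Y \<bullet> on_Arr G g" by simp
  then have "on_Arr G (on_Arr F f) = on_Arr G g"
    using Comp_reduce[OF \<rho>(2), of "on_Arr G g"] Comp_reduce[OF \<rho>(2), of "on_Arr G (on_Arr F f)"] H by simp
  then have "on_Arr F f = g" by (rule left_inverse_faithful[OF iso' is_functorD(2)[OF F f] g])
  then show ?thesis using that f by blast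
qed

section \<open>Epimorphisms annihilated by an object\<close>

context abelian_category begin

lemma epimorphism_Ide: "X \<in> Obj C \<Longrightarrow> epimorphism C (Ide C X)"
  unfolding epimorphism_def by (auto simp: Hom_def)

lemma epimorphism_comp:
  assumes "epimorphism C f" "epimorphism C g" "Cod C f = Dom C g"
  shows "epimorphism C (g \<bullet> f)"
proof -
  have A: "f \<in> Arr C" "g \<in> Arr C" using assms unfolding epimorphism_def by auto
  show ?thesis
  proof (rule epimorphismI)
    fix t assume t: "t \<in> Arr C" "Dom C t = Cod C (g \<bullet> f)" "t \<bullet> g \<bullet> f = Zero C (Dom C (g \<bullet> f)) (Cod C t)"
    then have "t \<bullet> g = Zero C (Dom C g) (Cod C t)"
      using epimorphism_Zero[OF assms(1), of "t \<bullet> g"] A assms(3) by simp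
    then show "t = Zero C (Cod C (g \<bullet> f)) (Cod C t)"
      using epimorphism_Zero[OF assms(2), of t] t A assms(3) by simp
  qed (use A assms in simp)
qed

lemma epimorphism_right_factor:
  assumes "epimorphism C (g \<bullet> f)" "f \<in> Arr C" "g \<in> Arr C" "Cod C f = Dom C g"
  shows "epimorphism C g"
proof (rule epimorphismI)
  fix t assume t: "t \<in> Arr C" "Dom C t = Cod C g" "t \<bullet> g = Zero C (Dom C g) (Cod C t)"
  have "t \<bullet> g \<bullet> f = Zero C (Dom C f) (Cod C t)" using Comp_reduce[OF t(3), of f] t(1,2) assms by simp
  then show "t = Zero C (Cod C g) (Cod C t)" using epimorphism_Zero[OF assms(1), of t] t assms by simp
qed (use assms in simp)

text \<open>Makes the chain condition in Hom(c, Y) applicable to images.\<close>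

lemma Im_Hom_submodule:
  assumes t: "t \<in> Arr C" and c: "c \<in> Obj C"
  shows "submodule (Im_Hom C c t) k (HomMod C c (Cod C t))"
proof -
  interpret H: module k "HomMod C c (Cod C t)" using t c by (intro HomMod_module) auto
  have I: "t \<bullet> s \<in> Im_Hom C c t" if "s \<in> Hom C c (Dom C t)" for s using that unfolding Im_Hom_def by blast
  have E: "\<exists>s\<in>Hom C c (Dom C t). f = t \<bullet> s" if "f \<in> Im_Hom C c t" for f using that unfolding Im_Hom_def by blast
  have sm: "Scal C r f \<in> Im_Hom C c t" if r: "r \<in> carrier k" and f: "f \<in> Im_Hom C c t" for r f
  proof -
    obtain s where s: "s \<in> Hom C c (Dom C t)" "f = t \<bullet> s" using E[OF f] by blast
    then show ?thesis using I[OF Scal_Hom[OF r s(1)]] r t by (simp add: Hom_def)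
  qed
  have sub: "Im_Hom C c t \<subseteq> Hom C c (Cod C t)" unfolding Im_Hom_def Hom_def using t by auto
  show ?thesis
  proof (rule H.submoduleI)
    show "Im_Hom C c t \<subseteq> carrier (HomMod C c (Cod C t))" using sub by (simp add: HomMod_def)
    show "\<zero>\<^bsub>HomMod C c (Cod C t)\<^esub> \<in> Im_Hom C c t"
      using I[OF Zero_Hom[OF c]] t c by (simp add: HomMod_def)
    fix f assume f: "f \<in> Im_Hom C c t"
    have "\<ominus>\<^bsub>HomMod C c (Cod C t)\<^esub> f = (\<ominus>\<^bsub>k\<^esub> \<one>\<^bsub>k\<^esub>) \<odot>\<^bsub>HomMod C c (Cod C t)\<^esub> f"
      using H.smult_l_minus[of "\<one>\<^bsub>k\<^esub>" f] H.smult_one[of f] f sub by (auto simp: HomMod_def)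
    then show "\<ominus>\<^bsub>HomMod C c (Cod C t)\<^esub> f \<in> Im_Hom C c t" using sm[of "\<ominus>\<^bsub>k\<^esub> \<one>\<^bsub>k\<^esub>" f] f by (simp add: HomMod_def)
  next
    fix f g assume "f \<in> Im_Hom C c t" "g \<in> Im_Hom C c t"
    then obtain s s' where s: "s \<in> Hom C c (Dom C t)" "f = t \<bullet> s" "s' \<in> Hom C c (Dom C t)" "g = t \<bullet> s'" using E by blast
    then show "f \<oplus>\<^bsub>HomMod C c (Cod C t)\<^esub> g \<in> Im_Hom C c t"
      using I[OF Plus_Hom[OF s(1,3)]] t by (simp add: HomMod_def Hom_def)
  next
    fix r f assume "r \<in> carrier k" "f \<in> Im_Hom C c t"
    then show "r \<odot>\<^bsub>HomMod C c (Cod C t)\<^esub> f \<in> Im_Hom C c t" using sm by (simp add: HomMod_def)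
  qed
qed

text \<open>Take an epimorphism onto \<open>Y\<close> whose image of Hom(c, -) is minimal. If that
  image contained a nonzero \<open>f\<close>, a pullback along an epimorphism through which
  \<open>f\<close> does not factor would produce an epimorphism with a strictly smaller
  image.\<close>

lemma ex_annihilating_epimorphism:
  assumes art: "artinian_cring k" and fin: "hom_finite k C" and c: "c \<in> Obj C" and Y: "Y \<in> Obj C"
    and sep: "\<And>f. f \<in> Hom C c Y \<Longrightarrow> f \<noteq> Zero C c Y \<Longrightarrow>
      \<exists>p. epimorphism C p \<and> Cod C p = Y \<and> f \<notin> Im_Hom C c p"
  shows "\<exists>t. epimorphism C t \<and> Cod C t = Y \<and> Im_Hom C c t \<subseteq> {Zero C c Y}"
proof -
  define N where "N = {Im_Hom C c t | t. epimorphism C t \<and> Cod C t = Y}"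
  have fg: "finitely_generated_module k (HomMod C c Y)" using fin c Y unfolding hom_finite_def by blast
  have sub: "submodule A k (HomMod C c Y)" if "A \<in> N" for A
    using that Im_Hom_submodule[OF _ c] unfolding N_def epimorphism_def by blast
  have "Im_Hom C c (Ide C Y) \<in> N" using epimorphism_Ide[OF Y] Y unfolding N_def by auto
  then have "N \<noteq> {}" by blast
  from artinian_minimal_submodule[OF art fg sub this]
  obtain A where A: "A \<in> N" "\<forall>A'\<in>N. \<not> A' \<subset> A" by blast
  then obtain t where t: "epimorphism C t" "Cod C t = Y" and "A = Im_Hom C c t" unfolding N_def by blast
  with A have min: "\<forall>A\<in>N. \<not> A \<subset> Im_Hom C c t" by simp
  have tA: "t \<in> Arr C" using t unfolding epimorphism_def by simp
  have "f = Zero C c Y" if f: "f \<in> Im_Hom C c t" for f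
  proof (rule ccontr)
    assume "f \<noteq> Zero C c Y"
    moreover have "f \<in> Hom C c Y" using f tA t unfolding Im_Hom_def Hom_def by auto
    ultimately obtain p where p: "epimorphism C p" "Cod C p = Y" "f \<notin> Im_Hom C c p" using sep by blast
    have pA: "p \<in> Arr C" using p unfolding epimorphism_def by simp
    \<comment> \<open>The diagonal t p' = p g of the pullback square is epi since \<open>t\<close>
      and \<open>p'\<close> are, and its image lies in those of both \<open>t\<close> and
      \<open>p\<close>.\<close>
    obtain g p' where pb: "is_pullback C t p g p'" and p': "epimorphism C p'"
      using epimorphism_pullback[OF tA p(1)] t p by metis
    have A: "g \<in> Arr C" "p' \<in> Arr C" "Dom C g = Dom C p'" "Cod C p' = Dom C t" "Cod C g = Dom C p" "t \<bullet> p' = p \<bullet> g"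
      using pb unfolding is_pullback_def by auto
    have ep: "epimorphism C (t \<bullet> p')" by (rule epimorphism_comp[OF p' t(1) A(4)])
    have fac: "Im_Hom C c (a \<bullet> b) \<subseteq> Im_Hom C c a" if ab: "a \<in> Arr C" "b \<in> Arr C" "Cod C b = Dom C a" for a b
    proof
      fix x assume "x \<in> Im_Hom C c (a \<bullet> b)"
      then obtain s where s: "s \<in> Hom C c (Dom C b)" "x = (a \<bullet> b) \<bullet> s" using ab unfolding Im_Hom_def by auto
      then have "x = a \<bullet> (b \<bullet> s)" "b \<bullet> s \<in> Hom C c (Dom C a)" using ab by (simp_all add: Hom_def)
      then show "x \<in> Im_Hom C c a" unfolding Im_Hom_def by blast
    qed
    have "Cod C (t \<bullet> p') = Y" using Comp_sel(3)[of p' t] tA A(2,4) t(2) by simp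
    then have "Im_Hom C c (t \<bullet> p') \<in> N" using ep unfolding N_def by blast
    moreover have "Im_Hom C c (t \<bullet> p') \<subseteq> Im_Hom C c t" by (rule fac) (use tA A in auto)
    moreover have "Im_Hom C c (t \<bullet> p') \<subseteq> Im_Hom C c p" unfolding A(6) by (rule fac) (use pA A in auto)
    ultimately show False using min f p(3) by blast
  qed
  then show ?thesis using t by blast
qed

text \<open>Serre duality enters only through \<open>sep\<close>, so that the lemma can be used in
  \<open>opposite C\<close> as well, where no duality has been set up.\<close>

lemma right_determined_imp_epimorphism:
  assumes art: "artinian_cring k" and fin: "hom_finite k C"
    and sep: "\<And>c Y f. f \<in> Hom C c Y \<Longrightarrow> f \<noteq> Zero C c Y \<Longrightarrow>
      \<exists>p. epimorphism C p \<and> Cod C p = Y \<and> f \<notin> Im_Hom C c p"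
    and det: "right_determined C \<alpha> c"
  shows "epimorphism C \<alpha>"
proof -
  have \<alpha>: "\<alpha> \<in> Arr C" and c: "c \<in> Obj C" using det unfolding right_determined_def by auto
  have "\<exists>t. epimorphism C t \<and> Cod C t = Cod C \<alpha> \<and> Im_Hom C c t \<subseteq> {Zero C c (Cod C \<alpha>)}"
    by (rule ex_annihilating_epimorphism[OF art fin c]) (use \<alpha> sep in auto)
  then obtain t where t: "epimorphism C t" "Cod C t = Cod C \<alpha>" "Im_Hom C c t \<subseteq> {Zero C c (Cod C \<alpha>)}" by blast
  have tA: "t \<in> Arr C" using t unfolding epimorphism_def by simp
  have "Zero C c (Cod C \<alpha>) \<in> Im_Hom C c \<alpha>"
    unfolding Im_Hom_def using \<alpha> c Zero_Hom[of c "Dom C \<alpha>"] by (intro image_eqI[of _ _ "Zero C c (Dom C \<alpha>)"]) auto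
  then have "Im_Hom C c t \<subseteq> Im_Hom C c \<alpha>" using t by blast
  moreover have "t \<in> Hom C (Dom C t) (Cod C \<alpha>)" "Dom C t \<in> Obj C" using tA t unfolding Hom_def by auto
  ultimately obtain t' where t': "t' \<in> Hom C (Dom C t) (Dom C \<alpha>)" "t = \<alpha> \<bullet> t'"
    using det unfolding right_determined_def by blast
  then show ?thesis using epimorphism_right_factor[of \<alpha> t'] t \<alpha> by (simp add: Hom_def)
qed

lemma extensions_of_monomorphism:
  assumes "monomorphism C i" "is_cokernel C i p"
  shows "(i, p) \<in> extensions C (Cod C p) (Dom C i)"
  using abelian_category.extensions_of_epimorphism[OF abelian_category_opposite, of i p] assms
  by (simp add: extensions_opposite)

end

section \<open>Serre duality\<close>

text \<open>Fixes a witness \<Phi> of the duality and a quasi-inverse \<sigma> of \<tau>, both of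
  which are existential in \<open>serre_duality\<close>. Functionals are written as
  \<open>linear_maps\<close>, the carrier of \<open>Hom_module\<close>.\<close>

locale serre_category = abelian_category k C
  for k :: "('k, 'x) ring_scheme" and C :: "('k, 'o, 'm) lincat" (structure) +
  fixes E :: "('k, 'e, 'y) module_scheme" and \<tau> \<sigma> :: "('o, 'm, 'o, 'm) functor_data"
    and \<Phi> :: "'o \<Rightarrow> 'o \<Rightarrow> (('m \<times> 'm) set \<Rightarrow> 'e) \<Rightarrow> 'm"
  assumes artinian: "artinian_cring k"
    and fin: "hom_finite k C"
    and cogenerator: "injective_cogenerator k E"
    and \<tau>_linear: "is_linear_functor k C C \<tau>"
    and \<tau>_inverse: "quasi_inverse C C \<tau> \<sigma>"
    and \<Phi>_linear: "\<lbrakk>X \<in> Obj C; Y \<in> Obj C\<rbrakk> \<Longrightarrow>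
      \<Phi> X Y \<in> linear_maps k (Hom_module k (Ext1 C X Y) E) (HomMod C Y (on_Obj \<tau> X))"
    and \<Phi>_bij: "\<lbrakk>X \<in> Obj C; Y \<in> Obj C\<rbrakk> \<Longrightarrow>
      bij_betw (\<Phi> X Y) (linear_maps k (Ext1 C X Y) E) (Hom C Y (on_Obj \<tau> X))"
    and \<Phi>_pull: "\<lbrakk>Y \<in> Obj C; f \<in> Hom C X X'; \<phi> \<in> linear_maps k (Ext1 C X Y) E\<rbrakk> \<Longrightarrow>
      \<Phi> X' Y (compose (carrier (Ext1 C X' Y)) \<phi> (ext_pull C f)) = on_Arr \<tau> f \<bullet> \<Phi> X Y \<phi>"
    and \<Phi>_push: "\<lbrakk>X \<in> Obj C; h \<in> Hom C Y' Y; \<phi> \<in> linear_maps k (Ext1 C X Y) E\<rbrakk> \<Longrightarrow>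
      \<Phi> X Y' (compose (carrier (Ext1 C X Y')) \<phi> (ext_push C h)) = \<Phi> X Y \<phi> \<bullet> h"
begin

lemma module_E: "module k E"
  using cogenerator unfolding injective_cogenerator_def injective_module_def by blast

lemma \<tau>_functor: "is_functor C C \<tau>"
  using \<tau>_linear unfolding is_linear_functor_def by blast

lemma \<tau>_Obj: "X \<in> Obj C \<Longrightarrow> on_Obj \<tau> X \<in> Obj C"
  by (rule is_functorD(1)[OF \<tau>_functor])

lemma \<sigma>_functor: "is_functor C C \<sigma>"
  using \<tau>_inverse unfolding quasi_inverse_def by blast

lemma \<sigma>_Obj: "X \<in> Obj C \<Longrightarrow> on_Obj \<sigma> X \<in> Obj C"
  by (rule is_functorD(1)[OF \<sigma>_functor])

lemma \<tau>_Hom: "f \<in> Hom C X Y \<Longrightarrow> on_Arr \<tau> f \<in> Hom C (on_Obj \<tau> X) (on_Obj \<tau> Y)"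
  by (rule is_functorD(2)[OF \<tau>_functor])

text \<open>Being linear, \<tau> commutes with the scalar zero and so preserves zero morphisms;
  being faithful, it sends nothing else to zero.\<close>

lemma \<tau>_nonzero:
  assumes f: "f \<in> Hom C X Y" "f \<noteq> Zero C X Y"
  shows "on_Arr \<tau> f \<noteq> Zero C (on_Obj \<tau> X) (on_Obj \<tau> Y)"
proof
  assume z: "on_Arr \<tau> f = Zero C (on_Obj \<tau> X) (on_Obj \<tau> Y)"
  have O: "X \<in> Obj C" "Y \<in> Obj C" using Hom_Obj[OF f(1)] by auto
  have "on_Arr \<tau> (Scal C \<zero>\<^bsub>k\<^esub> f) = Scal C \<zero>\<^bsub>k\<^esub> (on_Arr \<tau> f)"
    using \<tau>_linear f unfolding is_linear_functor_def Hom_def by auto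
  then have "on_Arr \<tau> (Zero C X Y) = on_Arr \<tau> f"
    using \<tau>_Hom[OF f(1)] f(1) z O by (simp add: Hom_def Scal_null Scal_Zero \<tau>_Obj)
  moreover have "naturally_isomorphic C C (comp_functor \<sigma> \<tau>) id_functor"
    using \<tau>_inverse unfolding quasi_inverse_def by blast
  ultimately show False using left_inverse_faithful[OF _ f(1) Zero_Hom[OF O]] f(2) by metis
qed

text \<open>Exhibits \<open>X\<close> as a retract of \<tau>\<sigma> X; this half of the isomorphism
  suffices below.\<close>

lemma ex_iso_\<tau>\<sigma>:
  assumes "X \<in> Obj C"
  obtains \<epsilon> \<theta> where "\<epsilon> \<in> Hom C (on_Obj \<tau> (on_Obj \<sigma> X)) X" "\<theta> \<in> Hom C X (on_Obj \<tau> (on_Obj \<sigma> X))"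
    "\<epsilon> \<bullet> \<theta> = Ide C X"
proof -
  have "naturally_isomorphic C C (comp_functor \<tau> \<sigma>) id_functor"
    using \<tau>_inverse unfolding quasi_inverse_def by blast
  then obtain \<nu> where \<nu>: "\<And>X. X \<in> Obj C \<Longrightarrow> \<nu> X \<in> Hom C (on_Obj \<tau> (on_Obj \<sigma> X)) X"
    "\<And>X. X \<in> Obj C \<Longrightarrow> isomorphism C (\<nu> X)" by (rule natural_isomorphism_id) blast
  show ?thesis using isomorphismE[OF \<nu>(2)[OF assms] \<nu>(1)[OF assms]] that \<nu>(1)[OF assms] by metis
qed

lemma ex_functional:
  assumes "\<eta> \<in> Ext X Y" "\<eta> \<noteq> split_extensions C X Y"
  obtains \<phi> where "\<phi> \<in> linear_maps k (Ext1 C X Y) E" "\<phi> \<eta> \<noteq> \<zero>\<^bsub>E\<^esub>"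
  using injective_cogenerator_separates[OF cogenerator module_Ext1, of X Y \<eta>] assms Ext_Obj[OF assms(1)] by auto

lemma functional_split:
  assumes "\<phi> \<in> linear_maps k (Ext1 C X Y) E" "X \<in> Obj C" "Y \<in> Obj C"
  shows "\<phi> (split_extensions C X Y) = \<zero>\<^bsub>E\<^esub>"
  using linear_maps_zero[OF module_Ext1[OF assms(2,3)] module_E assms(1)] by simp

lemma \<Phi>_surj:
  assumes "X \<in> Obj C" "g \<in> Hom C Y (on_Obj \<tau> X)"
  obtains \<phi> where "\<phi> \<in> linear_maps k (Ext1 C X Y) E" "\<Phi> X Y \<phi> = g"
  using \<Phi>_bij[OF assms(1), of Y] Hom_Obj[OF assms(2)] assms(2) unfolding bij_betw_def by (metis imageE)

lemma \<Phi>_Hom: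
  assumes "X \<in> Obj C" "Y \<in> Obj C" "\<phi> \<in> linear_maps k (Ext1 C X Y) E"
  shows "\<Phi> X Y \<phi> \<in> Hom C Y (on_Obj \<tau> X)"
  using \<Phi>_bij[OF assms(1,2)] assms(3) unfolding bij_betw_def by blast

text \<open>A functional that vanishes everywhere equals its multiple by the scalar zero, by
  extensionality, and \<Phi> respects scalars.\<close>

lemma \<Phi>_vanishing:
  assumes O: "X \<in> Obj C" "Y \<in> Obj C" and \<phi>: "\<phi> \<in> linear_maps k (Ext1 C X Y) E"
    and z: "\<And>\<xi>. \<xi> \<in> Ext X Y \<Longrightarrow> \<phi> \<xi> = \<zero>\<^bsub>E\<^esub>"
  shows "\<Phi> X Y \<phi> = Zero C Y (on_Obj \<tau> X)"
proof -
  interpret E: module k E by (rule module_E)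
  have car: "carrier (Hom_module k (Ext1 C X Y) E) = linear_maps k (Ext1 C X Y) E"
    by (simp add: Hom_module_def)
  have "\<zero>\<^bsub>k\<^esub> \<odot>\<^bsub>Hom_module k (Ext1 C X Y) E\<^esub> \<phi> = \<phi>"
  proof
    fix \<xi>
    have "\<phi> \<in> Ext X Y \<rightarrow>\<^sub>E carrier E" using \<phi> unfolding linear_maps_def by blast
    then show "(\<zero>\<^bsub>k\<^esub> \<odot>\<^bsub>Hom_module k (Ext1 C X Y) E\<^esub> \<phi>) \<xi> = \<phi> \<xi>"
      using z by (cases "\<xi> \<in> Ext X Y") (auto simp: Hom_module_def)
  qed
  moreover have "\<Phi> X Y (\<zero>\<^bsub>k\<^esub> \<odot>\<^bsub>Hom_module k (Ext1 C X Y) E\<^esub> \<phi>) = Scal C \<zero>\<^bsub>k\<^esub> (\<Phi> X Y \<phi>)"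
    using linear_maps_smult[OF \<Phi>_linear[OF O] K.zero_closed, of \<phi>] \<phi> car by (simp add: HomMod_def)
  ultimately show ?thesis using \<Phi>_Hom[OF O \<phi>] Scal_null[of "\<Phi> X Y \<phi>"] by (simp add: Hom_def)
qed

lemma compose_pull_linear:
  assumes f: "f \<in> Hom C X X'" and Y: "Y \<in> Obj C" and \<phi>: "\<phi> \<in> linear_maps k (Ext1 C X Y) E"
  shows "compose (Ext X' Y) \<phi> (ext_pull C f) \<in> linear_maps k (Ext1 C X' Y) E"
proof -
  have O: "X' \<in> Obj C" using Hom_Obj[OF f] by auto
  interpret M: module k "Ext1 C X' Y" by (rule module_Ext1[OF O Y])
  note cl = ext_pull_closed[OF _ f]
  show ?thesis unfolding linear_maps_def
  proof (intro CollectI conjI ballI)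
    show "compose (Ext X' Y) \<phi> (ext_pull C f) \<in> Ext X' Y \<rightarrow>\<^sub>E carrier E"
      using cl linear_maps_closed[OF \<phi>] by (auto simp: compose_def)
  next
    fix \<xi> \<zeta> assume "\<xi> \<in> Ext X' Y" "\<zeta> \<in> Ext X' Y"
    then show "compose (Ext X' Y) \<phi> (ext_pull C f) (\<xi> \<oplus>\<^bsub>Ext1 C X' Y\<^esub> \<zeta>)
      = compose (Ext X' Y) \<phi> (ext_pull C f) \<xi> \<oplus>\<^bsub>E\<^esub> compose (Ext X' Y) \<phi> (ext_pull C f) \<zeta>"
      using M.a_closed ext_pull_linear(1)[OF f Y] linear_maps_add[OF \<phi> cl cl] by (simp add: compose_def del: Ext1_sel)
  next
    fix r \<xi> assume "r \<in> carrier k" "\<xi> \<in> Ext X' Y"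
    then show "compose (Ext X' Y) \<phi> (ext_pull C f) (r \<odot>\<^bsub>Ext1 C X' Y\<^esub> \<xi>)
      = r \<odot>\<^bsub>E\<^esub> compose (Ext X' Y) \<phi> (ext_pull C f) \<xi>"
      using M.smult_closed ext_pull_linear(2)[OF f Y] linear_maps_smult[OF \<phi> _ cl] by (simp add: compose_def del: Ext1_sel)
  qed
qed

lemma compose_push_linear:
  assumes h: "h \<in> Hom C Y' Y" and X: "X \<in> Obj C" and \<phi>: "\<phi> \<in> linear_maps k (Ext1 C X Y) E"
  shows "compose (Ext X Y') \<phi> (ext_push C h) \<in> linear_maps k (Ext1 C X Y') E"
proof -
  have O: "Y' \<in> Obj C" using Hom_Obj[OF h] by auto
  interpret M: module k "Ext1 C X Y'" by (rule module_Ext1[OF X O])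
  note cl = ext_push_closed[OF _ h]
  show ?thesis unfolding linear_maps_def
  proof (intro CollectI conjI ballI)
    show "compose (Ext X Y') \<phi> (ext_push C h) \<in> Ext X Y' \<rightarrow>\<^sub>E carrier E"
      using cl linear_maps_closed[OF \<phi>] by (auto simp: compose_def)
  next
    fix \<xi> \<zeta> assume "\<xi> \<in> Ext X Y'" "\<zeta> \<in> Ext X Y'"
    then show "compose (Ext X Y') \<phi> (ext_push C h) (\<xi> \<oplus>\<^bsub>Ext1 C X Y'\<^esub> \<zeta>)
      = compose (Ext X Y') \<phi> (ext_push C h) \<xi> \<oplus>\<^bsub>E\<^esub> compose (Ext X Y') \<phi> (ext_push C h) \<zeta>"
      using M.a_closed ext_push_linear(1)[OF h X] linear_maps_add[OF \<phi> cl cl] by (simp add: compose_def del: Ext1_sel)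
  next
    fix r \<xi> assume "r \<in> carrier k" "\<xi> \<in> Ext X Y'"
    then show "compose (Ext X Y') \<phi> (ext_push C h) (r \<odot>\<^bsub>Ext1 C X Y'\<^esub> \<xi>)
      = r \<odot>\<^bsub>E\<^esub> compose (Ext X Y') \<phi> (ext_push C h) \<xi>"
      using M.smult_closed ext_push_linear(2)[OF h X] linear_maps_smult[OF \<phi> _ cl] by (simp add: compose_def del: Ext1_sel)
  qed
qed

lemma \<Phi>_inj:
  assumes "X \<in> Obj C" "Y \<in> Obj C" "\<phi> \<in> linear_maps k (Ext1 C X Y) E" "\<psi> \<in> linear_maps k (Ext1 C X Y) E"
    "\<Phi> X Y \<phi> = \<Phi> X Y \<psi>"
  shows "\<phi> = \<psi>"
  using \<Phi>_bij[OF assms(1,2)] assms(3-5) unfolding bij_betw_def by (blast dest: inj_onD)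

section \<open>Determined morphisms under Serre duality\<close>

theorem epimorphism_right_determined:
  assumes \<alpha>: "epimorphism C \<alpha>" and i: "is_kernel C \<alpha> i"
  shows "right_determined C \<alpha> (on_Obj \<sigma> (Dom C i))"
proof -
  define K where "K = Dom C i"
  define c where "c = on_Obj \<sigma> K"
  define Y where "Y = Cod C \<alpha>"
  have e: "(i, \<alpha>) \<in> extensions C Y K" using extensions_of_epimorphism[OF \<alpha> i] unfolding Y_def K_def .
  note D = extensionsD[OF e]
  note \<xi> = ext_class_in_Ext[OF e] and e\<xi> = ext_class_mem[OF e]
  let ?\<xi> = "ext_class Y K (i, \<alpha>)"
  have c: "c \<in> Obj C" unfolding c_def using \<sigma>_Obj D by simp
  obtain \<epsilon> \<theta> where \<epsilon>: "\<epsilon> \<in> Hom C (on_Obj \<tau> c) K" and \<theta>: "\<theta> \<in> Hom C K (on_Obj \<tau> c)" and \<epsilon>\<theta>: "\<epsilon> \<bullet> \<theta> = Ide C K"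
    unfolding c_def by (rule ex_iso_\<tau>\<sigma>[OF D(8)])
  \<comment> \<open>\<open>\<psi>\<close> is the functional on Ext(c, K) that belongs to the
    comparison map K \<rightarrow> \<tau> c; the functional \<open>\<phi>\<close> below will be
    \<open>\<psi>\<close> after a pullback.\<close>
  obtain \<psi> where \<psi>: "\<psi> \<in> linear_maps k (Ext1 C c K) E" "\<Phi> c K \<psi> = \<theta>" by (rule \<Phi>_surj[OF c \<theta>])
  have "\<exists>t'\<in>Hom C T (Dom C \<alpha>). t = \<alpha> \<bullet> t'"
    if T: "T \<in> Obj C" and t: "t \<in> Hom C T Y" and im: "Im_Hom C c t \<subseteq> Im_Hom C c \<alpha>" for T t
  proof -
    have "ext_pull C t ?\<xi> = split_extensions C T K"
    proof (rule ccontr)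
      assume "ext_pull C t ?\<xi> \<noteq> split_extensions C T K"
      then obtain \<phi> where \<phi>: "\<phi> \<in> linear_maps k (Ext1 C T K) E" "\<phi> (ext_pull C t ?\<xi>) \<noteq> \<zero>\<^bsub>E\<^esub>"
        by (rule ex_functional[OF ext_pull_closed[OF \<xi> t]])
      have h: "\<Phi> T K \<phi> \<in> Hom C K (on_Obj \<tau> T)" by (rule \<Phi>_Hom[OF T D(8) \<phi>(1)])
      \<comment> \<open>Composition with \<open>\<epsilon>\<close> turns the map K \<rightarrow>
        \<tau> T into one \<tau> c \<rightarrow> \<tau> T, to which fullness applies;
        \<open>\<epsilon> \<bullet> \<theta> = Ide C K\<close> undoes it afterwards.\<close>
      obtain f where f: "f \<in> Hom C c T" "on_Arr \<tau> f = \<Phi> T K \<phi> \<bullet> \<epsilon>"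
        by (rule quasi_inverse_full[OF \<tau>_inverse c T Comp_Hom[OF \<epsilon> h]])
      have "\<Phi> T K (compose (Ext T K) \<psi> (ext_pull C f)) = (\<Phi> T K \<phi> \<bullet> \<epsilon>) \<bullet> \<theta>"
        using \<Phi>_pull[OF D(8) f(1) \<psi>(1)] f(2) \<psi>(2) by simp
      also have "\<dots> = \<Phi> T K \<phi>" using Comp_assoc[OF \<theta> \<epsilon> h] \<epsilon>\<theta> h by (simp add: Comp_Ide)
      finally have "compose (Ext T K) \<psi> (ext_pull C f) = \<phi>"
        by (rule \<Phi>_inj[OF T D(8) compose_pull_linear[OF f(1) D(8) \<psi>(1)] \<phi>(1)])
      then have "\<phi> (ext_pull C t ?\<xi>) = \<psi> (ext_pull C f (ext_pull C t ?\<xi>))"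
        using ext_pull_closed[OF \<xi> t] by (auto simp: compose_def)
      also have "ext_pull C f (ext_pull C t ?\<xi>) = ext_pull C (t \<bullet> f) ?\<xi>" by (rule ext_pull_comp[OF \<xi> t f(1)])
      also have "\<dots> = split_extensions C c K"
      proof -
        have "t \<bullet> f \<in> Im_Hom C c t" using f(1) t unfolding Im_Hom_def Hom_def by auto
        then have "t \<bullet> f \<in> Im_Hom C c \<alpha>" by (rule subsetD[OF im])
        then obtain s where "s \<in> Hom C c (Dom C \<alpha>)" "\<alpha> \<bullet> s = t \<bullet> f" unfolding Im_Hom_def by auto
        then show ?thesis using ext_pull_split_iff[OF \<xi> e\<xi> Comp_Hom[OF f(1) t]] by blast
      qed
      also have "\<psi> \<dots> = \<zero>\<^bsub>E\<^esub>" by (rule functional_split[OF \<psi>(1) c D(8)])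
      finally show False using \<phi>(2) by contradiction
    qed
    then show ?thesis using ext_pull_split_iff[OF \<xi> e\<xi> t] by metis
  qed
  then show ?thesis unfolding right_determined_def using D(2) c unfolding c_def K_def Y_def by blast
qed

text \<open>Proved directly instead of in \<open>opposite C\<close>, where the duality would have to
  be rebuilt with \<sigma> as translation. In the second variable the argument is shorter: with
  \<open>\<psi>\<close> corresponding to the identity of \<tau> W, naturality shows that
  \<open>\<phi>\<close> is \<open>\<psi>\<close> after the pushout along \<Phi>(\<phi>), without any
  lifting along \<tau>.\<close>

theorem monomorphism_left_determined:
  assumes \<beta>: "monomorphism C \<beta>" and p: "is_cokernel C \<beta> p"
  shows "left_determined C \<beta> (on_Obj \<tau> (Cod C p))"
proof -
  define W where "W = Cod C p"
  define c where "c = on_Obj \<tau> W"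
  define Y where "Y = Dom C \<beta>"
  have e: "(\<beta>, p) \<in> extensions C W Y" using extensions_of_monomorphism[OF \<beta> p] unfolding Y_def W_def .
  note D = extensionsD[OF e]
  note \<xi> = ext_class_in_Ext[OF e] and e\<xi> = ext_class_mem[OF e]
  let ?\<xi> = "ext_class W Y (\<beta>, p)"
  have c: "c \<in> Obj C" unfolding c_def using \<tau>_Obj D by simp
  obtain \<psi> where \<psi>: "\<psi> \<in> linear_maps k (Ext1 C W c) E" "\<Phi> W c \<psi> = Ide C c"
    using \<Phi>_surj[OF D(7), of "Ide C c" c] Ide_Hom[OF c] unfolding c_def by blast
  have "\<exists>t'\<in>Hom C (Cod C \<beta>) T. t = t' \<bullet> \<beta>"
    if T: "T \<in> Obj C" and t: "t \<in> Hom C Y T"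
      and im: "Im_Hom (opposite C) c t \<subseteq> Im_Hom (opposite C) c \<beta>" for T t
  proof -
    have "ext_push C t ?\<xi> = split_extensions C W T"
    proof (rule ccontr)
      assume "ext_push C t ?\<xi> \<noteq> split_extensions C W T"
      then obtain \<phi> where \<phi>: "\<phi> \<in> linear_maps k (Ext1 C W T) E" "\<phi> (ext_push C t ?\<xi>) \<noteq> \<zero>\<^bsub>E\<^esub>"
        by (rule ex_functional[OF ext_push_closed[OF \<xi> t]])
      define f where "f = \<Phi> W T \<phi>"
      have f: "f \<in> Hom C T c" unfolding f_def c_def by (rule \<Phi>_Hom[OF D(7) T \<phi>(1)])
      have "\<Phi> W T (compose (Ext W T) \<psi> (ext_push C f)) = \<Phi> W T \<phi>"
        using \<Phi>_push[OF D(7) f \<psi>(1)] \<psi>(2) f f_def by (simp add: Ide_Comp)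
      then have "compose (Ext W T) \<psi> (ext_push C f) = \<phi>"
        by (rule \<Phi>_inj[OF D(7) T compose_push_linear[OF f D(7) \<psi>(1)] \<phi>(1)])
      then have "\<phi> (ext_push C t ?\<xi>) = \<psi> (ext_push C f (ext_push C t ?\<xi>))"
        using ext_push_closed[OF \<xi> t] by (auto simp: compose_def)
      also have "ext_push C f (ext_push C t ?\<xi>) = ext_push C (f \<bullet> t) ?\<xi>" by (rule ext_push_comp[OF \<xi> t f])
      also have "\<dots> = split_extensions C W c"
      proof -
        have "f \<bullet> t \<in> Im_Hom (opposite C) c t" using f t unfolding Im_Hom_def Hom_def by auto
        then have "f \<bullet> t \<in> Im_Hom (opposite C) c \<beta>" by (rule subsetD[OF im])
        then obtain s where "s \<in> Hom C (Cod C \<beta>) c" "s \<bullet> \<beta> = f \<bullet> t" unfolding Im_Hom_def by auto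
        then show ?thesis using ext_push_split_iff[OF \<xi> e\<xi> Comp_Hom[OF t f]] by blast
      qed
      also have "\<psi> \<dots> = \<zero>\<^bsub>E\<^esub>" by (rule functional_split[OF \<psi>(1) D(7) c])
      finally show False using \<phi>(2) by contradiction
    qed
    then show ?thesis using ext_push_split_iff[OF \<xi> e\<xi> t] by metis
  qed
  then show ?thesis unfolding left_determined_def right_determined_def using D(1) c
    unfolding c_def W_def Y_def by simp
qed

text \<open>\<open>\<psi>\<close> is the functional on Ext(c, \<tau> c) corresponding to the
  identity of \<tau> c. By naturality, \<open>\<psi>\<close> after the pullback along
  \<open>f\<close> corresponds to \<tau> f, which is nonzero; so some \<open>\<xi>\<close> has a
  nonsplit pullback along \<open>f\<close>, and its epimorphism is the one sought.\<close>

lemma ex_epimorphism_not_factor: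
  assumes f: "f \<in> Hom C c Y" "f \<noteq> Zero C c Y"
  shows "\<exists>p. epimorphism C p \<and> Cod C p = Y \<and> f \<notin> Im_Hom C c p"
proof -
  have O: "c \<in> Obj C" "Y \<in> Obj C" using Hom_Obj[OF f(1)] by auto
  define d where "d = on_Obj \<tau> c"
  have d: "d \<in> Obj C" unfolding d_def by (rule \<tau>_Obj[OF O(1)])
  obtain \<psi> where \<psi>: "\<psi> \<in> linear_maps k (Ext1 C c d) E" "\<Phi> c d \<psi> = Ide C d"
    using \<Phi>_surj[OF O(1), of "Ide C d" d] Ide_Hom[OF d] unfolding d_def by blast
  have \<tau>f: "on_Arr \<tau> f \<in> Hom C d (on_Obj \<tau> Y)" unfolding d_def by (rule \<tau>_Hom[OF f(1)])
  have "\<Phi> Y d (compose (Ext Y d) \<psi> (ext_pull C f)) = on_Arr \<tau> f"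
    using \<Phi>_pull[OF d f(1) \<psi>(1)] \<psi>(2) \<tau>f by (simp add: Comp_Ide)
  then have "\<not> (\<forall>\<xi>\<in>Ext Y d. compose (Ext Y d) \<psi> (ext_pull C f) \<xi> = \<zero>\<^bsub>E\<^esub>)"
    using \<Phi>_vanishing[OF O(2) d compose_pull_linear[OF f(1) d \<psi>(1)]] \<tau>_nonzero[OF f] unfolding d_def by metis
  then obtain \<xi> where \<xi>: "\<xi> \<in> Ext Y d" "\<psi> (ext_pull C f \<xi>) \<noteq> \<zero>\<^bsub>E\<^esub>" by (auto simp: compose_def)
  then have ns: "ext_pull C f \<xi> \<noteq> split_extensions C c d" using functional_split[OF \<psi>(1) O(1) d] by metis
  obtain i p where e: "(i, p) \<in> \<xi>" using Ext_nonempty[OF \<xi>(1)] by auto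
  have eX: "(i, p) \<in> extensions C Y d" using Ext_subset[OF \<xi>(1)] e by blast
  have "f \<notin> Im_Hom C c p" using ns ext_pull_split_iff[OF \<xi>(1) e f(1)] unfolding Im_Hom_def by blast
  then show ?thesis using extensionsD[OF eX] by blast
qed

text \<open>The same construction in the second variable: \<open>\<psi>\<close> lives on
  Ext(\<sigma> c, c) and corresponds to \<open>\<theta>\<close>, and \<open>\<psi>\<close> after the
  pushout along \<open>f\<close> corresponds to \<open>\<theta> \<bullet> f\<close>. This is nonzero
  because \<open>\<theta>\<close> has the left inverse \<open>\<epsilon>\<close>.\<close>

lemma ex_monomorphism_not_factor:
  assumes f: "f \<in> Hom C Y c" "f \<noteq> Zero C Y c"
  shows "\<exists>i. monomorphism C i \<and> Dom C i = Y \<and> f \<notin> Im_Hom (opposite C) c i"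
proof -
  have O: "c \<in> Obj C" "Y \<in> Obj C" using Hom_Obj[OF f(1)] by auto
  define d where "d = on_Obj \<sigma> c"
  have d: "d \<in> Obj C" unfolding d_def by (rule \<sigma>_Obj[OF O(1)])
  obtain \<epsilon> \<theta> where \<epsilon>: "\<epsilon> \<in> Hom C (on_Obj \<tau> d) c" and \<theta>: "\<theta> \<in> Hom C c (on_Obj \<tau> d)" and \<epsilon>\<theta>: "\<epsilon> \<bullet> \<theta> = Ide C c"
    unfolding d_def by (rule ex_iso_\<tau>\<sigma>[OF O(1)])
  obtain \<psi> where \<psi>: "\<psi> \<in> linear_maps k (Ext1 C d c) E" "\<Phi> d c \<psi> = \<theta>" by (rule \<Phi>_surj[OF d \<theta>])
  have "\<theta> \<bullet> f \<noteq> Zero C Y (on_Obj \<tau> d)"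
  proof
    assume "\<theta> \<bullet> f = Zero C Y (on_Obj \<tau> d)"
    then have "\<epsilon> \<bullet> \<theta> \<bullet> f = Zero C Y c" using \<epsilon> O d by (simp add: Hom_def)
    moreover have "\<epsilon> \<bullet> \<theta> \<bullet> f = f" using Comp_assoc[OF f(1) \<theta> \<epsilon>] \<epsilon>\<theta> f(1) by (simp add: Ide_Comp)
    ultimately show False using f(2) by simp
  qed
  moreover have "\<Phi> d Y (compose (Ext d Y) \<psi> (ext_push C f)) = \<theta> \<bullet> f"
    using \<Phi>_push[OF d f(1) \<psi>(1)] \<psi>(2) by simp
  ultimately have "\<not> (\<forall>\<xi>\<in>Ext d Y. compose (Ext d Y) \<psi> (ext_push C f) \<xi> = \<zero>\<^bsub>E\<^esub>)"
    using \<Phi>_vanishing[OF d O(2) compose_push_linear[OF f(1) d \<psi>(1)]] by metis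
  then obtain \<xi> where \<xi>: "\<xi> \<in> Ext d Y" "\<psi> (ext_push C f \<xi>) \<noteq> \<zero>\<^bsub>E\<^esub>" by (auto simp: compose_def)
  then have ns: "ext_push C f \<xi> \<noteq> split_extensions C d c" using functional_split[OF \<psi>(1) d O(1)] by metis
  obtain i p where e: "(i, p) \<in> \<xi>" using Ext_nonempty[OF \<xi>(1)] by auto
  have eX: "(i, p) \<in> extensions C d Y" using Ext_subset[OF \<xi>(1)] e by blast
  have "f \<notin> Im_Hom (opposite C) c i" using ns ext_push_split_iff[OF \<xi>(1) e f(1)] unfolding Im_Hom_def by force
  then show ?thesis using extensionsD[OF eX] by blast
qed

section \<open>Characterisation of right and left determined morphisms\<close>

lemma hom_finite_opposite: "hom_finite k (opposite C)"
  using fin unfolding hom_finite_def by simp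

theorem right_determined_iff_epimorphism:
  assumes "\<alpha> \<in> Arr C"
  shows "(\<exists>c\<in>Obj C. right_determined C \<alpha> c) \<longleftrightarrow> epimorphism C \<alpha>"
proof
  assume "\<exists>c\<in>Obj C. right_determined C \<alpha> c"
  then show "epimorphism C \<alpha>"
    using right_determined_imp_epimorphism[OF artinian fin ex_epimorphism_not_factor] by blast
next
  assume "epimorphism C \<alpha>"
  moreover obtain i where "is_kernel C \<alpha> i" using ex_kernel[OF assms] by blast
  ultimately show "\<exists>c\<in>Obj C. right_determined C \<alpha> c"
    using epimorphism_right_determined unfolding right_determined_def by blast
qed

theorem left_determined_iff_monomorphism:
  assumes "\<beta> \<in> Arr C"
  shows "(\<exists>c\<in>Obj C. left_determined C \<beta> c) \<longleftrightarrow> monomorphism C \<beta>"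
proof
  assume "\<exists>c\<in>Obj C. left_determined C \<beta> c"
  then obtain c where "right_determined (opposite C) \<beta> c" unfolding left_determined_def by blast
  \<comment> \<open>The chain argument runs in \<open>opposite C\<close>, on images inside Hom(Y, c)
    with Y the domain of \<open>\<beta>\<close>; its separation hypothesis is
    \<open>ex_monomorphism_not_factor\<close>.\<close>
  from abelian_category.right_determined_imp_epimorphism[OF abelian_category_opposite artinian hom_finite_opposite _ this]
  show "monomorphism C \<beta>" using ex_monomorphism_not_factor by simp
next
  assume "monomorphism C \<beta>"
  moreover obtain p where p: "is_cokernel C \<beta> p" using ex_cokernel[OF assms] by blast
  ultimately have "left_determined C \<beta> (on_Obj \<tau> (Cod C p))" by (rule monomorphism_left_determined)
  then show "\<exists>c\<in>Obj C. left_determined C \<beta> c" unfolding left_determined_def right_determined_def by auto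
qed

end

theorem mainTheorem3:
  fixes k :: "('k, 'x) ring_scheme"
    and E :: "('k, 'e, 'y) module_scheme"
    and C :: "('k, 'o, 'm) lincat"
    and \<tau> \<tau>_inv :: "('o, 'm, 'o, 'm) functor_data"
  assumes "artinian_cring k"
    and "minimal_injective_cogenerator k E"
    and "abelian_category k C"
    and "hom_finite k C"
    and "serre_duality k E C \<tau>"
    and "quasi_inverse C C \<tau> \<tau>_inv"
  shows "(\<forall>X\<in>Obj C. \<forall>Y\<in>Obj C. \<forall>\<alpha>\<in>Hom C X Y.
            ((\<exists>c\<in>Obj C. right_determined C \<alpha> c) \<longleftrightarrow> epimorphism C \<alpha>) \<and>
            (epimorphism C \<alpha> \<longrightarrow>
               (\<forall>i. is_kernel C \<alpha> i \<longrightarrow> right_determined C \<alpha> (on_Obj \<tau>_inv (Dom C i))))) \<and>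
         (\<forall>Y\<in>Obj C. \<forall>Z\<in>Obj C. \<forall>\<beta>\<in>Hom C Y Z.
            ((\<exists>c\<in>Obj C. left_determined C \<beta> c) \<longleftrightarrow> monomorphism C \<beta>) \<and>
            (monomorphism C \<beta> \<longrightarrow>
               (\<forall>p. is_cokernel C \<beta> p \<longrightarrow> left_determined C \<beta> (on_Obj \<tau> (Cod C p)))))"
proof -
  interpret C: abelian_category k C by fact
  obtain \<Phi> where \<Phi>1: "\<forall>X\<in>Obj C. \<forall>Y\<in>Obj C.
          \<Phi> X Y \<in> linear_maps k (Hom_module k (Ext1 C X Y) E) (HomMod C Y (on_Obj \<tau> X)) \<and>
          bij_betw (\<Phi> X Y) (carrier (Hom_module k (Ext1 C X Y) E)) (Hom C Y (on_Obj \<tau> X))"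
    and \<Phi>2: "\<forall>X\<in>Obj C. \<forall>X'\<in>Obj C. \<forall>Y\<in>Obj C. \<forall>f\<in>Hom C X X'.
          \<forall>\<phi>\<in>carrier (Hom_module k (Ext1 C X Y) E).
            \<Phi> X' Y (compose (carrier (Ext1 C X' Y)) \<phi> (ext_pull C f)) = on_Arr \<tau> f \<bullet>\<^bsub>C\<^esub> \<Phi> X Y \<phi>"
    and \<Phi>3: "\<forall>X\<in>Obj C. \<forall>Y\<in>Obj C. \<forall>Y'\<in>Obj C. \<forall>h\<in>Hom C Y' Y.
          \<forall>\<phi>\<in>carrier (Hom_module k (Ext1 C X Y) E).
            \<Phi> X Y' (compose (carrier (Ext1 C X Y')) \<phi> (ext_push C h)) = \<Phi> X Y \<phi> \<bullet>\<^bsub>C\<^esub> h"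
    using assms(5) unfolding serre_duality_def by blast
  have car: "carrier (Hom_module k (Ext1 C X Y) E) = linear_maps k (Ext1 C X Y) E" for X Y
    by (simp add: Hom_module_def)
  \<comment> \<open>The quasi-inverse is the one given in the statement, not the one whose existence
    \<open>serre_duality\<close> asserts.\<close>
  interpret serre_category k C E \<tau> \<tau>_inv \<Phi>
  proof (intro serre_category.intro serre_category_axioms.intro)
    show "abelian_category k C" "artinian_cring k" "hom_finite k C" "quasi_inverse C C \<tau> \<tau>_inv" by fact+
    show "injective_cogenerator k E" using assms(2) unfolding minimal_injective_cogenerator_def by blast
    show "is_linear_functor k C C \<tau>" using assms(5) unfolding serre_duality_def by blast
  qed (use \<Phi>1 \<Phi>2 \<Phi>3 C.Hom_Obj in \<open>simp_all add: car\<close>)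
  show ?thesis
    using right_determined_iff_epimorphism epimorphism_right_determined
      left_determined_iff_monomorphism monomorphism_left_determined C.HomD by blast
qed

end
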